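(* Let $\kappa \le \infty$ be an uncountable regular cardinal, and let $\Phi$ be a class of $\kappa$-small presheaves. Then for any category $\mathcal{C}$ and presheaf $\phi : \mathcal{C}^{op} \to \mathrm{Set}$, we have $\phi \in \Phi^*[\mathcal{C}]$ if and only if there is a $\kappa$-small subcategory $\mathcal{D} \subseteq \mathcal{C}$ such that $\phi$ is the left Kan extension, along the inclusion $\mathcal{D}^{op} \to \mathcal{C}^{op}$, of some $\psi \in \Phi^*[\mathcal{D}]$ (which is then necessarily a $\kappa$-small presheaf).
   Context: Categories are locally small by default. $\infty$ denotes the bound on the fixed universe of small sets, so "$\infty$-small" means small; "$\kappa$-small" means of size $<\kappa$ (a category is $\kappa$-small if it has fewer than $\kappa$ morphisms). Subcategories are not required to be full. A $\kappa$-small presheaf is a presheaf $\phi : \mathcal{J}^{op} \to \mathrm{Set}$ such that $\mathcal{J}$ is a $\kappa$-small category and $\phi$ takes values in sets of size $<\kappa$. For a presheaf $\phi\in[\mathcal{J}^{op},\mathrm{Set}]$ and a diagram $F : \mathcal{J} \to \mathcal{A}$, the $\phi$-weighted colimit $\phi\star F$ is the colimit of the composite of the canonical projection from the category of elements of $\phi$ to $\mathcal{J}$ with $F$. For a class $\Phi$ of presheaves (on various categories), a $\Phi$-colimit is a colimit weighted by some $\phi\in\Phi$. $\Phi^*[\mathcal{C}]$ is the (replete) closure of the representables in $[\mathcal{C}^{op},\mathrm{Set}]$ under $\Phi$-colimits, i.e., the smallest replete full subcategory containing the representables and closed under $\Phi$-colimits. *)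

theory Defs
  imports Main "HOL-Library.FuncSet"
begin

unbundle cardinal_syntax

section \<open>Categories, functors, natural transformations\<close>

text \<open>Categories are given by families of hom-sets. Hom-sets for different pairs of objects need
  not be disjoint, so operations on arrows also take the relevant objects as arguments:
  for \<open>f : a \<rightarrow> b\<close> and \<open>g : b \<rightarrow> c\<close>, the composite is \<open>Comp C a b c g f : a \<rightarrow> c\<close>.\<close>

record ('o, 'm) cat =
  Obj :: "'o set"
  Hom :: "'o \<Rightarrow> 'o \<Rightarrow> 'm set"
  Ident :: "'o \<Rightarrow> 'm"
  Comp :: "'o \<Rightarrow> 'o \<Rightarrow> 'o \<Rightarrow> 'm \<Rightarrow> 'm \<Rightarrow> 'm"

locale category =
  fixes C :: "('o, 'm) cat"
  assumes ident_in_hom: "a \<in> Obj C \<Longrightarrow> Ident C a \<in> Hom C a a"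
    and comp_in_hom: "\<lbrakk>a \<in> Obj C; b \<in> Obj C; c \<in> Obj C; f \<in> Hom C a b; g \<in> Hom C b c\<rbrakk>
      \<Longrightarrow> Comp C a b c g f \<in> Hom C a c"
    and comp_ident_right: "\<lbrakk>a \<in> Obj C; b \<in> Obj C; f \<in> Hom C a b\<rbrakk>
      \<Longrightarrow> Comp C a a b f (Ident C a) = f"
    and comp_ident_left: "\<lbrakk>a \<in> Obj C; b \<in> Obj C; f \<in> Hom C a b\<rbrakk>
      \<Longrightarrow> Comp C a b b (Ident C b) f = f"
    and comp_assoc: "\<lbrakk>a \<in> Obj C; b \<in> Obj C; c \<in> Obj C; d \<in> Obj C;
        f \<in> Hom C a b; g \<in> Hom C b c; h \<in> Hom C c d\<rbrakk>
      \<Longrightarrow> Comp C a c d h (Comp C a b c g f) = Comp C a b d (Comp C b c d h g) f"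

definition opcat :: "('o, 'm) cat \<Rightarrow> ('o, 'm) cat" where
  "opcat C = \<lparr>Obj = Obj C, Hom = (\<lambda>a b. Hom C b a), Ident = Ident C,
     Comp = (\<lambda>a b c g f. Comp C c b a f g)\<rparr>"

text \<open>Not required to be full.\<close>

definition subcategory :: "('o, 'm) cat \<Rightarrow> ('o, 'm) cat \<Rightarrow> bool" where
  "subcategory D C \<longleftrightarrow> category D \<and> Obj D \<subseteq> Obj C \<and>
     (\<forall>a\<in>Obj D. \<forall>b\<in>Obj D. Hom D a b \<subseteq> Hom C a b) \<and>
     (\<forall>a\<in>Obj D. Ident D a = Ident C a) \<and>
     (\<forall>a\<in>Obj D. \<forall>b\<in>Obj D. \<forall>c\<in>Obj D. \<forall>f\<in>Hom D a b. \<forall>g\<in>Hom D b c.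
        Comp D a b c g f = Comp C a b c g f)"

definition isomorphic :: "('o, 'm) cat \<Rightarrow> 'o \<Rightarrow> 'o \<Rightarrow> bool" where
  "isomorphic C a b \<longleftrightarrow> a \<in> Obj C \<and> b \<in> Obj C \<and>
     (\<exists>f\<in>Hom C a b. \<exists>g\<in>Hom C b a. Comp C a b a g f = Ident C a \<and> Comp C b a b f g = Ident C b)"

record ('a, 'f, 'b, 'g) fctr =
  OMap :: "'a \<Rightarrow> 'b"
  AMap :: "'a \<Rightarrow> 'a \<Rightarrow> 'f \<Rightarrow> 'g"

locale is_functor =
  dom: category C + cod: category D
  for C :: "('a, 'f) cat" and D :: "('b, 'g) cat" +
  fixes F :: "('a, 'f, 'b, 'g) fctr"
  assumes omap_in_obj: "a \<in> Obj C \<Longrightarrow> OMap F a \<in> Obj D"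
    and amap_in_hom: "\<lbrakk>a \<in> Obj C; b \<in> Obj C; f \<in> Hom C a b\<rbrakk>
      \<Longrightarrow> AMap F a b f \<in> Hom D (OMap F a) (OMap F b)"
    and amap_ident: "a \<in> Obj C \<Longrightarrow> AMap F a a (Ident C a) = Ident D (OMap F a)"
    and amap_comp: "\<lbrakk>a \<in> Obj C; b \<in> Obj C; c \<in> Obj C; f \<in> Hom C a b; g \<in> Hom C b c\<rbrakk>
      \<Longrightarrow> AMap F a c (Comp C a b c g f)
          = Comp D (OMap F a) (OMap F b) (OMap F c) (AMap F b c g) (AMap F a b f)"

definition fcomp ::
  "('b, 'g, 'c, 'h) fctr \<Rightarrow> ('a, 'f, 'b, 'g) fctr \<Rightarrow> ('a, 'f, 'c, 'h) fctr" (infixl "\<circ>F" 55) where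
  "G \<circ>F F = \<lparr>OMap = (\<lambda>a. OMap G (OMap F a)),
     AMap = (\<lambda>a b f. AMap G (OMap F a) (OMap F b) (AMap F a b f))\<rparr>"

text \<open>The underlying map of the inclusion of a subcategory and of its opposite.\<close>

definition inclusion :: "('o, 'm, 'o, 'm) fctr" where
  "inclusion = \<lparr>OMap = (\<lambda>a. a), AMap = (\<lambda>a b f. f)\<rparr>"

text \<open>Families of arrows are extensional, so that equality of natural transformations is
  equality of their components at the objects of \<open>C\<close>.\<close>

definition nat_trans ::
  "('a, 'f) cat \<Rightarrow> ('b, 'g) cat \<Rightarrow> ('a, 'f, 'b, 'g) fctr \<Rightarrow> ('a, 'f, 'b, 'g) fctr \<Rightarrow> ('a \<Rightarrow> 'g) set" where
  "nat_trans C D F G = {\<alpha> \<in> (\<Pi>\<^sub>E a\<in>Obj C. Hom D (OMap F a) (OMap G a)).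
     \<forall>a\<in>Obj C. \<forall>b\<in>Obj C. \<forall>f\<in>Hom C a b.
       Comp D (OMap F a) (OMap F b) (OMap G b) (\<alpha> b) (AMap F a b f)
       = Comp D (OMap F a) (OMap G a) (OMap G b) (AMap G a b f) (\<alpha> a)}"

definition funcat :: "('a, 'f) cat \<Rightarrow> ('b, 'g) cat \<Rightarrow> (('a, 'f, 'b, 'g) fctr, 'a \<Rightarrow> 'g) cat" where
  "funcat C D = \<lparr>Obj = {F. is_functor C D F}, Hom = nat_trans C D,
     Ident = (\<lambda>F. \<lambda>a\<in>Obj C. Ident D (OMap F a)),
     Comp = (\<lambda>F G H \<beta> \<alpha>. \<lambda>a\<in>Obj C. Comp D (OMap F a) (OMap G a) (OMap H a) (\<beta> a) (\<alpha> a))\<rparr>"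


section \<open>Size and presheaves\<close>

text \<open>The bound of the universe is the cardinality of a type \<open>'u\<close>. A set is small if its
  cardinality is less than that; every small set is in bijection with a subset of \<open>'u\<close>, so
  the small subsets of \<open>'u\<close> and all maps between them form the category of small sets.\<close>

abbreviation infty :: "'u rel" where
  "infty \<equiv> |UNIV :: 'u set|"

definition setcat :: "('u set, 'u \<Rightarrow> 'u) cat" where
  "setcat = \<lparr>Obj = {A :: 'u set. |A| <o (infty :: 'u rel)}, Hom = (\<lambda>A B. A \<rightarrow>\<^sub>E B),
     Ident = (\<lambda>A. \<lambda>x\<in>A. x), Comp = (\<lambda>A B C g f. compose A g f)\<rparr>"

definition locally_small_cat :: "'k rel \<Rightarrow> ('o, 'm) cat \<Rightarrow> bool" where
  "locally_small_cat \<kappa> C \<longleftrightarrow> (\<forall>a\<in>Obj C. \<forall>b\<in>Obj C. |Hom C a b| <o \<kappa>)"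

definition arrows :: "('o, 'm) cat \<Rightarrow> ('o \<times> 'o \<times> 'm) set" where
  "arrows C = {(a, b, f). a \<in> Obj C \<and> b \<in> Obj C \<and> f \<in> Hom C a b}"

definition small_cat :: "'k rel \<Rightarrow> ('o, 'm) cat \<Rightarrow> bool" where
  "small_cat \<kappa> C \<longleftrightarrow> |arrows C| <o \<kappa>"

type_synonym ('o, 'm, 'u) presheaf = "('o, 'm, 'u set, 'u \<Rightarrow> 'u) fctr"

abbreviation is_presheaf :: "('o, 'm) cat \<Rightarrow> ('o, 'm, 'u) presheaf \<Rightarrow> bool" where
  "is_presheaf C \<phi> \<equiv> is_functor (opcat C) setcat \<phi>"

definition psh :: "('o, 'm) cat \<Rightarrow> (('o, 'm, 'u) presheaf, 'o \<Rightarrow> 'u \<Rightarrow> 'u) cat" where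
  "psh C = funcat (opcat C) setcat"

definition small_presheaf :: "'k rel \<Rightarrow> ('o, 'm) cat \<Rightarrow> ('o, 'm, 'u) presheaf \<Rightarrow> bool" where
  "small_presheaf \<kappa> C \<phi> \<longleftrightarrow>
     is_presheaf C \<phi> \<and> small_cat \<kappa> C \<and> (\<forall>a\<in>Obj C. |OMap \<phi> a| <o \<kappa>)"

text \<open>Hom-sets are sets of arrows rather than subsets of \<open>'u\<close>, so the natural isomorphism from
  \<open>C(-, c)\<close> to the presheaf \<open>\<phi>\<close> is spelled out as a family of bijections.\<close>

definition representable :: "('o, 'm) cat \<Rightarrow> ('o, 'm, 'u) presheaf \<Rightarrow> bool" where
  "representable C \<phi> \<longleftrightarrow> is_presheaf C \<phi> \<and>
     (\<exists>c\<in>Obj C. \<exists>\<theta>. (\<forall>a\<in>Obj C. bij_betw (\<theta> a) (Hom C a c) (OMap \<phi> a)) \<and>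
       (\<forall>a\<in>Obj C. \<forall>b\<in>Obj C. \<forall>f\<in>Hom C a b. \<forall>h\<in>Hom C b c.
          \<theta> a (Comp C a b c h f) = AMap \<phi> b a f (\<theta> b h)))"


section \<open>Weighted colimits\<close>

definition cocone :: "('j, 'f) cat \<Rightarrow> ('a, 'g) cat \<Rightarrow> ('j, 'f, 'a, 'g) fctr \<Rightarrow> 'a \<Rightarrow> ('j \<Rightarrow> 'g) \<Rightarrow> bool" where
  "cocone J A F L l \<longleftrightarrow> L \<in> Obj A \<and> (\<forall>i\<in>Obj J. l i \<in> Hom A (OMap F i) L) \<and>
     (\<forall>i\<in>Obj J. \<forall>j\<in>Obj J. \<forall>f\<in>Hom J i j.
        Comp A (OMap F i) (OMap F j) L (l j) (AMap F i j f) = l i)"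

definition is_colimit :: "('j, 'f) cat \<Rightarrow> ('a, 'g) cat \<Rightarrow> ('j, 'f, 'a, 'g) fctr \<Rightarrow> 'a \<Rightarrow> bool" where
  "is_colimit J A F L \<longleftrightarrow> (\<exists>l. cocone J A F L l \<and>
     (\<forall>L' l'. cocone J A F L' l' \<longrightarrow>
        (\<exists>!h. h \<in> Hom A L L' \<and> (\<forall>i\<in>Obj J. Comp A (OMap F i) L L' h (l i) = l' i))))"

definition elements :: "('j, 'f) cat \<Rightarrow> ('j, 'f, 'u) presheaf \<Rightarrow> ('j \<times> 'u, 'f) cat" where
  "elements J \<phi> = \<lparr>Obj = {(j, x). j \<in> Obj J \<and> x \<in> OMap \<phi> j},
     Hom = (\<lambda>(i, x) (j, y). {f \<in> Hom J i j. AMap \<phi> j i f y = x}),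
     Ident = (\<lambda>(j, x). Ident J j),
     Comp = (\<lambda>(i, x) (j, y) (k, z). Comp J i j k)\<rparr>"

definition elements_proj :: "('j \<times> 'u, 'f, 'j, 'f) fctr" where
  "elements_proj = \<lparr>OMap = fst, AMap = (\<lambda>_ _ f. f)\<rparr>"

text \<open>\<open>L\<close> is (a choice of) the weighted colimit \<open>\<phi> \<star> F\<close>.\<close>

definition is_weighted_colimit ::
  "('j, 'f) cat \<Rightarrow> ('j, 'f, 'u) presheaf \<Rightarrow> ('a, 'g) cat \<Rightarrow> ('j, 'f, 'a, 'g) fctr \<Rightarrow> 'a \<Rightarrow> bool" where
  "is_weighted_colimit J \<phi> A F L \<longleftrightarrow> is_colimit (elements J \<phi>) A (F \<circ>F elements_proj) L"

text \<open>A class of presheaves on various categories is a set of pairs \<open>(J, \<phi>)\<close> with \<open>\<phi>\<close> a presheaf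
  on \<open>J\<close>. A full subcategory is represented by its set of objects.\<close>

definition closed_under_colimits ::
  "(('i, 'j) cat \<times> ('i, 'j, 'u) presheaf) set \<Rightarrow> ('a, 'g) cat \<Rightarrow> 'a set \<Rightarrow> bool" where
  "closed_under_colimits \<Phi> A S \<longleftrightarrow>
     (\<forall>(J, \<phi>)\<in>\<Phi>. \<forall>F L. is_functor J A F \<and> (\<forall>j\<in>Obj J. OMap F j \<in> S) \<and> is_weighted_colimit J \<phi> A F L
        \<longrightarrow> L \<in> S)"

definition replete :: "('a, 'g) cat \<Rightarrow> 'a set \<Rightarrow> bool" where
  "replete A S \<longleftrightarrow> S \<subseteq> Obj A \<and> (\<forall>x\<in>S. \<forall>y. isomorphic A x y \<longrightarrow> y \<in> S)"

text \<open>The objects of \<open>\<Phi>\<^sup>*[C]\<close>.\<close>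

definition phi_star ::
  "(('i, 'j) cat \<times> ('i, 'j, 'u) presheaf) set \<Rightarrow> ('o, 'm) cat \<Rightarrow> ('o, 'm, 'u) presheaf set" where
  "phi_star \<Phi> C = \<Inter>{S. replete (psh C) S \<and> {\<phi>. representable C \<phi>} \<subseteq> S
                        \<and> closed_under_colimits \<Phi> (psh C) S}"


section \<open>Left Kan extensions\<close>

definition whisker :: "('d, 'f) cat \<Rightarrow> ('d, 'f, 'c, 'g) fctr \<Rightarrow> ('c \<Rightarrow> 'h) \<Rightarrow> 'd \<Rightarrow> 'h" where
  "whisker D K \<gamma> = (\<lambda>d\<in>Obj D. \<gamma> (OMap K d))"

definition is_left_kan_extension ::
  "('d, 'f) cat \<Rightarrow> ('c, 'g) cat \<Rightarrow> ('e, 'h) cat \<Rightarrow> ('d, 'f, 'c, 'g) fctr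
   \<Rightarrow> ('d, 'f, 'e, 'h) fctr \<Rightarrow> ('c, 'g, 'e, 'h) fctr \<Rightarrow> bool" where
  "is_left_kan_extension D C E K F L \<longleftrightarrow>
     is_functor D C K \<and> is_functor D E F \<and> is_functor C E L \<and>
     (\<exists>\<eta>\<in>nat_trans D E F (L \<circ>F K). \<forall>G. is_functor C E G \<longrightarrow> (\<forall>\<beta>\<in>nat_trans D E F (G \<circ>F K).
        \<exists>!\<gamma>. \<gamma> \<in> nat_trans C E L G \<and>
          Comp (funcat D E) F (L \<circ>F K) (G \<circ>F K) (whisker D K \<gamma>) \<eta> = \<beta>))"

end

theory Submission
  imports Defs
begin

text \<open>Restriction of presheaves along the inclusion of a subcategory \<open>D\<close> of \<open>C\<close> has the left Kan extension
as a left adjoint. Therefore left Kan extension preserves colimits (\<open>lan_colimit\<close>); it also sends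
representables to representables, with the same representing object
(\<open>pointwise_lan_representable\<close>). Hence it sends \<open>\<Phi>\<^sup>*[D]\<close> into \<open>\<Phi>\<^sup>*[C]\<close> (\<open>phi_star_lan\<close>), which is one
half of the theorem.

For the other half, call a presheaf on \<open>C\<close> descending if it is the left Kan extension of some
\<open>\<psi> \<in> \<Phi>\<^sup>*[D]\<close> with \<open>D\<close> \<open>\<kappa>\<close>-small. A representable descends to the subcategory formed by one identity.
The point is that descending presheaves are closed under \<open>\<Phi>\<close>-colimits. Let \<open>F\<close> be a diagram on \<open>J\<close> in
which \<open>F j\<close> is the left Kan extension of \<open>\<psi>\<^sub>j \<in> \<Phi>\<^sup>*[D\<^sub>j]\<close> with unit \<open>\<eta>\<^sub>j\<close>. The elements of \<open>F j\<close> at \<open>c\<close> are represented by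
pairs of an arrow \<open>g : c \<rightarrow> d\<close> with \<open>d\<close> in \<open>D\<^sub>j\<close> and an element of \<open>\<psi>\<^sub>j d\<close>, and two pairs represent the same
element iff they are joined by a finite zigzag (\<open>natural_lan_imp_pointwise_lan\<close>). Choose a \<open>\<kappa>\<close>-small
subcategory \<open>E\<close> that contains all \<open>D\<^sub>j\<close> such that

\<^item> for every arrow \<open>f : i \<rightarrow> j\<close> of \<open>J\<close> and every element \<open>y\<close> of \<open>\<psi>\<^sub>i\<close>, the image of \<open>\<eta>\<^sub>i y\<close> under \<open>F f\<close> is represented by
  an arrow of \<open>E\<close>;

\<^item> two pairs with arrows in \<open>E\<close> that represent the same element of \<open>F j\<close> are joined by a zigzag in \<open>E\<close>.

At every stage there are fewer than \<open>\<kappa>\<close> instances of these requirements, each asking for finitely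
many arrows, but new arrows create new instances of the second one; since \<open>\<kappa>\<close> is regular and uncountable, repeating
the process countably often yields such an \<open>E\<close> (\<open>descent_subcategory\<close>). Let \<open>G j\<close> consist of the elements
of \<open>F j\<close> that are represented by arrows of \<open>E\<close>. By the second requirement \<open>G j\<close> is the left Kan extension
of \<open>\<psi>\<^sub>j\<close> to \<open>E\<close>, so it lies in \<open>\<Phi>\<^sup>*[E]\<close>, and its left Kan extension to \<open>C\<close> is \<open>F j\<close>. By the first one the maps
\<open>F f\<close> restrict to \<open>G\<close>. Because the descended presheaves are realised as subobjects
of the \<open>F j\<close>, the restricted maps inherit functoriality from \<open>F\<close>. The weighted colimit of \<open>G\<close> thus lies in \<open>\<Phi>\<^sup>*[E]\<close>, and its left Kan extension is the one of \<open>F\<close>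
(\<open>descends_colimit\<close>).

Finally, over a \<open>\<kappa>\<close>-small category the presheaves with values of size below \<open>\<kappa>\<close> contain the
representables and are closed under \<open>\<kappa>\<close>-small colimits, which gives the size of \<open>\<psi>\<close>
(\<open>phi_star_small\<close>).\<close>

section \<open>Sets of size below a regular cardinal\<close>

locale regular_cardinal =
  fixes \<kappa> :: "'k rel"
  assumes card_order: "Card_order \<kappa>" and infinite_field: "\<not> finite (Field \<kappa>)"
    and regular: "regularCard \<kappa>"
begin

lemma is_stable: "stable \<kappa>"
  using card_order infinite_field regular by (rule regularCard_stable)

lemma small_Sigma: "|A| <o \<kappa> \<Longrightarrow> (\<And>a. a \<in> A \<Longrightarrow> |B a| <o \<kappa>) \<Longrightarrow> |Sigma A B| <o \<kappa>"
  using is_stable by (auto intro: stable_elim)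

lemma small_UN: "|A| <o \<kappa> \<Longrightarrow> (\<And>a. a \<in> A \<Longrightarrow> |B a| <o \<kappa>) \<Longrightarrow> |\<Union>a\<in>A. B a| <o \<kappa>"
  using is_stable by (auto intro: stable_UNION)

lemma small_Un: "|A| <o \<kappa> \<Longrightarrow> |B| <o \<kappa> \<Longrightarrow> |A \<union> B| <o \<kappa>"
  using card_of_Un_ordLess_infinite_Field[OF infinite_field card_order] by blast

lemma small_finite: "finite A \<Longrightarrow> |A| <o \<kappa>"
  using finite_ordLess_infinite[OF card_of_Well_order, of \<kappa> A] card_order infinite_field
  by (auto simp: card_order_on_def Field_card_of)

end

lemma small_image: "|A| <o \<kappa> \<Longrightarrow> |f ` A| <o \<kappa>"
  by (rule ordLeq_ordLess_trans[OF card_of_image])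

lemma small_subset: "|B| <o \<kappa> \<Longrightarrow> A \<subseteq> B \<Longrightarrow> |A| <o \<kappa>"
  by (rule ordLeq_ordLess_trans[OF card_of_mono1])

lemma small_inj: "|B| <o \<kappa> \<Longrightarrow> inj_on f A \<Longrightarrow> f ` A \<subseteq> B \<Longrightarrow> |A| <o \<kappa>"
  by (rule ordLeq_ordLess_trans[OF iffD1[OF card_of_ordLeq]]) auto

lemma regular_cardinalI:
  assumes "Card_order \<kappa>" "regularCard \<kappa>" "natLeq <o \<kappa>"
  shows "regular_cardinal \<kappa>"
proof
  have "|UNIV :: nat set| \<le>o |Field \<kappa>|"
    using assms(1,3) card_of_nat card_of_Field_ordIso
    by (meson ordIso_ordLeq_trans ordIso_symmetric ordLeq_ordIso_trans ordLess_imp_ordLeq)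
  then show "\<not> finite (Field \<kappa>)"
    using card_of_ordLeq_infinite infinite_UNIV_nat by blast
qed (use assms in auto)

lemma regular_cardinal_infty:
  assumes "regularCard (infty :: 'u rel)" "natLeq <o \<kappa>" "\<kappa> \<le>o (infty :: 'u rel)"
  shows "regular_cardinal (infty :: 'u rel)"
  using assms by (intro regular_cardinalI) (auto intro: ordLess_ordLeq_trans card_of_Card_order)

section \<open>Presheaves in terms of elements\<close>

lemma category_opcat: "category C \<Longrightarrow> category (opcat C)"
  unfolding category_def opcat_def by simp

lemma category_setcat: "category setcat"
  by unfold_locales
    (auto simp: setcat_def compose_def PiE_def extensional_def restrict_def fun_eq_iff Pi_def)

text \<open>The maps of natural families occurring below are often only specified on the sets that they
  are meant for; \<open>natural\<close> ignores the values elsewhere, and \<open>normalise\<close> removes them.\<close>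

definition natural ::
  "('o, 'm) cat \<Rightarrow> ('o, 'm, 'u) presheaf \<Rightarrow> ('o, 'm, 'u) presheaf \<Rightarrow> ('o \<Rightarrow> 'u \<Rightarrow> 'u) \<Rightarrow> bool" where
  "natural C P Q \<alpha> \<longleftrightarrow> (\<forall>a\<in>Obj C. \<forall>x\<in>OMap P a. \<alpha> a x \<in> OMap Q a) \<and>
     (\<forall>a\<in>Obj C. \<forall>b\<in>Obj C. \<forall>f\<in>Hom C a b. \<forall>x\<in>OMap P b.
        \<alpha> a (AMap P b a f x) = AMap Q b a f (\<alpha> b x))"

definition normalise ::
  "('o, 'm) cat \<Rightarrow> ('o, 'm, 'u) presheaf \<Rightarrow> ('o \<Rightarrow> 'u \<Rightarrow> 'u) \<Rightarrow> 'o \<Rightarrow> 'u \<Rightarrow> 'u" where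
  "normalise C P \<alpha> = (\<lambda>a\<in>Obj C. \<lambda>x\<in>OMap P a. \<alpha> a x)"

definition agree ::
  "('o, 'm) cat \<Rightarrow> ('o, 'm, 'u) presheaf \<Rightarrow> ('o \<Rightarrow> 'u \<Rightarrow> 'u) \<Rightarrow> ('o \<Rightarrow> 'u \<Rightarrow> 'u) \<Rightarrow> bool" where
  "agree C P \<alpha> \<beta> \<longleftrightarrow> (\<forall>a\<in>Obj C. \<forall>x\<in>OMap P a. \<alpha> a x = \<beta> a x)"

lemma normalise_apply [simp]: "a \<in> Obj C \<Longrightarrow> x \<in> OMap P a \<Longrightarrow> normalise C P \<alpha> a x = \<alpha> a x"
  by (simp add: normalise_def)

lemma normalise_eq_iff: "normalise C P \<alpha> = normalise C P \<beta> \<longleftrightarrow> agree C P \<alpha> \<beta>"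
  by (auto simp: normalise_def agree_def restrict_def fun_eq_iff)

lemma agree_refl [simp]: "agree C P \<alpha> \<alpha>"
  by (simp add: agree_def)

lemma agree_normalise [simp]: "agree C P (normalise C P \<alpha>) \<beta> \<longleftrightarrow> agree C P \<alpha> \<beta>"
    "agree C P \<beta> (normalise C P \<alpha>) \<longleftrightarrow> agree C P \<beta> \<alpha>"
  by (auto simp: agree_def)

lemma is_presheaf_iff:
  fixes P :: "('o, 'm, 'u) presheaf"
  assumes "category C"
  shows "is_presheaf C P \<longleftrightarrow>
    (\<forall>a\<in>Obj C. |OMap P a| <o (infty :: 'u rel)) \<and>
    (\<forall>a\<in>Obj C. \<forall>b\<in>Obj C. \<forall>f\<in>Hom C a b. AMap P b a f \<in> OMap P b \<rightarrow>\<^sub>E OMap P a) \<and>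
    (\<forall>a\<in>Obj C. \<forall>x\<in>OMap P a. AMap P a a (Ident C a) x = x) \<and>
    (\<forall>a\<in>Obj C. \<forall>b\<in>Obj C. \<forall>c\<in>Obj C. \<forall>f\<in>Hom C a b. \<forall>g\<in>Hom C b c. \<forall>x\<in>OMap P c.
       AMap P c a (Comp C a b c g f) x = AMap P b a f (AMap P c b g x))"
    (is "?L \<longleftrightarrow> ?R")
proof
  assume ?L
  then interpret is_functor "opcat C" setcat P .
  have hom: "AMap P b a f \<in> OMap P b \<rightarrow>\<^sub>E OMap P a"
    if "a \<in> Obj C" "b \<in> Obj C" "f \<in> Hom C a b" for a b f
    using amap_in_hom[of b a f] that by (simp add: opcat_def setcat_def)
  have comp: "AMap P c a (Comp C a b c g f) x = AMap P b a f (AMap P c b g x)"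
    if "a \<in> Obj C" "b \<in> Obj C" "c \<in> Obj C" "f \<in> Hom C a b" "g \<in> Hom C b c" "x \<in> OMap P c"
    for a b c f g x
    using amap_comp[of c b a g f] that by (simp add: opcat_def setcat_def compose_def)
  show ?R
    using omap_in_obj amap_ident hom comp
    by (auto simp: opcat_def setcat_def)
next
  assume R: ?R
  show ?L
  proof (intro is_functor.intro is_functor_axioms.intro category_opcat category_setcat assms)
    fix a b c f g
    assume *: "a \<in> Obj (opcat C)" "b \<in> Obj (opcat C)" "c \<in> Obj (opcat C)"
      "f \<in> Hom (opcat C) a b" "g \<in> Hom (opcat C) b c"
    then have *: "a \<in> Obj C" "b \<in> Obj C" "c \<in> Obj C" "f \<in> Hom C b a" "g \<in> Hom C c b"
      by (auto simp: opcat_def)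
    with R have "AMap P a c (Comp C c b a f g) \<in> OMap P a \<rightarrow>\<^sub>E OMap P c"
      using category.comp_in_hom[OF assms] by blast
    with R * show "AMap P a c (Comp (opcat C) a b c g f) =
       Comp setcat (OMap P a) (OMap P b) (OMap P c) (AMap P b c g) (AMap P a b f)"
      by (auto simp: opcat_def setcat_def compose_def fun_eq_iff PiE_def extensional_def)
  next
    fix a
    assume *: "a \<in> Obj (opcat C)"
    then have *: "a \<in> Obj C"
      by (auto simp: opcat_def)
    with R have "AMap P a a (Ident C a) \<in> OMap P a \<rightarrow>\<^sub>E OMap P a"
      using category.ident_in_hom[OF assms] by blast
    with R * show "AMap P a a (Ident (opcat C) a) = Ident setcat (OMap P a)"
      by (auto simp: opcat_def setcat_def fun_eq_iff PiE_def extensional_def)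
  qed (use R in \<open>auto simp: opcat_def setcat_def\<close>)
qed

lemma is_presheaf_category: "is_presheaf C P \<Longrightarrow> category C"
  by (auto simp: is_functor_def category_def opcat_def)

lemma
  assumes "is_presheaf C P"
  shows presheaf_size: "a \<in> Obj C \<Longrightarrow> |OMap P a| <o (infty :: 'u rel)"
    and presheaf_ext: "a \<in> Obj C \<Longrightarrow> b \<in> Obj C \<Longrightarrow> f \<in> Hom C a b \<Longrightarrow>
      AMap P b a f \<in> OMap P b \<rightarrow>\<^sub>E OMap (P :: ('o, 'm, 'u) presheaf) a"
    and presheaf_mem: "a \<in> Obj C \<Longrightarrow> b \<in> Obj C \<Longrightarrow> f \<in> Hom C a b \<Longrightarrow> x \<in> OMap P b \<Longrightarrow>
      AMap P b a f x \<in> OMap P a"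
    and presheaf_ident: "a \<in> Obj C \<Longrightarrow> x \<in> OMap P a \<Longrightarrow> AMap P a a (Ident C a) x = x"
    and presheaf_comp: "a \<in> Obj C \<Longrightarrow> b \<in> Obj C \<Longrightarrow> c \<in> Obj C \<Longrightarrow> f \<in> Hom C a b \<Longrightarrow>
      g \<in> Hom C b c \<Longrightarrow> x \<in> OMap P c \<Longrightarrow>
      AMap P c a (Comp C a b c g f) x = AMap P b a f (AMap P c b g x)"
  using assms is_presheaf_iff[OF is_presheaf_category[OF assms], of P] by (blast dest: PiE_mem)+

lemma natural_mem: "natural C P Q \<alpha> \<Longrightarrow> a \<in> Obj C \<Longrightarrow> x \<in> OMap P a \<Longrightarrow> \<alpha> a x \<in> OMap Q a"
  by (simp add: natural_def)

lemma natural_act: "natural C P Q \<alpha> \<Longrightarrow> a \<in> Obj C \<Longrightarrow> b \<in> Obj C \<Longrightarrow> f \<in> Hom C a b \<Longrightarrow>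
    x \<in> OMap P b \<Longrightarrow> \<alpha> a (AMap P b a f x) = AMap Q b a f (\<alpha> b x)"
  by (simp add: natural_def)

lemma natural_id: "natural C P P (\<lambda>a x. x)"
  by (simp add: natural_def)

lemma natural_comp: "natural C P Q \<alpha> \<Longrightarrow> natural C Q R \<beta> \<Longrightarrow> natural C P R (\<lambda>a x. \<beta> a (\<alpha> a x))"
  by (simp add: natural_def)

lemma natural_agree:
  assumes "is_presheaf C P" "agree C P \<alpha> \<beta>" 
  shows "natural C P Q \<alpha> \<longleftrightarrow> natural C P Q \<beta>"
  using assms(2) presheaf_mem[OF assms(1)] unfolding natural_def agree_def by auto

lemma natural_normalise [simp]: "is_presheaf C P \<Longrightarrow> natural C P Q (normalise C P \<alpha>) \<longleftrightarrow> natural C P Q \<alpha>"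
  by (rule natural_agree) (auto simp: agree_def)

lemma Obj_psh [simp]: "P \<in> Obj (psh C) \<longleftrightarrow> is_presheaf C P"
  by (simp add: psh_def funcat_def)

lemma Hom_psh:
  assumes "is_presheaf C P" "is_presheaf C Q"
  shows "\<alpha> \<in> Hom (psh C) P Q \<longleftrightarrow> natural C P Q \<alpha> \<and> normalise C P \<alpha> = \<alpha>"
proof -
  have ext: "(\<forall>a\<in>Obj C. \<alpha> a \<in> OMap P a \<rightarrow>\<^sub>E OMap Q a) \<and> \<alpha> \<in> extensional (Obj C) \<longleftrightarrow>
      (\<forall>a\<in>Obj C. \<forall>x\<in>OMap P a. \<alpha> a x \<in> OMap Q a) \<and> normalise C P \<alpha> = \<alpha>"
    by (auto simp: normalise_def PiE_def extensional_def restrict_def fun_eq_iff)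
  have act: "compose (OMap P b) (\<alpha> a) (AMap P b a f) = compose (OMap P b) (AMap Q b a f) (\<alpha> b)
      \<longleftrightarrow> (\<forall>x\<in>OMap P b. \<alpha> a (AMap P b a f x) = AMap Q b a f (\<alpha> b x))" for a b f
    by (auto simp: compose_def restrict_def fun_eq_iff)
  have hom: "\<alpha> \<in> Hom (psh C) P Q \<longleftrightarrow>
      ((\<forall>a\<in>Obj C. \<alpha> a \<in> OMap P a \<rightarrow>\<^sub>E OMap Q a) \<and> \<alpha> \<in> extensional (Obj C)) \<and>
      (\<forall>a\<in>Obj C. \<forall>b\<in>Obj C. \<forall>f\<in>Hom C a b.
        compose (OMap P b) (\<alpha> a) (AMap P b a f) = compose (OMap P b) (AMap Q b a f) (\<alpha> b))"
    by (auto simp: psh_def funcat_def nat_trans_def opcat_def setcat_def PiE_iff)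
  show ?thesis
    unfolding hom ext act natural_def by blast
qed

lemma normalise_Hom_psh:
  "is_presheaf C P \<Longrightarrow> is_presheaf C Q \<Longrightarrow> natural C P Q \<alpha> \<Longrightarrow> normalise C P \<alpha> \<in> Hom (psh C) P Q"
  by (simp add: Hom_psh normalise_eq_iff agree_def)

lemma Hom_psh_eqI:
  "is_presheaf C P \<Longrightarrow> is_presheaf C Q \<Longrightarrow> \<alpha> \<in> Hom (psh C) P Q \<Longrightarrow> \<beta> \<in> Hom (psh C) P Q \<Longrightarrow>
    agree C P \<alpha> \<beta> \<Longrightarrow> \<alpha> = \<beta>"
  by (metis Hom_psh normalise_eq_iff)

lemma Comp_psh: "Comp (psh C) P Q R \<beta> \<alpha> = normalise C P (\<lambda>a x. \<beta> a (\<alpha> a x))"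
  by (simp add: psh_def funcat_def setcat_def opcat_def normalise_def compose_def)

lemma Ident_psh: "Ident (psh C) P = normalise C P (\<lambda>a x. x)"
  by (simp add: psh_def funcat_def setcat_def opcat_def normalise_def)

lemma category_psh: "category (psh C)"
proof
  fix P Q R :: "('a, 'b, 'c) presheaf" and \<alpha> \<beta>
  assume "P \<in> Obj (psh C)" "Q \<in> Obj (psh C)" "R \<in> Obj (psh C)"
    "\<alpha> \<in> Hom (psh C) P Q" "\<beta> \<in> Hom (psh C) Q R"
  then show "Comp (psh C) P Q R \<beta> \<alpha> \<in> Hom (psh C) P R"
    using natural_comp[of C P Q \<alpha> R \<beta>]
    by (simp add: Comp_psh Hom_psh normalise_eq_iff)
next
  fix P :: "('a, 'b, 'c) presheaf"
  assume "P \<in> Obj (psh C)"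
  then show "Ident (psh C) P \<in> Hom (psh C) P P"
    by (auto simp: Ident_psh intro!: normalise_Hom_psh natural_id)
next
  fix P Q :: "('a, 'b, 'c) presheaf" and \<alpha>
  assume "P \<in> Obj (psh C)" "Q \<in> Obj (psh C)" "\<alpha> \<in> Hom (psh C) P Q"
  then have "normalise C P \<alpha> = \<alpha>" "natural C P Q \<alpha>"
    by (auto simp: Hom_psh)
  moreover have "normalise C P (\<lambda>a x. \<alpha> a (normalise C P (\<lambda>a x. x) a x)) = normalise C P \<alpha>"
    "normalise C P (\<lambda>a x. normalise C Q (\<lambda>a x. x) a (\<alpha> a x)) = normalise C P \<alpha>"
    using natural_mem[OF \<open>natural C P Q \<alpha>\<close>] by (auto simp: normalise_eq_iff agree_def)
  ultimately show "Comp (psh C) P P Q \<alpha> (Ident (psh C) P) = \<alpha>"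
      "Comp (psh C) P Q Q (Ident (psh C) Q) \<alpha> = \<alpha>"
    by (simp_all add: Comp_psh Ident_psh)
next
  fix P Q R S :: "('a, 'b, 'c) presheaf" and \<alpha> \<beta> \<gamma>
  assume "P \<in> Obj (psh C)" "Q \<in> Obj (psh C)" "R \<in> Obj (psh C)" "S \<in> Obj (psh C)"
    "\<alpha> \<in> Hom (psh C) P Q" "\<beta> \<in> Hom (psh C) Q R" "\<gamma> \<in> Hom (psh C) R S"
  then have "natural C P Q \<alpha>" "natural C Q R \<beta>"
    by (simp_all add: Hom_psh)
  then show "Comp (psh C) P R S \<gamma> (Comp (psh C) P Q R \<beta> \<alpha>) =
      Comp (psh C) P Q S (Comp (psh C) Q R S \<gamma> \<beta>) \<alpha>"
    by (simp add: Comp_psh normalise_eq_iff) (simp add: agree_def natural_def)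
qed

lemma isomorphic_psh:
  "isomorphic (psh C) P Q \<longleftrightarrow> is_presheaf C P \<and> is_presheaf C Q \<and>
    (\<exists>\<alpha> \<beta>. natural C P Q \<alpha> \<and> natural C Q P \<beta> \<and>
      agree C P (\<lambda>a x. \<beta> a (\<alpha> a x)) (\<lambda>a x. x) \<and> agree C Q (\<lambda>a x. \<alpha> a (\<beta> a x)) (\<lambda>a x. x))"
    (is "?L \<longleftrightarrow> ?R")
proof
  assume ?L
  then obtain \<alpha> \<beta> where "is_presheaf C P" "is_presheaf C Q" "\<alpha> \<in> Hom (psh C) P Q"
      "\<beta> \<in> Hom (psh C) Q P" "agree C P (\<lambda>a x. \<beta> a (\<alpha> a x)) (\<lambda>a x. x)"
      "agree C Q (\<lambda>a x. \<alpha> a (\<beta> a x)) (\<lambda>a x. x)"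
    by (auto simp: isomorphic_def Comp_psh Ident_psh normalise_eq_iff)
  then show ?R
    by (intro conjI exI[of _ \<alpha>] exI[of _ \<beta>]) (simp_all add: Hom_psh)
next
  assume ?R
  then obtain \<alpha> \<beta> where *: "is_presheaf C P" "is_presheaf C Q" "natural C P Q \<alpha>" "natural C Q P \<beta>"
      "agree C P (\<lambda>a x. \<beta> a (\<alpha> a x)) (\<lambda>a x. x)" "agree C Q (\<lambda>a x. \<alpha> a (\<beta> a x)) (\<lambda>a x. x)"
    by blast
  then have "agree C P (\<lambda>a x. normalise C Q \<beta> a (normalise C P \<alpha> a x)) (\<lambda>a x. x)"
      "agree C Q (\<lambda>a x. normalise C P \<alpha> a (normalise C Q \<beta> a x)) (\<lambda>a x. x)"
    by (simp_all add: agree_def natural_def)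
  with * show ?L
    unfolding isomorphic_def
    by (intro conjI bexI[of _ "normalise C P \<alpha>"] bexI[of _ "normalise C Q \<beta>"] normalise_Hom_psh)
      (simp_all add: Comp_psh Ident_psh normalise_eq_iff)
qed

section \<open>Quotients and colimits of presheaves\<close>

text \<open>A set of size below the bound of the universe need not be a subset of \<open>'u\<close>, nor does its type have
to embed into \<open>'u\<close>; but its quotient by an equivalence relation can be copied into \<open>'u\<close>. Colimits, Kan
extensions and representables will all be constructed as such quotients.\<close>

lemma quotient_presheaf:
  fixes X :: "'o \<Rightarrow> 'x set" and act :: "'o \<Rightarrow> 'o \<Rightarrow> 'm \<Rightarrow> 'x \<Rightarrow> 'x" and E :: "'o \<Rightarrow> 'x rel"
  assumes "category C"
    and size: "\<And>c. c \<in> Obj C \<Longrightarrow> |X c| <o (infty :: 'u rel)"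
    and mem: "\<And>a b f x. a \<in> Obj C \<Longrightarrow> b \<in> Obj C \<Longrightarrow> f \<in> Hom C a b \<Longrightarrow> x \<in> X b \<Longrightarrow> act b a f x \<in> X a"
    and ident: "\<And>a x. a \<in> Obj C \<Longrightarrow> x \<in> X a \<Longrightarrow> act a a (Ident C a) x = x"
    and comp: "\<And>a b c f g x. a \<in> Obj C \<Longrightarrow> b \<in> Obj C \<Longrightarrow> c \<in> Obj C \<Longrightarrow> f \<in> Hom C a b \<Longrightarrow>
      g \<in> Hom C b c \<Longrightarrow> x \<in> X c \<Longrightarrow> act c a (Comp C a b c g f) x = act b a f (act c b g x)"
    and equiv: "\<And>c. c \<in> Obj C \<Longrightarrow> equiv (X c) (E c)"
    and stable: "\<And>a b f x y. a \<in> Obj C \<Longrightarrow> b \<in> Obj C \<Longrightarrow> f \<in> Hom C a b \<Longrightarrow> (x, y) \<in> E b \<Longrightarrow>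
      (act b a f x, act b a f y) \<in> E a"
  obtains Q :: "('o, 'm, 'u) presheaf" and q where "is_presheaf C Q"
    "\<And>c. c \<in> Obj C \<Longrightarrow> OMap Q c = q c ` X c"
    "\<And>c x y. c \<in> Obj C \<Longrightarrow> x \<in> X c \<Longrightarrow> y \<in> X c \<Longrightarrow> q c x = q c y \<longleftrightarrow> (x, y) \<in> E c"
    "\<And>a b f x. a \<in> Obj C \<Longrightarrow> b \<in> Obj C \<Longrightarrow> f \<in> Hom C a b \<Longrightarrow> x \<in> X b \<Longrightarrow>
      q a (act b a f x) = AMap Q b a f (q b x)"
proof -
  interpret category C by fact
  have "\<exists>q :: 'x \<Rightarrow> 'u. \<forall>x\<in>X c. \<forall>y\<in>X c. q x = q y \<longleftrightarrow> (x, y) \<in> E c" if c: "c \<in> Obj C" for c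
  proof -
    have "X c // E c = (\<lambda>x. E c `` {x}) ` X c"
      by (auto simp: quotient_def)
    then have "|X c // E c| <o (infty :: 'u rel)"
      using small_image[OF size[OF c]] by simp
    then obtain e :: "_ \<Rightarrow> 'u" where e: "inj_on e (X c // E c)"
      using iffD2[OF card_of_ordLeq ordLess_imp_ordLeq] by blast
    have "e (E c `` {x}) = e (E c `` {y}) \<longleftrightarrow> (x, y) \<in> E c" if "x \<in> X c" "y \<in> X c" for x y
      using inj_onD[OF e, of "E c `` {x}" "E c `` {y}"] that eq_equiv_class_iff[OF equiv[OF c] that]
      by (auto intro: quotientI)
    then show ?thesis
      by (intro exI[of _ "\<lambda>x. e (E c `` {x})"]) simp
  qed
  then obtain q :: "'o \<Rightarrow> 'x \<Rightarrow> 'u" where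
    q: "\<And>c x y. c \<in> Obj C \<Longrightarrow> x \<in> X c \<Longrightarrow> y \<in> X c \<Longrightarrow> q c x = q c y \<longleftrightarrow> (x, y) \<in> E c"
    by metis
  define Q :: "('o, 'm, 'u) presheaf" where
    "Q = \<lparr>OMap = (\<lambda>c. q c ` X c),
          AMap = (\<lambda>b a f. \<lambda>u\<in>q b ` X b. q a (act b a f (inv_into (X b) (q b) u)))\<rparr>"
  have nat: "q a (act b a f x) = AMap Q b a f (q b x)"
    if "a \<in> Obj C" "b \<in> Obj C" "f \<in> Hom C a b" "x \<in> X b" for a b f x
  proof -
    let ?y = "inv_into (X b) (q b) (q b x)"
    have y: "?y \<in> X b" "q b ?y = q b x"
      using that by (auto intro: inv_into_into f_inv_into_f)
    then have "(x, ?y) \<in> E b"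
      using q[of b x ?y] that by simp
    then have "(act b a f x, act b a f ?y) \<in> E a"
      using stable that by blast
    then have "q a (act b a f x) = q a (act b a f ?y)"
      using q[of a "act b a f x" "act b a f ?y"] mem that y by blast
    then show ?thesis
      using that by (simp add: Q_def)
  qed
  have obj: "OMap Q c = q c ` X c" for c
    by (simp add: Q_def)
  have "is_presheaf C Q"
    unfolding is_presheaf_iff[OF \<open>category C\<close>]
  proof (intro conjI ballI)
    fix a b f assume "a \<in> Obj C" "b \<in> Obj C" "f \<in> Hom C a b"
    then show "AMap Q b a f \<in> OMap Q b \<rightarrow>\<^sub>E OMap Q a"
      using mem by (auto simp: Q_def inv_into_into)
  next
    fix a b c f g x
    assume *: "a \<in> Obj C" "b \<in> Obj C" "c \<in> Obj C" "f \<in> Hom C a b" "g \<in> Hom C b c"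
      and "x \<in> OMap Q c"
    then obtain y where y: "y \<in> X c" "x = q c y"
      by (auto simp: obj)
    have "AMap Q c a (Comp C a b c g f) x = q a (act b a f (act c b g y))"
      using nat[of a c "Comp C a b c g f" y] comp_in_hom[of a b c f g] comp[of a b c f g y] * y by simp
    also have "\<dots> = AMap Q b a f (AMap Q c b g x)"
      using nat[of a b f "act c b g y"] nat[of b c g y] mem[of b c g y] * y by simp
    finally show "AMap Q c a (Comp C a b c g f) x = AMap Q b a f (AMap Q c b g x)" .
  next
    fix a x assume "a \<in> Obj C" "x \<in> OMap Q a"
    then show "AMap Q a a (Ident C a) x = x"
      using nat[of a a "Ident C a"] ident_in_hom[of a] ident[of a] by (auto simp: obj)
  qed (auto simp: obj intro: small_image size)
  then show ?thesis
    using that obj q nat by blast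
qed

text \<open>The following three notions restate diagrams, cocones and colimits in the presheaf category with
natural families in place of the extensional arrows of \<open>psh C\<close>. They treat a diagram on \<open>J\<close> and its
composite with the projection from a category of elements alike.\<close>

definition diagram ::
  "('o, 'm) cat \<Rightarrow> ('i, 'j) cat \<Rightarrow> ('i, 'j, ('o, 'm, 'u) presheaf, 'o \<Rightarrow> 'u \<Rightarrow> 'u) fctr \<Rightarrow> bool" where
  "diagram C I F \<longleftrightarrow> (\<forall>i\<in>Obj I. is_presheaf C (OMap F i)) \<and>
     (\<forall>i\<in>Obj I. \<forall>j\<in>Obj I. \<forall>f\<in>Hom I i j. natural C (OMap F i) (OMap F j) (AMap F i j f))"

definition natural_cocone ::
  "('o, 'm) cat \<Rightarrow> ('i, 'j) cat \<Rightarrow> ('i, 'j, ('o, 'm, 'u) presheaf, 'o \<Rightarrow> 'u \<Rightarrow> 'u) fctr \<Rightarrow>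
   ('o, 'm, 'u) presheaf \<Rightarrow> ('i \<Rightarrow> 'o \<Rightarrow> 'u \<Rightarrow> 'u) \<Rightarrow> bool" where
  "natural_cocone C I F L l \<longleftrightarrow> is_presheaf C L \<and> (\<forall>i\<in>Obj I. natural C (OMap F i) L (l i)) \<and>
     (\<forall>i\<in>Obj I. \<forall>j\<in>Obj I. \<forall>f\<in>Hom I i j.
        agree C (OMap F i) (\<lambda>a x. l j a (AMap F i j f a x)) (l i))"

definition natural_colimit ::
  "('o, 'm) cat \<Rightarrow> ('i, 'j) cat \<Rightarrow> ('i, 'j, ('o, 'm, 'u) presheaf, 'o \<Rightarrow> 'u \<Rightarrow> 'u) fctr \<Rightarrow>
   ('o, 'm, 'u) presheaf \<Rightarrow> ('i \<Rightarrow> 'o \<Rightarrow> 'u \<Rightarrow> 'u) \<Rightarrow> bool" where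
  "natural_colimit C I F L l \<longleftrightarrow> natural_cocone C I F L l \<and>
     (\<forall>M m. natural_cocone C I F M m \<longrightarrow>
        (\<exists>h. natural C L M h \<and> (\<forall>i\<in>Obj I. agree C (OMap F i) (\<lambda>a x. h a (l i a x)) (m i)))) \<and>
     (\<forall>M h h'. is_presheaf C M \<and> natural C L M h \<and> natural C L M h' \<and>
        (\<forall>i\<in>Obj I. agree C (OMap F i) (\<lambda>a x. h a (l i a x)) (\<lambda>a x. h' a (l i a x))) \<longrightarrow>
        agree C L h h')"

lemma natural_cocone_comp:
  assumes "natural_cocone C I F L l" "is_presheaf C M" "natural C L M h"
  shows "natural_cocone C I F M (\<lambda>i a x. h a (l i a x))"
  using assms unfolding natural_cocone_def by (auto intro: natural_comp) (simp add: agree_def)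

lemma natural_cocone_normalise:
  assumes "diagram C I F"
  shows "natural_cocone C I F L (\<lambda>i. normalise C (OMap F i) (l i)) \<longleftrightarrow> natural_cocone C I F L l"
proof -
  have "agree C (OMap F i) (\<lambda>a x. normalise C (OMap F j) (l j) a (AMap F i j f a x)) m
    \<longleftrightarrow> agree C (OMap F i) (\<lambda>a x. l j a (AMap F i j f a x)) m"
    if "i \<in> Obj I" "j \<in> Obj I" "f \<in> Hom I i j" for i j f m
  proof -
    have "natural C (OMap F i) (OMap F j) (AMap F i j f)"
      using assms that by (simp add: diagram_def)
    then show ?thesis
      by (simp add: agree_def natural_mem)
  qed
  then show ?thesis
    using assms by (simp add: natural_cocone_def diagram_def)
qed

lemma cocone_psh:
  assumes "diagram C I F"
  shows "cocone I (psh C) F L l \<longleftrightarrow>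
    natural_cocone C I F L l \<and> (\<forall>i\<in>Obj I. normalise C (OMap F i) (l i) = l i)"
proof (cases "is_presheaf C L \<and> (\<forall>i\<in>Obj I. normalise C (OMap F i) (l i) = l i)")
  case True
  then have "normalise C (OMap F i) k = l i \<longleftrightarrow> agree C (OMap F i) k (l i)" if "i \<in> Obj I" for i k
    using that normalise_eq_iff[of C "OMap F i" k "l i"] by simp
  moreover have "l i \<in> Hom (psh C) (OMap F i) L \<longleftrightarrow> natural C (OMap F i) L (l i)" if "i \<in> Obj I" for i
    using True assms that by (simp add: Hom_psh diagram_def)
  ultimately show ?thesis
    using True by (simp add: cocone_def natural_cocone_def Comp_psh)
next
  case False
  moreover have "\<not> cocone I (psh C) F L l"
  proof
    assume *: "cocone I (psh C) F L l"
    then have "is_presheaf C L" "\<forall>i\<in>Obj I. l i \<in> Hom (psh C) (OMap F i) L"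
      by (simp_all add: cocone_def)
    then have "\<forall>i\<in>Obj I. normalise C (OMap F i) (l i) = l i"
      using Hom_psh assms unfolding diagram_def by blast
    with \<open>is_presheaf C L\<close> False show False
      by simp
  qed
  ultimately show ?thesis
    by (auto simp: natural_cocone_def)
qed

lemma is_colimit_psh:
  assumes F: "diagram C I F"
  shows "is_colimit I (psh C) F L \<longleftrightarrow> (\<exists>l. natural_colimit C I F L l)"
proof
  assume "is_colimit I (psh C) F L"
  then obtain l where l: "cocone I (psh C) F L l"
    and univ: "\<And>M m. cocone I (psh C) F M m \<Longrightarrow>
      \<exists>!h. h \<in> Hom (psh C) L M \<and> (\<forall>i\<in>Obj I. Comp (psh C) (OMap F i) L M h (l i) = m i)"
    by (auto simp: is_colimit_def)
  have l': "natural_cocone C I F L l" and L: "is_presheaf C L"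
    using l cocone_psh[OF F] by (auto simp: natural_cocone_def)
  have norm: "cocone I (psh C) F M (\<lambda>i. normalise C (OMap F i) (m i))"
    if "natural_cocone C I F M m" for M m
    using that F by (simp add: cocone_psh natural_cocone_normalise normalise_eq_iff)
  have "natural_colimit C I F L l"
    unfolding natural_colimit_def
  proof (intro conjI allI impI l')
    fix M m assume m: "natural_cocone C I F M m"
    obtain h where "h \<in> Hom (psh C) L M"
      "\<forall>i\<in>Obj I. Comp (psh C) (OMap F i) L M h (l i) = normalise C (OMap F i) (m i)"
      using univ[OF norm[OF m]] by blast
    moreover have "is_presheaf C M"
      using m by (simp add: natural_cocone_def)
    ultimately show "\<exists>h. natural C L M h \<and> (\<forall>i\<in>Obj I. agree C (OMap F i) (\<lambda>a x. h a (l i a x)) (m i))"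
      using L by (auto simp: Hom_psh Comp_psh normalise_eq_iff)
  next
    fix M h h' assume *: "is_presheaf C M \<and> natural C L M h \<and> natural C L M h' \<and>
        (\<forall>i\<in>Obj I. agree C (OMap F i) (\<lambda>a x. h a (l i a x)) (\<lambda>a x. h' a (l i a x)))"
    let ?m = "\<lambda>i. normalise C (OMap F i) (\<lambda>a x. h a (l i a x))"
    have "cocone I (psh C) F M ?m"
      using norm[OF natural_cocone_comp[OF l']] * by blast
    from univ[OF this] obtain k where k: "\<And>g. g \<in> Hom (psh C) L M \<Longrightarrow>
        \<forall>i\<in>Obj I. Comp (psh C) (OMap F i) L M g (l i) = ?m i \<Longrightarrow> g = k"
      by blast
    have lmem: "l i a x \<in> OMap L a" if "i \<in> Obj I" "a \<in> Obj C" "x \<in> OMap (OMap F i) a" for i a x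
      using l' that by (auto simp: natural_cocone_def natural_def)
    have "normalise C L g = k" if "natural C L M g" "\<forall>i\<in>Obj I. agree C (OMap F i) (\<lambda>a x. g a (l i a x)) (\<lambda>a x. h a (l i a x))" for g
      using that * L lmem
      by (intro k normalise_Hom_psh ballI) (auto simp: Comp_psh normalise_eq_iff agree_def)
    from this[of h] this[of h'] have "normalise C L h = normalise C L h'"
      using * by (simp add: agree_def)
    then show "agree C L h h'"
      by (simp add: normalise_eq_iff)
  qed
  then show "\<exists>l. natural_colimit C I F L l"
    by blast
next
  assume "\<exists>l. natural_colimit C I F L l"
  then obtain l where l: "natural_cocone C I F L l"
    and ex: "\<And>M m. natural_cocone C I F M m \<Longrightarrow>
      \<exists>h. natural C L M h \<and> (\<forall>i\<in>Obj I. agree C (OMap F i) (\<lambda>a x. h a (l i a x)) (m i))"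
    and uniq: "\<And>M h h'. is_presheaf C M \<Longrightarrow> natural C L M h \<Longrightarrow> natural C L M h' \<Longrightarrow>
      (\<And>i. i \<in> Obj I \<Longrightarrow> agree C (OMap F i) (\<lambda>a x. h a (l i a x)) (\<lambda>a x. h' a (l i a x))) \<Longrightarrow>
      agree C L h h'"
    unfolding natural_colimit_def by blast
  have L: "is_presheaf C L"
    using l by (simp add: natural_cocone_def)
  have lmem: "l i a x \<in> OMap L a" if "i \<in> Obj I" "a \<in> Obj C" "x \<in> OMap (OMap F i) a" for i a x
    using l that by (auto simp: natural_cocone_def natural_def)
  let ?l = "\<lambda>i. normalise C (OMap F i) (l i)"
  have eq: "Comp (psh C) (OMap F i) L M h (?l i) = m \<longleftrightarrow>
      agree C (OMap F i) (\<lambda>a x. h a (l i a x)) m" if "normalise C (OMap F i) m = m" for i M h m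
  proof -
    have "Comp (psh C) (OMap F i) L M h (?l i) = normalise C (OMap F i) (\<lambda>a x. h a (l i a x))"
      by (auto simp: Comp_psh normalise_eq_iff) (simp add: agree_def)
    then show ?thesis
      using normalise_eq_iff[of C "OMap F i" _ m] that by simp
  qed
  show "is_colimit I (psh C) F L"
    unfolding is_colimit_def
  proof (intro exI[of _ ?l] conjI allI impI)
    show "cocone I (psh C) F L ?l"
      using l by (simp add: cocone_psh[OF F] natural_cocone_normalise[OF F] normalise_eq_iff)
    fix M m assume "cocone I (psh C) F M m"
    then have m: "natural_cocone C I F M m" and norm: "\<And>i. i \<in> Obj I \<Longrightarrow> normalise C (OMap F i) (m i) = m i"
      by (simp_all add: cocone_psh[OF F])
    then have M: "is_presheaf C M"
      by (simp add: natural_cocone_def)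
    obtain h where h: "natural C L M h" "\<And>i. i \<in> Obj I \<Longrightarrow> agree C (OMap F i) (\<lambda>a x. h a (l i a x)) (m i)"
      using ex[OF m] by blast
    show "\<exists>!h. h \<in> Hom (psh C) L M \<and> (\<forall>i\<in>Obj I. Comp (psh C) (OMap F i) L M h (?l i) = m i)"
    proof (rule ex1I[of _ "normalise C L h"])
      show "normalise C L h \<in> Hom (psh C) L M \<and>
          (\<forall>i\<in>Obj I. Comp (psh C) (OMap F i) L M (normalise C L h) (?l i) = m i)"
        using normalise_Hom_psh[OF L M h(1)] h(2) lmem by (simp add: eq norm) (simp add: agree_def)
    next
      fix g assume "g \<in> Hom (psh C) L M \<and> (\<forall>i\<in>Obj I. Comp (psh C) (OMap F i) L M g (?l i) = m i)"
      then have g: "g \<in> Hom (psh C) L M" "natural C L M g"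
          "\<And>i. i \<in> Obj I \<Longrightarrow> agree C (OMap F i) (\<lambda>a x. g a (l i a x)) (m i)"
        using L M by (simp_all add: eq norm Hom_psh)
      have "agree C L g h"
        by (rule uniq[OF M g(2) h(1)]) (use g(3) h(2) in \<open>simp add: agree_def\<close>)
      then show "g = normalise C L h"
        by (intro Hom_psh_eqI[OF L M g(1) normalise_Hom_psh[OF L M h(1)]]) simp
    qed
  qed
qed

text \<open>The colimit is the pointwise disjoint union of the presheaves in the diagram, modulo the
identifications that hold in every cocone. This relation is visibly an equivalence and compatible
with the action of \<open>C\<close>, and every cocone factors through the quotient by definition.\<close>

lemma colimit_exists:
  fixes F :: "('i, 'j, ('o, 'm, 'u) presheaf, 'o \<Rightarrow> 'u \<Rightarrow> 'u) fctr"
  assumes "category C" and F: "diagram C I F" and "regular_cardinal (infty :: 'u rel)"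
    and small: "|Obj I| <o (infty :: 'u rel)"
  obtains L l where "natural_colimit C I F L l"
    "\<And>a x. a \<in> Obj C \<Longrightarrow> x \<in> OMap L a \<Longrightarrow> \<exists>i\<in>Obj I. \<exists>y\<in>OMap (OMap F i) a. x = l i a y"
proof -
  interpret regular_cardinal "infty :: 'u rel" by fact
  have Fi: "is_presheaf C (OMap F i)" if "i \<in> Obj I" for i
    using F that by (simp add: diagram_def)
  define X where "X c = Sigma (Obj I) (\<lambda>i. OMap (OMap F i) c)" for c
  define act where "act b a f = (\<lambda>(i, x). (i, AMap (OMap F i) b a f x))" for b a f
  define E where "E c = {((i, x), (j, y)). (i, x) \<in> X c \<and> (j, y) \<in> X c \<and>
    (\<forall>M m. natural_cocone C I F M m \<longrightarrow> m i c x = m j c y)}" for c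
  obtain Q :: "('o, 'm, 'u) presheaf" and q where Q: "is_presheaf C Q"
    and Qobj: "\<And>c. c \<in> Obj C \<Longrightarrow> OMap Q c = q c ` X c"
    and eq: "\<And>c x y. c \<in> Obj C \<Longrightarrow> x \<in> X c \<Longrightarrow> y \<in> X c \<Longrightarrow> q c x = q c y \<longleftrightarrow> (x, y) \<in> E c"
    and nat: "\<And>a b f x. a \<in> Obj C \<Longrightarrow> b \<in> Obj C \<Longrightarrow> f \<in> Hom C a b \<Longrightarrow> x \<in> X b \<Longrightarrow>
      q a (act b a f x) = AMap Q b a f (q b x)"
  proof (rule quotient_presheaf[of C X act E, OF \<open>category C\<close>])
    show "|X c| <o (infty :: 'u rel)" if "c \<in> Obj C" for c
      unfolding X_def using small Fi that by (intro small_Sigma presheaf_size)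
    show "equiv (X c) (E c)" for c
      by (rule equivI) (auto simp: E_def refl_on_def sym_def trans_def, metis+)
    show "(act b a f x, act b a f y) \<in> E a"
      if *: "a \<in> Obj C" "b \<in> Obj C" "f \<in> Hom C a b" "(x, y) \<in> E b" for a b f x y
    proof -
      obtain i u j v where xy: "x = (i, u)" "y = (j, v)" "(i, u) \<in> X b" "(j, v) \<in> X b"
        and uv: "\<And>M m. natural_cocone C I F M m \<Longrightarrow> m i b u = m j b v"
        using *(4) by (auto simp: E_def)
      have "m i a (AMap (OMap F i) b a f u) = m j a (AMap (OMap F j) b a f v)"
        if "natural_cocone C I F M m" for M m
        using that uv[OF that] * xy natural_act[of C "OMap F i" M "m i" a b f u]
           natural_act[of C "OMap F j" M "m j" a b f v]
        by (simp add: natural_cocone_def X_def)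
      then show ?thesis
        using xy * by (auto simp: E_def act_def X_def intro!: presheaf_mem[OF Fi])
    qed
  qed (auto simp: X_def act_def presheaf_ident[OF Fi] presheaf_comp[OF Fi] intro: presheaf_mem[OF Fi])
  define l where "l i a x = q a (i, x)" for i a x
  have surj: "\<exists>i\<in>Obj I. \<exists>y\<in>OMap (OMap F i) a. x = l i a y" if "a \<in> Obj C" "x \<in> OMap Q a" for a x
    using that by (auto simp: Qobj l_def X_def)
  have l: "natural_cocone C I F Q l"
    unfolding natural_cocone_def
  proof (intro conjI ballI Q)
    fix i assume "i \<in> Obj I"
    then show "natural C (OMap F i) Q (l i)"
      using nat[where x="(i, _)"] by (auto simp: natural_def l_def Qobj X_def act_def)
  next
    fix i j f assume *: "i \<in> Obj I" "j \<in> Obj I" "f \<in> Hom I i j"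
    then have mem: "AMap F i j f a x \<in> OMap (OMap F j) a" if "a \<in> Obj C" "x \<in> OMap (OMap F i) a" for a x
      using F that unfolding diagram_def natural_def by blast
    have "((j, AMap F i j f a x), (i, x)) \<in> E a" if "a \<in> Obj C" "x \<in> OMap (OMap F i) a" for a x
      using * that mem by (auto simp: E_def X_def natural_cocone_def agree_def)
    then show "agree C (OMap F i) (\<lambda>a x. l j a (AMap F i j f a x)) (l i)"
      using * mem by (auto simp: agree_def l_def eq X_def)
  qed
  have "natural_colimit C I F Q l"
    unfolding natural_colimit_def
  proof (intro conjI allI impI l)
    fix M m assume m: "natural_cocone C I F M m"
    define h where "h a u = (case inv_into (X a) (q a) u of (i, x) \<Rightarrow> m i a x)" for a u
    have h: "h a (l i a x) = m i a x" if "i \<in> Obj I" "a \<in> Obj C" "x \<in> OMap (OMap F i) a" for i a x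
    proof -
      let ?p = "inv_into (X a) (q a) (q a (i, x))"
      have "(i, x) \<in> X a"
        using that by (simp add: X_def)
      then have "?p \<in> X a" "q a ?p = q a (i, x)"
        by (auto intro: inv_into_into f_inv_into_f)
      then have "(?p, (i, x)) \<in> E a"
        using eq \<open>(i, x) \<in> X a\<close> that by simp
      then show ?thesis
        using m by (auto simp: E_def h_def l_def)
    qed
    have "natural C Q M h"
      unfolding natural_def
    proof (intro conjI ballI)
      fix a x assume "a \<in> Obj C" "x \<in> OMap Q a"
      then show "h a x \<in> OMap M a"
        using surj[of a x] m h by (auto simp: natural_cocone_def natural_def)
    next
      fix a b f x assume *: "a \<in> Obj C" "b \<in> Obj C" "f \<in> Hom C a b" "x \<in> OMap Q b"
      then obtain i y where y: "i \<in> Obj I" "y \<in> OMap (OMap F i) b" "x = l i b y"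
        using surj by blast
      have "natural C (OMap F i) Q (l i)" "natural C (OMap F i) M (m i)"
        using l m y by (auto simp: natural_cocone_def)
      note nats = this[THEN natural_act, OF *(1,2,3) y(2)]
      show "h a (AMap Q b a f x) = AMap M b a f (h b x)"
        using h[of i b y] h[of i a "AMap (OMap F i) b a f y"] y * nats presheaf_mem[OF Fi *(1,2,3)]
        by simp
    qed
    then show "\<exists>h. natural C Q M h \<and> (\<forall>i\<in>Obj I. agree C (OMap F i) (\<lambda>a x. h a (l i a x)) (m i))"
      using h by (auto simp: agree_def)
  next
    fix M h h' assume "is_presheaf C M \<and> natural C Q M h \<and> natural C Q M h' \<and>
        (\<forall>i\<in>Obj I. agree C (OMap F i) (\<lambda>a x. h a (l i a x)) (\<lambda>a x. h' a (l i a x)))"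
    then show "agree C Q h h'"
      using surj unfolding agree_def by blast
  qed
  then show ?thesis
    using surj that by blast
qed

text \<open>Being a colimit determines the cocone up to isomorphism, so what holds for the constructed colimit
holds for all.\<close>

lemma colimit_surj:
  fixes F :: "('i, 'j, ('o, 'm, 'u) presheaf, 'o \<Rightarrow> 'u \<Rightarrow> 'u) fctr"
  assumes "category C" "diagram C I F" "regular_cardinal (infty :: 'u rel)"
    "|Obj I| <o (infty :: 'u rel)" and L: "natural_colimit C I F L l"
    and a: "a \<in> Obj C" "x \<in> OMap L a"
  shows "\<exists>i\<in>Obj I. \<exists>y\<in>OMap (OMap F i) a. x = l i a y"
proof -
  obtain K k where K: "natural_colimit C I F K k"
    and surj: "\<And>a x. a \<in> Obj C \<Longrightarrow> x \<in> OMap K a \<Longrightarrow> \<exists>i\<in>Obj I. \<exists>y\<in>OMap (OMap F i) a. x = k i a y"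
    using colimit_exists assms(1-4) by blast
  have cc: "natural_cocone C I F L l" "natural_cocone C I F K k" "is_presheaf C L"
    using L K by (auto simp: natural_colimit_def natural_cocone_def)
  obtain h where h: "natural C L K h" "\<And>i. i \<in> Obj I \<Longrightarrow> agree C (OMap F i) (\<lambda>a x. h a (l i a x)) (k i)"
    using L cc unfolding natural_colimit_def by blast
  obtain g where g: "natural C K L g" "\<And>i. i \<in> Obj I \<Longrightarrow> agree C (OMap F i) (\<lambda>a x. g a (k i a x)) (l i)"
    using K cc unfolding natural_colimit_def by blast
  have "agree C (OMap F i) (\<lambda>a x. g a (h a (l i a x))) (\<lambda>a x. l i a x)" if "i \<in> Obj I" for i
    using h(2) g(2) that by (simp add: agree_def)
  moreover have "natural C L L (\<lambda>a x. g a (h a x))"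
    using h(1) g(1) by (rule natural_comp)
  ultimately have "agree C L (\<lambda>a x. g a (h a x)) (\<lambda>a x. x)"
    using L cc(3) natural_id[of C L] unfolding natural_colimit_def by blast
  then have "x = g a (h a x)"
    using a by (simp add: agree_def)
  moreover have "h a x \<in> OMap K a"
    using h a by (simp add: natural_def)
  then obtain i y where "i \<in> Obj I" "y \<in> OMap (OMap F i) a" "h a x = k i a y"
    using surj a by blast
  ultimately show ?thesis
    using g(2) a by (force simp: agree_def)
qed

section \<open>Left Kan extensions along inclusions of subcategories\<close>

lemma
  assumes "subcategory D C"
  shows subcategory_category: "category D"
    and subcategory_obj: "a \<in> Obj D \<Longrightarrow> a \<in> Obj C"
    and subcategory_hom: "a \<in> Obj D \<Longrightarrow> b \<in> Obj D \<Longrightarrow> f \<in> Hom D a b \<Longrightarrow> f \<in> Hom C a b"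
    and subcategory_ident: "a \<in> Obj D \<Longrightarrow> Ident D a = Ident C a"
    and subcategory_comp: "a \<in> Obj D \<Longrightarrow> b \<in> Obj D \<Longrightarrow> c \<in> Obj D \<Longrightarrow> f \<in> Hom D a b \<Longrightarrow>
      g \<in> Hom D b c \<Longrightarrow> Comp D a b c g f = Comp C a b c g f"
  using assms unfolding subcategory_def by blast+

lemma fcomp_inclusion [simp]:
  "OMap (P \<circ>F inclusion) = OMap P" "AMap (P \<circ>F inclusion) = AMap P"
  by (simp_all add: fcomp_def inclusion_def)

lemma natural_fcomp_inclusion [simp]:
  "natural D P (Q \<circ>F inclusion) \<alpha> \<longleftrightarrow> natural D P Q \<alpha>"
  "natural D (P \<circ>F inclusion) Q \<alpha> \<longleftrightarrow> natural D P Q \<alpha>"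
  by (simp_all add: natural_def)

lemma natural_subcategory: "subcategory D C \<Longrightarrow> natural C P Q \<alpha> \<Longrightarrow> natural D P Q \<alpha>"
  unfolding natural_def subcategory_def by blast

lemma presheaf_subcategory:
  assumes "subcategory D C" "is_presheaf C P"
  shows "is_presheaf D (P \<circ>F inclusion)"
  unfolding is_presheaf_iff[OF subcategory_category[OF assms(1)]]
  using presheaf_size[OF assms(2)] presheaf_ext[OF assms(2)] presheaf_ident[OF assms(2)]
    presheaf_comp[OF assms(2)]
  by (simp add: subcategory_obj[OF assms(1)] subcategory_hom[OF assms(1)]
      subcategory_ident[OF assms(1)] subcategory_comp[OF assms(1)])

lemma inclusion_op_functor:
  assumes "subcategory D C" "category C"
  shows "is_functor (opcat D) (opcat C) inclusion"
  using assms unfolding subcategory_def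
  by (intro is_functor.intro is_functor_axioms.intro category_opcat) (auto simp: opcat_def inclusion_def)

text \<open>The universal property of \<open>is_left_kan_extension\<close> in terms of natural families. A presheaf on \<open>C\<close> is
used as a presheaf on \<open>D\<close> without restricting it explicitly, because \<open>natural D\<close> looks at its values
on \<open>D\<close> only.\<close>

definition natural_lan ::
  "('o, 'm) cat \<Rightarrow> ('o, 'm) cat \<Rightarrow> ('o, 'm, 'u) presheaf \<Rightarrow> ('o, 'm, 'u) presheaf \<Rightarrow>
   ('o \<Rightarrow> 'u \<Rightarrow> 'u) \<Rightarrow> bool" where
  "natural_lan D C \<psi> \<phi> \<eta> \<longleftrightarrow> natural D \<psi> \<phi> \<eta> \<and>
     (\<forall>G \<beta>. is_presheaf C G \<and> natural D \<psi> G \<beta> \<longrightarrow>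
        (\<exists>\<gamma>. natural C \<phi> G \<gamma> \<and> agree D \<psi> (\<lambda>d y. \<gamma> d (\<eta> d y)) \<beta>)) \<and>
     (\<forall>G \<gamma> \<gamma>'. is_presheaf C G \<and> natural C \<phi> G \<gamma> \<and> natural C \<phi> G \<gamma>' \<and>
        agree D \<psi> (\<lambda>d y. \<gamma> d (\<eta> d y)) (\<lambda>d y. \<gamma>' d (\<eta> d y)) \<longrightarrow> agree C \<phi> \<gamma> \<gamma>')"

lemma
  assumes "natural_lan D C \<psi> \<phi> \<eta>"
  shows natural_lan_unit: "natural D \<psi> \<phi> \<eta>"
    and natural_lan_extend: "is_presheaf C G \<Longrightarrow> natural D \<psi> G \<beta> \<Longrightarrow>
      \<exists>\<gamma>. natural C \<phi> G \<gamma> \<and> agree D \<psi> (\<lambda>d y. \<gamma> d (\<eta> d y)) \<beta>"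
    and natural_lan_unique: "is_presheaf C G \<Longrightarrow> natural C \<phi> G \<gamma> \<Longrightarrow> natural C \<phi> G \<gamma>' \<Longrightarrow>
      agree D \<psi> (\<lambda>d y. \<gamma> d (\<eta> d y)) (\<lambda>d y. \<gamma>' d (\<eta> d y)) \<Longrightarrow> agree C \<phi> \<gamma> \<gamma>'"
  using assms unfolding natural_lan_def by blast+

lemma is_left_kan_extension_iff:
  fixes \<phi> \<psi> :: "('o, 'm, 'u) presheaf"
  assumes "category C" and D: "subcategory D C" and \<psi>: "is_presheaf D \<psi>" and \<phi>: "is_presheaf C \<phi>"
  shows "is_left_kan_extension (opcat D) (opcat C) setcat inclusion \<psi> \<phi> \<longleftrightarrow>
    (\<exists>\<eta>. natural_lan D C \<psi> \<phi> \<eta>)"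
proof -
  let ?r = "\<lambda>P :: ('o, 'm, 'u) presheaf. P \<circ>F inclusion"
  have r: "is_presheaf C P \<Longrightarrow> is_presheaf D (?r P)" for P
    using presheaf_subcategory[OF D] by blast
  have wh: "agree D \<psi> (\<lambda>d y. whisker (opcat D) inclusion \<gamma> d (\<eta> d y)) \<beta> \<longleftrightarrow>
      agree D \<psi> (\<lambda>d y. \<gamma> d (\<eta> d y)) \<beta>" for \<gamma> \<eta> \<beta> :: "'o \<Rightarrow> 'u \<Rightarrow> 'u"
    by (simp add: agree_def whisker_def inclusion_def opcat_def)
  have comp: "Comp (psh D) \<psi> (?r \<phi>) (?r G) (whisker (opcat D) inclusion \<gamma>) \<eta> = \<beta> \<longleftrightarrow>
      agree D \<psi> (\<lambda>d y. \<gamma> d (\<eta> d y)) \<beta>"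
    if "normalise D \<psi> \<beta> = \<beta>" for \<beta> \<gamma> \<eta> :: "'o \<Rightarrow> 'u \<Rightarrow> 'u" and G
    using normalise_eq_iff[of D \<psi> "\<lambda>d y. whisker (opcat D) inclusion \<gamma> d (\<eta> d y)" \<beta>] that
    by (simp add: wh Comp_psh)
  have lan: "is_left_kan_extension (opcat D) (opcat C) setcat inclusion \<psi> \<phi> \<longleftrightarrow>
    (\<exists>\<eta>\<in>Hom (psh D) \<psi> (?r \<phi>). \<forall>G. is_presheaf C G \<longrightarrow> (\<forall>\<beta>\<in>Hom (psh D) \<psi> (?r G).
      \<exists>!\<gamma>. \<gamma> \<in> Hom (psh C) \<phi> G \<and> agree D \<psi> (\<lambda>d y. \<gamma> d (\<eta> d y)) \<beta>))"
  proof -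
    have "is_left_kan_extension (opcat D) (opcat C) setcat inclusion \<psi> \<phi> \<longleftrightarrow>
      (\<exists>\<eta>\<in>Hom (psh D) \<psi> (?r \<phi>). \<forall>G. is_presheaf C G \<longrightarrow> (\<forall>\<beta>\<in>Hom (psh D) \<psi> (?r G).
        \<exists>!\<gamma>. \<gamma> \<in> Hom (psh C) \<phi> G \<and>
          Comp (psh D) \<psi> (?r \<phi>) (?r G) (whisker (opcat D) inclusion \<gamma>) \<eta> = \<beta>))"
      using inclusion_op_functor[OF D \<open>category C\<close>] \<psi> \<phi>
      by (simp add: is_left_kan_extension_def psh_def) (simp add: funcat_def)
    also have "\<dots> \<longleftrightarrow> (\<exists>\<eta>\<in>Hom (psh D) \<psi> (?r \<phi>). \<forall>G. is_presheaf C G \<longrightarrow> (\<forall>\<beta>\<in>Hom (psh D) \<psi> (?r G).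
      \<exists>!\<gamma>. \<gamma> \<in> Hom (psh C) \<phi> G \<and> agree D \<psi> (\<lambda>d y. \<gamma> d (\<eta> d y)) \<beta>))"
      using \<psi> r by (intro bex_cong ball_cong all_cong refl) (simp add: comp Hom_psh)
    finally show ?thesis .
  qed
  show ?thesis
  proof
    assume "is_left_kan_extension (opcat D) (opcat C) setcat inclusion \<psi> \<phi>"
    then obtain \<eta> where "\<eta> \<in> Hom (psh D) \<psi> (?r \<phi>)" and
      univ: "\<And>G \<beta>. is_presheaf C G \<Longrightarrow> \<beta> \<in> Hom (psh D) \<psi> (?r G) \<Longrightarrow>
        \<exists>!\<gamma>. \<gamma> \<in> Hom (psh C) \<phi> G \<and> agree D \<psi> (\<lambda>d y. \<gamma> d (\<eta> d y)) \<beta>"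
      unfolding lan by blast
    then have \<eta>: "natural D \<psi> \<phi> \<eta>"
      using \<psi> \<phi> r by (simp add: Hom_psh)
    have "natural_lan D C \<psi> \<phi> \<eta>"
      unfolding natural_lan_def
    proof (intro conjI allI impI \<eta>)
      fix G \<beta> assume G: "is_presheaf C G \<and> natural D \<psi> G \<beta>"
      then have "normalise D \<psi> \<beta> \<in> Hom (psh D) \<psi> (?r G)"
        using \<psi> r by (simp add: normalise_Hom_psh)
      then obtain \<gamma> where "\<gamma> \<in> Hom (psh C) \<phi> G" "agree D \<psi> (\<lambda>d y. \<gamma> d (\<eta> d y)) \<beta>"
        using univ[of G "normalise D \<psi> \<beta>"] G by auto
      then show "\<exists>\<gamma>. natural C \<phi> G \<gamma> \<and> agree D \<psi> (\<lambda>d y. \<gamma> d (\<eta> d y)) \<beta>"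
        using G \<phi> by (intro exI[of _ \<gamma>]) (simp add: Hom_psh)
    next
      fix G \<gamma> \<gamma>' assume G: "is_presheaf C G \<and> natural C \<phi> G \<gamma> \<and> natural C \<phi> G \<gamma>' \<and>
        agree D \<psi> (\<lambda>d y. \<gamma> d (\<eta> d y)) (\<lambda>d y. \<gamma>' d (\<eta> d y))"
      have "natural D \<psi> G (\<lambda>d y. \<gamma> d (\<eta> d y))"
        using natural_comp[OF \<eta> natural_subcategory[OF D]] G by blast
      then have "normalise D \<psi> (\<lambda>d y. \<gamma> d (\<eta> d y)) \<in> Hom (psh D) \<psi> (?r G)"
        using \<psi> r G by (simp add: normalise_Hom_psh)
      from univ[OF _ this] obtain k where k: "\<And>g. g \<in> Hom (psh C) \<phi> G \<Longrightarrow>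
          agree D \<psi> (\<lambda>d y. g d (\<eta> d y)) (\<lambda>d y. \<gamma> d (\<eta> d y)) \<Longrightarrow> g = k"
        using G by auto
      have "normalise C \<phi> \<gamma> = k" "normalise C \<phi> \<gamma>' = k"
        using G \<phi> natural_mem[OF \<eta>] subcategory_obj[OF D]
        by (intro k normalise_Hom_psh; simp add: agree_def)+
      then show "agree C \<phi> \<gamma> \<gamma>'"
        using normalise_eq_iff[of C \<phi> \<gamma> \<gamma>'] by simp
    qed
    then show "\<exists>\<eta>. natural_lan D C \<psi> \<phi> \<eta>"
      by blast
  next
    assume "\<exists>\<eta>. natural_lan D C \<psi> \<phi> \<eta>"
    then obtain \<eta> where \<eta>: "natural_lan D C \<psi> \<phi> \<eta>" ..
    have mem: "\<eta> d y \<in> OMap \<phi> d" if "d \<in> Obj D" "y \<in> OMap \<psi> d" for d y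
      using natural_lan_unit[OF \<eta>] that by (rule natural_mem)
    have norm: "agree D \<psi> (\<lambda>d y. \<gamma> d (normalise D \<psi> \<eta> d y)) \<beta> \<longleftrightarrow> agree D \<psi> (\<lambda>d y. \<gamma> d (\<eta> d y)) \<beta>" for \<gamma> \<beta>
      by (simp add: agree_def)
    show "is_left_kan_extension (opcat D) (opcat C) setcat inclusion \<psi> \<phi>"
      unfolding lan norm
    proof (intro bexI[of _ "normalise D \<psi> \<eta>"] allI impI ballI)
      show "normalise D \<psi> \<eta> \<in> Hom (psh D) \<psi> (?r \<phi>)"
        using natural_lan_unit[OF \<eta>] \<psi> \<phi> r by (simp add: normalise_Hom_psh)
      fix G \<beta> assume G: "is_presheaf C G" and "\<beta> \<in> Hom (psh D) \<psi> (?r G)"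
      then have "natural D \<psi> G \<beta>"
        using \<psi> r by (simp add: Hom_psh)
      then obtain \<gamma> where \<gamma>: "natural C \<phi> G \<gamma>" "agree D \<psi> (\<lambda>d y. \<gamma> d (\<eta> d y)) \<beta>"
        using natural_lan_extend[OF \<eta> G] by blast
      show "\<exists>!\<gamma>. \<gamma> \<in> Hom (psh C) \<phi> G \<and> agree D \<psi> (\<lambda>d y. \<gamma> d (normalise D \<psi> \<eta> d y)) \<beta>"
        unfolding norm
      proof (rule ex1I[of _ "normalise C \<phi> \<gamma>"])
        show "normalise C \<phi> \<gamma> \<in> Hom (psh C) \<phi> G \<and> agree D \<psi> (\<lambda>d y. normalise C \<phi> \<gamma> d (\<eta> d y)) \<beta>"
          using normalise_Hom_psh[OF \<phi> G \<gamma>(1)] \<gamma>(2) mem subcategory_obj[OF D] by (simp add: agree_def)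
      next
        fix g assume g: "g \<in> Hom (psh C) \<phi> G \<and> agree D \<psi> (\<lambda>d y. g d (\<eta> d y)) \<beta>"
        then have "agree C \<phi> g \<gamma>"
          using natural_lan_unique[OF \<eta> G _ \<gamma>(1), of g] \<gamma>(2) \<phi> G by (simp add: Hom_psh agree_def)
        then show "g = normalise C \<phi> \<gamma>"
          using g by (intro Hom_psh_eqI[OF \<phi> G _ normalise_Hom_psh[OF \<phi> G \<gamma>(1)]]) simp_all
      qed
    qed
  qed
qed

lemma natural_lan_iso:
  assumes \<eta>: "natural_lan D C \<psi> \<phi> \<eta>" and \<eta>': "natural_lan D C \<psi> \<phi>' \<eta>'"
    and \<phi>: "is_presheaf C \<phi>" and \<phi>': "is_presheaf C \<phi>'"
  obtains \<alpha> \<beta> where "natural C \<phi> \<phi>' \<alpha>" "natural C \<phi>' \<phi> \<beta>"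
    "agree D \<psi> (\<lambda>d y. \<alpha> d (\<eta> d y)) \<eta>'" "agree D \<psi> (\<lambda>d y. \<beta> d (\<eta>' d y)) \<eta>"
    "agree C \<phi> (\<lambda>a x. \<beta> a (\<alpha> a x)) (\<lambda>a x. x)" "agree C \<phi>' (\<lambda>a x. \<alpha> a (\<beta> a x)) (\<lambda>a x. x)"
proof -
  obtain \<alpha> where \<alpha>: "natural C \<phi> \<phi>' \<alpha>" "agree D \<psi> (\<lambda>d y. \<alpha> d (\<eta> d y)) \<eta>'"
    using natural_lan_extend[OF \<eta> \<phi>' natural_lan_unit[OF \<eta>']] by blast
  obtain \<beta> where \<beta>: "natural C \<phi>' \<phi> \<beta>" "agree D \<psi> (\<lambda>d y. \<beta> d (\<eta>' d y)) \<eta>"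
    using natural_lan_extend[OF \<eta>' \<phi> natural_lan_unit[OF \<eta>]] by blast
  have "agree C \<phi> (\<lambda>a x. \<beta> a (\<alpha> a x)) (\<lambda>a x. x)"
    by (rule natural_lan_unique[OF \<eta> \<phi> natural_comp[OF \<alpha>(1) \<beta>(1)] natural_id])
      (use \<alpha> \<beta> in \<open>simp add: agree_def\<close>)
  moreover have "agree C \<phi>' (\<lambda>a x. \<alpha> a (\<beta> a x)) (\<lambda>a x. x)"
    by (rule natural_lan_unique[OF \<eta>' \<phi>' natural_comp[OF \<beta>(1) \<alpha>(1)] natural_id])
      (use \<alpha> \<beta> in \<open>simp add: agree_def\<close>)
  ultimately show ?thesis
    using \<alpha> \<beta> that by blast
qed

lemma natural_lan_isomorphic:
  assumes "natural_lan D C \<psi> \<phi> \<eta>" "natural_lan D C \<psi> \<phi>' \<eta>'" "is_presheaf C \<phi>" "is_presheaf C \<phi>'"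
  shows "isomorphic (psh C) \<phi> \<phi>'"
proof -
  obtain \<alpha> \<beta> where "natural C \<phi> \<phi>' \<alpha>" "natural C \<phi>' \<phi> \<beta>"
    "agree C \<phi> (\<lambda>a x. \<beta> a (\<alpha> a x)) (\<lambda>a x. x)" "agree C \<phi>' (\<lambda>a x. \<alpha> a (\<beta> a x)) (\<lambda>a x. x)"
    using natural_lan_iso[OF assms] .
  then show ?thesis
    unfolding isomorphic_psh using assms(3,4) by (intro conjI exI[of _ \<alpha>] exI[of _ \<beta>])
qed

lemma natural_lan_transport_target:
  assumes \<eta>: "natural_lan D C \<psi> \<phi> \<eta>" and D: "subcategory D C" and iso: "isomorphic (psh C) \<phi> \<phi>'"
  shows "\<exists>\<eta>'. natural_lan D C \<psi> \<phi>' \<eta>'"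
proof -
  obtain \<alpha> \<beta> where ab: "natural C \<phi> \<phi>' \<alpha>" "natural C \<phi>' \<phi> \<beta>"
    "agree C \<phi> (\<lambda>a x. \<beta> a (\<alpha> a x)) (\<lambda>a x. x)" "agree C \<phi>' (\<lambda>a x. \<alpha> a (\<beta> a x)) (\<lambda>a x. x)"
    using iso unfolding isomorphic_psh by blast
  have mem: "\<eta> d y \<in> OMap \<phi> d" if "d \<in> Obj D" "y \<in> OMap \<psi> d" for d y
    using natural_lan_unit[OF \<eta>] that by (rule natural_mem)
  have ba: "\<beta> d (\<alpha> d (\<eta> d y)) = \<eta> d y" if "d \<in> Obj D" "y \<in> OMap \<psi> d" for d y
    using ab(3) mem that subcategory_obj[OF D] by (simp add: agree_def)
  have "natural_lan D C \<psi> \<phi>' (\<lambda>d y. \<alpha> d (\<eta> d y))"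
    unfolding natural_lan_def
  proof (intro conjI allI impI)
    show "natural D \<psi> \<phi>' (\<lambda>d y. \<alpha> d (\<eta> d y))"
      using natural_lan_unit[OF \<eta>] natural_subcategory[OF D ab(1)] by (rule natural_comp)
  next
    fix G \<delta> assume "is_presheaf C G \<and> natural D \<psi> G \<delta>"
    then obtain \<gamma> where \<gamma>: "natural C \<phi> G \<gamma>" "agree D \<psi> (\<lambda>d y. \<gamma> d (\<eta> d y)) \<delta>"
      using natural_lan_extend[OF \<eta>] by blast
    then show "\<exists>\<gamma>. natural C \<phi>' G \<gamma> \<and> agree D \<psi> (\<lambda>d y. \<gamma> d (\<alpha> d (\<eta> d y))) \<delta>"
      using ba natural_comp[OF ab(2) \<gamma>(1)]
      by (intro exI[of _ "\<lambda>a x. \<gamma> a (\<beta> a x)"]) (simp add: agree_def)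
  next
    fix G \<gamma> \<gamma>' assume *: "is_presheaf C G \<and> natural C \<phi>' G \<gamma> \<and> natural C \<phi>' G \<gamma>' \<and>
        agree D \<psi> (\<lambda>d y. \<gamma> d (\<alpha> d (\<eta> d y))) (\<lambda>d y. \<gamma>' d (\<alpha> d (\<eta> d y)))"
    then have "agree C \<phi> (\<lambda>a x. \<gamma> a (\<alpha> a x)) (\<lambda>a x. \<gamma>' a (\<alpha> a x))"
      using natural_lan_unique[OF \<eta>] natural_comp[OF ab(1)] by blast
    then show "agree C \<phi>' \<gamma> \<gamma>'"
      using natural_mem[OF ab(2)] ab(4) by (simp add: agree_def) metis
  qed
  then show ?thesis
    by blast
qed

lemma natural_lan_transport_source:
  assumes \<eta>: "natural_lan D C \<psi> \<phi> \<eta>" and D: "subcategory D C" and iso: "isomorphic (psh D) \<psi> \<psi>'"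
  shows "\<exists>\<eta>'. natural_lan D C \<psi>' \<phi> \<eta>'"
proof -
  obtain \<alpha> \<beta> where ab: "natural D \<psi> \<psi>' \<alpha>" "natural D \<psi>' \<psi> \<beta>"
    "agree D \<psi> (\<lambda>a x. \<beta> a (\<alpha> a x)) (\<lambda>a x. x)" "agree D \<psi>' (\<lambda>a x. \<alpha> a (\<beta> a x)) (\<lambda>a x. x)"
    using iso unfolding isomorphic_psh by blast
  have "natural_lan D C \<psi>' \<phi> (\<lambda>d y. \<eta> d (\<beta> d y))"
    unfolding natural_lan_def
  proof (intro conjI allI impI)
    show "natural D \<psi>' \<phi> (\<lambda>d y. \<eta> d (\<beta> d y))"
      using ab(2) natural_lan_unit[OF \<eta>] by (rule natural_comp)
  next
    fix G \<delta> assume G: "is_presheaf C G \<and> natural D \<psi>' G \<delta>"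
    then obtain \<gamma> where \<gamma>: "natural C \<phi> G \<gamma>" "agree D \<psi> (\<lambda>d y. \<gamma> d (\<eta> d y)) (\<lambda>d y. \<delta> d (\<alpha> d y))"
      using natural_lan_extend[OF \<eta> _ natural_comp[OF ab(1)]] by blast
    then show "\<exists>\<gamma>. natural C \<phi> G \<gamma> \<and> agree D \<psi>' (\<lambda>d y. \<gamma> d (\<eta> d (\<beta> d y))) \<delta>"
      using natural_mem[OF ab(2)] ab(4) by (intro exI[of _ \<gamma>]) (simp add: agree_def)
  next
    fix G \<gamma> \<gamma>' assume *: "is_presheaf C G \<and> natural C \<phi> G \<gamma> \<and> natural C \<phi> G \<gamma>' \<and>
        agree D \<psi>' (\<lambda>d y. \<gamma> d (\<eta> d (\<beta> d y))) (\<lambda>d y. \<gamma>' d (\<eta> d (\<beta> d y)))"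
    then have "agree D \<psi> (\<lambda>d y. \<gamma> d (\<eta> d y)) (\<lambda>d y. \<gamma>' d (\<eta> d y))"
      using natural_mem[OF ab(1)] ab(3) by (simp add: agree_def) metis
    then show "agree C \<phi> \<gamma> \<gamma>'"
      using natural_lan_unique[OF \<eta>] * by blast
  qed
  then show ?thesis
    by blast
qed

text \<open>Left Kan extension preserves colimits, as a left adjoint does. Since the Kan extensions are given
one by one through their universal properties, the diagram \<open>H'\<close> is any diagram of Kan extensions whose
transition maps are compatible with the units. The unit \<open>\<zeta>\<close> is induced by the universal property of \<open>K\<close>, and a
family out of \<open>L\<close> corresponds to a compatible system of families out of the \<open>H' i\<close>, hence to one out of
the \<open>H i\<close>, hence to a family out of \<open>K\<close>.\<close>

lemma lan_colimit:
  assumes D: "subcategory D C" and H: "diagram D I H" and H': "diagram C I H'"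
    and \<eta>: "\<And>i. i \<in> Obj I \<Longrightarrow> natural_lan D C (OMap H i) (OMap H' i) (\<eta> i)"
    and nat: "\<And>i j f. i \<in> Obj I \<Longrightarrow> j \<in> Obj I \<Longrightarrow> f \<in> Hom I i j \<Longrightarrow>
      agree D (OMap H i) (\<lambda>d y. AMap H' i j f d (\<eta> i d y)) (\<lambda>d y. \<eta> j d (AMap H i j f d y))"
    and K: "natural_colimit D I H K k" and L: "natural_colimit C I H' L l"
  shows "\<exists>\<zeta>. natural_lan D C K L \<zeta>"
proof -
  have kc: "natural_cocone D I H K k" and lc: "natural_cocone C I H' L l"
    using K L by (auto simp: natural_colimit_def)
  have k: "natural D (OMap H i) K (k i)" and l: "natural C (OMap H' i) L (l i)" if "i \<in> Obj I" for i
    using kc lc that by (auto simp: natural_cocone_def)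
  have pL: "is_presheaf C L"
    using lc by (simp add: natural_cocone_def)
  have \<eta>mem: "\<eta> i d y \<in> OMap (OMap H' i) d"
    if "i \<in> Obj I" "d \<in> Obj D" "y \<in> OMap (OMap H i) d" for i d y
    using natural_lan_unit[OF \<eta>] that by (blast intro: natural_mem)
  have Hmem: "AMap H i j f d y \<in> OMap (OMap H j) d" if "i \<in> Obj I" "j \<in> Obj I" "f \<in> Hom I i j"
     "d \<in> Obj D" "y \<in> OMap (OMap H i) d" for i j f d y
    using H that unfolding diagram_def by (blast intro: natural_mem)
  have lf: "l j a (AMap H' i j f a x) = l i a x"
    if "i \<in> Obj I" "j \<in> Obj I" "f \<in> Hom I i j" "a \<in> Obj C" "x \<in> OMap (OMap H' i) a" for i j f a x
    using lc that by (simp add: natural_cocone_def agree_def)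
  have kf: "k j a (AMap H i j f a x) = k i a x"
    if "i \<in> Obj I" "j \<in> Obj I" "f \<in> Hom I i j" "a \<in> Obj D" "x \<in> OMap (OMap H i) a" for i j f a x
    using kc that by (simp add: natural_cocone_def agree_def)
  have nat': "AMap H' i j f d (\<eta> i d y) = \<eta> j d (AMap H i j f d y)"
    if "i \<in> Obj I" "j \<in> Obj I" "f \<in> Hom I i j" "d \<in> Obj D" "y \<in> OMap (OMap H i) d" for i j f d y
    using nat[OF that(1-3)] that by (simp add: agree_def)
  have "natural_cocone D I H (L \<circ>F inclusion) (\<lambda>i d y. l i d (\<eta> i d y))"
    unfolding natural_cocone_def
  proof (intro conjI ballI presheaf_subcategory[OF D pL])
    fix i assume "i \<in> Obj I"
    then show "natural D (OMap H i) (L \<circ>F inclusion) (\<lambda>d y. l i d (\<eta> i d y))"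
      using natural_comp[OF natural_lan_unit[OF \<eta>] natural_subcategory[OF D l]] by simp
  next
    fix i j f assume *: "i \<in> Obj I" "j \<in> Obj I" "f \<in> Hom I i j"
    have "l j d (\<eta> j d (AMap H i j f d y)) = l i d (\<eta> i d y)" if "d \<in> Obj D" "y \<in> OMap (OMap H i) d" for d y
      using lf[OF * _ \<eta>mem[OF *(1) that]] subcategory_obj[OF D] nat'[OF * that] that by simp
    then show "agree D (OMap H i) (\<lambda>d y. l j d (\<eta> j d (AMap H i j f d y))) (\<lambda>d y. l i d (\<eta> i d y))"
      by (simp add: agree_def)
  qed
  then obtain \<zeta> where \<zeta>: "natural D K (L \<circ>F inclusion) \<zeta>"
    and \<zeta>k: "\<And>i. i \<in> Obj I \<Longrightarrow> agree D (OMap H i) (\<lambda>d y. \<zeta> d (k i d y)) (\<lambda>d y. l i d (\<eta> i d y))"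
    using K unfolding natural_colimit_def by blast
  have kuniq: "agree D K h h'" if "is_presheaf C G" "natural D K G h" "natural D K G h'"
    "\<And>i. i \<in> Obj I \<Longrightarrow> agree D (OMap H i) (\<lambda>d y. h d (k i d y)) (\<lambda>d y. h' d (k i d y))" for G h h'
  proof -
    have "is_presheaf D (G \<circ>F inclusion)" "natural D K (G \<circ>F inclusion) h" "natural D K (G \<circ>F inclusion) h'"
      using presheaf_subcategory[OF D] that by simp_all
    then show ?thesis
      using K that(4) unfolding natural_colimit_def by blast
  qed
  have luniq: "agree C L h h'" if "is_presheaf C G" "natural C L G h" "natural C L G h'"
    "\<And>i. i \<in> Obj I \<Longrightarrow> agree C (OMap H' i) (\<lambda>d y. h d (l i d y)) (\<lambda>d y. h' d (l i d y))" for G h h'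
    using L that unfolding natural_colimit_def by blast
  have "natural_lan D C K L \<zeta>"
    unfolding natural_lan_def
  proof (intro conjI allI impI)
    show "natural D K L \<zeta>"
      using \<zeta> by simp
  next
    fix G \<beta> assume *: "is_presheaf C G \<and> natural D K G \<beta>"
    have "\<exists>\<gamma>. natural C (OMap H' i) G \<gamma> \<and>
        agree D (OMap H i) (\<lambda>d y. \<gamma> d (\<eta> i d y)) (\<lambda>d y. \<beta> d (k i d y))" if "i \<in> Obj I" for i
      using natural_lan_extend[OF \<eta>[OF that]] natural_comp[OF k[OF that]] * by blast
    then have "\<exists>\<gamma>. \<forall>i\<in>Obj I. natural C (OMap H' i) G (\<gamma> i) \<and>
        agree D (OMap H i) (\<lambda>d y. \<gamma> i d (\<eta> i d y)) (\<lambda>d y. \<beta> d (k i d y))"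
      by (intro bchoice) blast
    then obtain \<gamma> where \<gamma>: "\<And>i. i \<in> Obj I \<Longrightarrow> natural C (OMap H' i) G (\<gamma> i)"
      and \<gamma>\<eta>: "\<And>i. i \<in> Obj I \<Longrightarrow> agree D (OMap H i) (\<lambda>d y. \<gamma> i d (\<eta> i d y)) (\<lambda>d y. \<beta> d (k i d y))"
      by blast
    have "natural_cocone C I H' G \<gamma>"
      unfolding natural_cocone_def
    proof (intro conjI ballI)
      fix i j f assume ij: "i \<in> Obj I" "j \<in> Obj I" "f \<in> Hom I i j"
      have Hf: "natural C (OMap H' i) (OMap H' j) (AMap H' i j f)"
        using H' ij by (simp add: diagram_def)
      have "\<gamma> j d (AMap H' i j f d (\<eta> i d y)) = \<gamma> i d (\<eta> i d y)"
        if "d \<in> Obj D" "y \<in> OMap (OMap H i) d" for d y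
        using \<gamma>\<eta>[OF ij(1)] \<gamma>\<eta>[OF ij(2)] nat'[OF ij that] kf[OF ij that] Hmem[OF ij that] that
        by (simp add: agree_def)
      then show "agree C (OMap H' i) (\<lambda>a x. \<gamma> j a (AMap H' i j f a x)) (\<gamma> i)"
        using * by (intro natural_lan_unique[OF \<eta>[OF ij(1)] _ natural_comp[OF Hf \<gamma>[OF ij(2)]] \<gamma>[OF ij(1)]])
          (simp_all add: agree_def)
    qed (use * \<gamma> in auto)
    then obtain g where g: "natural C L G g"
      and gl: "\<And>i. i \<in> Obj I \<Longrightarrow> agree C (OMap H' i) (\<lambda>a x. g a (l i a x)) (\<gamma> i)"
      using L unfolding natural_colimit_def by blast
    have "agree D K (\<lambda>d y. g d (\<zeta> d y)) \<beta>"
    proof (rule kuniq)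
      show "natural D K G (\<lambda>d y. g d (\<zeta> d y))"
        using \<zeta> natural_subcategory[OF D g] natural_comp[of D K L \<zeta> G g] by simp
      show "agree D (OMap H i) (\<lambda>d y. g d (\<zeta> d (k i d y))) (\<lambda>d y. \<beta> d (k i d y))" if "i \<in> Obj I" for i
        using \<zeta>k[OF that] gl[OF that] \<gamma>\<eta>[OF that] \<eta>mem[OF that] subcategory_obj[OF D]
        by (simp add: agree_def)
    qed (use * in auto)
    then show "\<exists>\<gamma>. natural C L G \<gamma> \<and> agree D K (\<lambda>d y. \<gamma> d (\<zeta> d y)) \<beta>"
      using g by blast
  next
    fix G \<gamma> \<gamma>' assume *: "is_presheaf C G \<and> natural C L G \<gamma> \<and> natural C L G \<gamma>' \<and>
        agree D K (\<lambda>d y. \<gamma> d (\<zeta> d y)) (\<lambda>d y. \<gamma>' d (\<zeta> d y))"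
    show "agree C L \<gamma> \<gamma>'"
    proof (rule luniq)
      fix i assume i: "i \<in> Obj I"
      have "\<gamma> d (l i d (\<eta> i d y)) = \<gamma>' d (l i d (\<eta> i d y))"
        if "d \<in> Obj D" "y \<in> OMap (OMap H i) d" for d y
      proof -
        have "\<zeta> d (k i d y) = l i d (\<eta> i d y)" "k i d y \<in> OMap K d"
          using \<zeta>k[OF i] natural_mem[OF k[OF i]] that by (simp_all add: agree_def)
        then show ?thesis
          using * that unfolding agree_def by metis
      qed
      then show "agree C (OMap H' i) (\<lambda>a x. \<gamma> a (l i a x)) (\<lambda>a x. \<gamma>' a (l i a x))"
        using * natural_comp[OF l[OF i]] i
        by (intro natural_lan_unique[OF \<eta>[OF i]]) (auto simp: agree_def)
    qed (use * in auto)
  qed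
  then show ?thesis
    by blast
qed

section \<open>The elements of a left Kan extension\<close>

text \<open>The coend formula for \<open>Lan \<psi>\<close> at \<open>c\<close>: it is the quotient of the set \<open>lan_points C D \<psi> c\<close> by the equivalence
relation \<open>lan_rel C D \<psi> c\<close> that the steps \<open>(d, g, \<psi>(h)(y')) \<sim> (d', h \<circ> g, y')\<close> generate. The map
\<open>lan_value \<phi> \<eta> c\<close> sends a pair to the element of \<open>\<phi> c\<close> that it represents when \<open>\<phi>\<close> is the Kan extension with
unit \<open>\<eta>\<close>. The category \<open>C\<close> is a parameter of the points and of the relation, because the comparison of zigzags in \<open>C\<close> with
those in a smaller category is what the proof is about.\<close>

definition lan_points ::
  "('o, 'm) cat \<Rightarrow> ('o, 'm) cat \<Rightarrow> ('o, 'm, 'u) presheaf \<Rightarrow> 'o \<Rightarrow> ('o \<times> 'm \<times> 'u) set" where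
  "lan_points C D \<psi> c = {(d, g, y). d \<in> Obj D \<and> g \<in> Hom C c d \<and> y \<in> OMap \<psi> d}"

definition lan_step ::
  "('o, 'm) cat \<Rightarrow> ('o, 'm) cat \<Rightarrow> ('o, 'm, 'u) presheaf \<Rightarrow> 'o \<Rightarrow> ('o \<times> 'm \<times> 'u) rel" where
  "lan_step C D \<psi> c = {((d, g, y), (d', g', y')). d \<in> Obj D \<and> d' \<in> Obj D \<and> g \<in> Hom C c d \<and> g' \<in> Hom C c d' \<and>
     y' \<in> OMap \<psi> d' \<and> (\<exists>h\<in>Hom D d d'. g' = Comp C c d d' h g \<and> y = AMap \<psi> d' d h y')}"

definition lan_rel ::
  "('o, 'm) cat \<Rightarrow> ('o, 'm) cat \<Rightarrow> ('o, 'm, 'u) presheaf \<Rightarrow> 'o \<Rightarrow> ('o \<times> 'm \<times> 'u) rel" where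
  "lan_rel C D \<psi> c = (lan_step C D \<psi> c \<union> (lan_step C D \<psi> c)\<inverse>)\<^sup>*"

definition lan_value ::
  "('o, 'm, 'u) presheaf \<Rightarrow> ('o \<Rightarrow> 'u \<Rightarrow> 'u) \<Rightarrow> 'o \<Rightarrow> 'o \<times> 'm \<times> 'u \<Rightarrow> 'u" where
  "lan_value \<phi> \<eta> c = (\<lambda>(d, g, y). AMap \<phi> d c g (\<eta> d y))"

definition pointwise_lan ::
  "('o, 'm) cat \<Rightarrow> ('o, 'm) cat \<Rightarrow> ('o, 'm, 'u) presheaf \<Rightarrow> ('o, 'm, 'u) presheaf \<Rightarrow>
   ('o \<Rightarrow> 'u \<Rightarrow> 'u) \<Rightarrow> bool" where
  "pointwise_lan D C \<psi> \<phi> \<eta> \<longleftrightarrow> natural D \<psi> \<phi> \<eta> \<and> (\<forall>c\<in>Obj C.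
     OMap \<phi> c = lan_value \<phi> \<eta> c ` lan_points C D \<psi> c \<and>
     (\<forall>p\<in>lan_points C D \<psi> c. \<forall>p'\<in>lan_points C D \<psi> c.
        lan_value \<phi> \<eta> c p = lan_value \<phi> \<eta> c p' \<longrightarrow> (p, p') \<in> lan_rel C D \<psi> c))"

lemma
  assumes "pointwise_lan D C \<psi> \<phi> \<eta>"
  shows pointwise_lan_unit: "natural D \<psi> \<phi> \<eta>"
    and pointwise_lan_obj: "c \<in> Obj C \<Longrightarrow> OMap \<phi> c = lan_value \<phi> \<eta> c ` lan_points C D \<psi> c"
    and pointwise_lan_rel: "c \<in> Obj C \<Longrightarrow> p \<in> lan_points C D \<psi> c \<Longrightarrow> p' \<in> lan_points C D \<psi> c \<Longrightarrow>
        lan_value \<phi> \<eta> c p = lan_value \<phi> \<eta> c p' \<Longrightarrow> (p, p') \<in> lan_rel C D \<psi> c"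
  using assms unfolding pointwise_lan_def by blast+

lemma lan_rel_refl [simp]: "(p, p) \<in> lan_rel C D \<psi> c"
  by (simp add: lan_rel_def)

lemma lan_rel_step: "(p, q) \<in> lan_step C D \<psi> c \<Longrightarrow> (p, q) \<in> lan_rel C D \<psi> c"
  by (auto simp: lan_rel_def)

lemma lan_rel_sym: "(p, q) \<in> lan_rel C D \<psi> c \<Longrightarrow> (q, p) \<in> lan_rel C D \<psi> c"
  unfolding lan_rel_def by (meson symD sym_Un_converse sym_rtrancl)

lemma lan_rel_trans: "(p, q) \<in> lan_rel C D \<psi> c \<Longrightarrow> (q, r) \<in> lan_rel C D \<psi> c \<Longrightarrow> (p, r) \<in> lan_rel C D \<psi> c"
  unfolding lan_rel_def by (rule rtrancl_trans)

lemma lan_rel_induct: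
  assumes "(p, q) \<in> lan_rel C D \<psi> c" "\<And>x. R x x" "\<And>x y. R x y \<Longrightarrow> R y x"
    "\<And>x y z. R x y \<Longrightarrow> R y z \<Longrightarrow> R x z" "\<And>x y. (x, y) \<in> lan_step C D \<psi> c \<Longrightarrow> R x y"
  shows "R p q"
  using assms(1) unfolding lan_rel_def
proof (induction rule: rtrancl_induct)
  case (step y z)
  then have "R y z"
    using assms(3,5) by blast
  with step show ?case
    using assms(4) by blast
qed (rule assms(2))

lemma lan_value_cong:
  assumes D: "subcategory D C" and \<phi>: "is_presheaf C \<phi>" and \<eta>: "natural D \<psi> \<phi> \<eta>"
    and c: "c \<in> Obj C" and pq: "(p, q) \<in> lan_rel C D \<psi> c"
  shows "lan_value \<phi> \<eta> c p = lan_value \<phi> \<eta> c q"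
  using pq
proof (rule lan_rel_induct)
  fix p q assume "(p, q) \<in> lan_step C D \<psi> c"
  then obtain d g y d' y' h where *: "p = (d, g, y)" "q = (d', Comp C c d d' h g, y')"
      "d \<in> Obj D" "d' \<in> Obj D" "g \<in> Hom C c d" "y' \<in> OMap \<psi> d'" "h \<in> Hom D d d'" "y = AMap \<psi> d' d h y'"
    by (auto simp: lan_step_def)
  have "AMap \<phi> d' c (Comp C c d d' h g) (\<eta> d' y') = AMap \<phi> d c g (AMap \<phi> d' d h (\<eta> d' y'))"
    using * c subcategory_obj[OF D] subcategory_hom[OF D] natural_mem[OF \<eta>]
    by (intro presheaf_comp[OF \<phi>]) auto
  also have "AMap \<phi> d' d h (\<eta> d' y') = \<eta> d y"
    using natural_act[OF \<eta> *(3,4,7,6)] * by simp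
  finally show "lan_value \<phi> \<eta> c p = lan_value \<phi> \<eta> c q"
    by (simp add: lan_value_def *)
qed auto

text \<open>A natural family out of a Kan extension is determined on all represented elements by its
composite with the unit.\<close>

lemma lan_value_natural:
  assumes D: "subcategory D C" and \<eta>: "natural D \<psi> \<phi> \<eta>" and \<gamma>: "natural C \<phi> G \<gamma>"
    and \<beta>: "agree D \<psi> (\<lambda>d y. \<gamma> d (\<eta> d y)) \<beta>" and "c \<in> Obj C" "p \<in> lan_points C D \<psi> c"
  shows "\<gamma> c (lan_value \<phi> \<eta> c p) = lan_value G \<beta> c p"
proof -
  obtain d g y where *: "p = (d, g, y)" "d \<in> Obj D" "g \<in> Hom C c d" "y \<in> OMap \<psi> d"
    using assms(6) by (auto simp: lan_points_def)
  then show ?thesis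
    using natural_act[OF \<gamma> \<open>c \<in> Obj C\<close>, of d g "\<eta> d y"] natural_mem[OF \<eta>, of d y] subcategory_obj[OF D] \<beta>
    by (simp add: lan_value_def agree_def)
qed

definition lan_act :: "('o, 'm) cat \<Rightarrow> 'o \<Rightarrow> 'o \<Rightarrow> 'm \<Rightarrow> 'o \<times> 'm \<times> 'u \<Rightarrow> 'o \<times> 'm \<times> 'u" where
  "lan_act C b a f = (\<lambda>(d, g, y). (d, Comp C a b d g f, y))"

lemma lan_act_mem:
  assumes "category C" "subcategory D C" "a \<in> Obj C" "b \<in> Obj C" "f \<in> Hom C a b" "p \<in> lan_points C D \<psi> b"
  shows "lan_act C b a f p \<in> lan_points C D \<psi> a"
  using assms category.comp_in_hom[OF assms(1)] subcategory_obj[OF assms(2)]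
  by (auto simp: lan_act_def lan_points_def)

lemma lan_value_act:
  assumes D: "subcategory D C" and \<phi>: "is_presheaf C \<phi>" and \<eta>: "natural D \<psi> \<phi> \<eta>"
    and *: "a \<in> Obj C" "b \<in> Obj C" "f \<in> Hom C a b" "p \<in> lan_points C D \<psi> b"
  shows "lan_value \<phi> \<eta> a (lan_act C b a f p) = AMap \<phi> b a f (lan_value \<phi> \<eta> b p)"
  using * subcategory_obj[OF D] natural_mem[OF \<eta>]
  by (auto simp: lan_value_def lan_act_def lan_points_def presheaf_comp[OF \<phi>])

lemma lan_point_unit:
  assumes "category C" "subcategory D C" "d \<in> Obj D" "y \<in> OMap \<psi> d"
  shows "(d, Ident C d, y) \<in> lan_points C D \<psi> d"
  using assms category.ident_in_hom[OF assms(1)] subcategory_obj[OF assms(2)]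
  by (auto simp: lan_points_def)

lemma lan_value_unit:
  assumes "subcategory D C" "is_presheaf C \<phi>" "natural D \<psi> \<phi> \<eta>" "d \<in> Obj D" "y \<in> OMap \<psi> d"
  shows "lan_value \<phi> \<eta> d (d, Ident C d, y) = \<eta> d y"
  using assms subcategory_obj[OF assms(1)] natural_mem[OF assms(3)]
  by (simp add: lan_value_def presheaf_ident)

lemma lan_value_mem:
  assumes D: "subcategory D C" and \<phi>: "is_presheaf C \<phi>" and \<eta>: "natural D \<psi> \<phi> \<eta>"
    and c: "c \<in> Obj C" "p \<in> lan_points C D \<psi> c"
  shows "lan_value \<phi> \<eta> c p \<in> OMap \<phi> c"
  using c natural_mem[OF \<eta>] subcategory_obj[OF D]
  by (auto simp: lan_value_def lan_points_def intro!: presheaf_mem[OF \<phi>])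

text \<open>A family \<open>\<beta>\<close> out of \<open>\<psi>\<close> has to be extended by sending the element that a pair represents to the value of
the pair under \<open>\<beta>\<close>. That value is constant along zigzags, so the extension is well defined as soon as
pairs with equal value are joined by one.\<close>

lemma pointwise_lan_imp_natural_lan:
  assumes D: "subcategory D C" and C: "category C" and \<phi>: "is_presheaf C \<phi>"
    and lan: "pointwise_lan D C \<psi> \<phi> \<eta>"
  shows "natural_lan D C \<psi> \<phi> \<eta>"
  unfolding natural_lan_def
proof (intro conjI allI impI)
  show \<eta>: "natural D \<psi> \<phi> \<eta>"
    using lan by (rule pointwise_lan_unit)
  note obj = pointwise_lan_obj[OF lan]
  {
    fix G \<beta> assume "is_presheaf C G \<and> natural D \<psi> G \<beta>"
    then have G: "is_presheaf C G" and \<beta>: "natural D \<psi> G \<beta>"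
      by auto
    define \<gamma> where "\<gamma> c x = lan_value G \<beta> c (inv_into (lan_points C D \<psi> c) (lan_value \<phi> \<eta> c) x)" for c x
    have \<gamma>: "\<gamma> c (lan_value \<phi> \<eta> c p) = lan_value G \<beta> c p" if "c \<in> Obj C" "p \<in> lan_points C D \<psi> c" for c p
    proof -
      let ?q = "inv_into (lan_points C D \<psi> c) (lan_value \<phi> \<eta> c) (lan_value \<phi> \<eta> c p)"
      have "?q \<in> lan_points C D \<psi> c" "lan_value \<phi> \<eta> c ?q = lan_value \<phi> \<eta> c p"
        using that by (auto intro: inv_into_into f_inv_into_f)
      then have "(?q, p) \<in> lan_rel C D \<psi> c"
        using pointwise_lan_rel[OF lan] that by blast
      then show ?thesis
        unfolding \<gamma>_def using lan_value_cong[OF D G \<beta>] that by blast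
    qed
    have "natural C \<phi> G \<gamma>"
      unfolding natural_def
    proof (intro conjI ballI)
      fix c x assume "c \<in> Obj C" "x \<in> OMap \<phi> c"
      then show "\<gamma> c x \<in> OMap G c"
        using obj \<gamma> lan_value_mem[OF D G \<beta>] by auto
    next
      fix a b f x assume *: "a \<in> Obj C" "b \<in> Obj C" "f \<in> Hom C a b" "x \<in> OMap \<phi> b"
      then obtain p where p: "p \<in> lan_points C D \<psi> b" "x = lan_value \<phi> \<eta> b p"
        using obj by blast
      have "\<gamma> a (AMap \<phi> b a f x) = lan_value G \<beta> a (lan_act C b a f p)"
        using lan_value_act[OF D \<phi> \<eta> *(1-3) p(1)] p \<gamma>[OF *(1) lan_act_mem[OF C D *(1-3) p(1)]] by simp
      then show "\<gamma> a (AMap \<phi> b a f x) = AMap G b a f (\<gamma> b x)"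
        using lan_value_act[OF D G \<beta> *(1-3) p(1)] p \<gamma>[OF *(2)] by simp
    qed
    moreover have "\<gamma> d (\<eta> d y) = \<beta> d y" if "d \<in> Obj D" "y \<in> OMap \<psi> d" for d y
      using \<gamma>[OF _ lan_point_unit[OF C D that]] lan_value_unit[OF D \<phi> \<eta> that] lan_value_unit[OF D G \<beta> that]
        subcategory_obj[OF D] that by simp
    ultimately show "\<exists>\<gamma>. natural C \<phi> G \<gamma> \<and> agree D \<psi> (\<lambda>d y. \<gamma> d (\<eta> d y)) \<beta>"
      by (auto simp: agree_def)
  next
    fix G \<gamma> \<gamma>' assume *: "is_presheaf C G \<and> natural C \<phi> G \<gamma> \<and> natural C \<phi> G \<gamma>' \<and>
      agree D \<psi> (\<lambda>d y. \<gamma> d (\<eta> d y)) (\<lambda>d y. \<gamma>' d (\<eta> d y))"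
    then have "\<gamma> c (lan_value \<phi> \<eta> c p) = \<gamma>' c (lan_value \<phi> \<eta> c p)"
      if "c \<in> Obj C" "p \<in> lan_points C D \<psi> c" for c p
      using lan_value_natural[OF D \<eta> _ _ that, of G \<gamma> "\<lambda>d y. \<gamma>' d (\<eta> d y)"]
        lan_value_natural[OF D \<eta> _ _ that, of G \<gamma>' "\<lambda>d y. \<gamma>' d (\<eta> d y)"] by simp
    then show "agree C \<phi> \<gamma> \<gamma>'"
      using obj by (auto simp: agree_def)
  }
qed

lemma pointwise_lan_exists:
  fixes \<psi> :: "('o, 'm, 'u) presheaf"
  assumes D: "subcategory D C" and C: "category C" and \<psi>: "is_presheaf D \<psi>"
    and "regular_cardinal (infty :: 'u rel)"
    and small: "|Obj D| <o (infty :: 'u rel)" and loc: "locally_small_cat (infty :: 'u rel) C"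
  obtains \<phi> \<eta> where "is_presheaf C \<phi>" "pointwise_lan D C \<psi> \<phi> \<eta>"
proof -
  interpret regular_cardinal "infty :: 'u rel" by fact
  interpret category C by fact
  note subobj = subcategory_obj[OF D]
  define E where "E c = lan_rel C D \<psi> c \<inter> lan_points C D \<psi> c \<times> lan_points C D \<psi> c" for c
  obtain Q :: "('o, 'm, 'u) presheaf" and q where Q: "is_presheaf C Q"
    and Qobj: "\<And>c. c \<in> Obj C \<Longrightarrow> OMap Q c = q c ` lan_points C D \<psi> c"
    and eq: "\<And>c x y. c \<in> Obj C \<Longrightarrow> x \<in> lan_points C D \<psi> c \<Longrightarrow> y \<in> lan_points C D \<psi> c \<Longrightarrow>
      q c x = q c y \<longleftrightarrow> (x, y) \<in> E c"
    and nat: "\<And>a b f x. a \<in> Obj C \<Longrightarrow> b \<in> Obj C \<Longrightarrow> f \<in> Hom C a b \<Longrightarrow> x \<in> lan_points C D \<psi> b \<Longrightarrow>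
      q a (lan_act C b a f x) = AMap Q b a f (q b x)"
  proof (rule quotient_presheaf[of C "lan_points C D \<psi>" "lan_act C" E, OF C])
    fix c assume c: "c \<in> Obj C"
    have "lan_points C D \<psi> c = Sigma (Obj D) (\<lambda>d. Hom C c d \<times> OMap \<psi> d)"
      by (auto simp: lan_points_def)
    moreover have "|Sigma (Obj D) (\<lambda>d. Hom C c d \<times> OMap \<psi> d)| <o (infty :: 'u rel)"
      using small loc c subobj presheaf_size[OF \<psi>]
      by (intro small_Sigma) (auto simp: locally_small_cat_def)
    ultimately show "|lan_points C D \<psi> c| <o (infty :: 'u rel)"
      by simp
    show "equiv (lan_points C D \<psi> c) (E c)"
      unfolding E_def
      by (rule equivI) (auto simp: refl_on_def sym_def trans_def intro: lan_rel_sym lan_rel_trans)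
  next
    fix a b f p p' assume *: "a \<in> Obj C" "b \<in> Obj C" "f \<in> Hom C a b" "(p, p') \<in> E b"
    have "(lan_act C b a f p, lan_act C b a f p') \<in> lan_rel C D \<psi> a" if "(p, p') \<in> lan_rel C D \<psi> b" for p p'
      using that
    proof (rule lan_rel_induct)
      fix x y assume "(x, y) \<in> lan_step C D \<psi> b"
      then have "(lan_act C b a f x, lan_act C b a f y) \<in> lan_step C D \<psi> a"
        using * subobj subcategory_hom[OF D]
        by (auto simp: lan_step_def lan_act_def comp_assoc intro!: comp_in_hom[OF *(1,2)])
      then show "(lan_act C b a f x, lan_act C b a f y) \<in> lan_rel C D \<psi> a"
        by (rule lan_rel_step)
    qed (auto intro: lan_rel_sym lan_rel_trans)
    moreover have "p \<in> lan_points C D \<psi> b" "p' \<in> lan_points C D \<psi> b" "(p, p') \<in> lan_rel C D \<psi> b"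
      using *(4) by (simp_all add: E_def)
    ultimately show "(lan_act C b a f p, lan_act C b a f p') \<in> E a"
      by (simp add: E_def lan_act_mem[OF C D *(1-3)])
  next
    fix a b f p assume "a \<in> Obj C" "b \<in> Obj C" "f \<in> Hom C a b" "p \<in> lan_points C D \<psi> b"
    then show "lan_act C b a f p \<in> lan_points C D \<psi> a"
      by (rule lan_act_mem[OF C D])
  qed (use subobj in \<open>auto simp: lan_act_def lan_points_def comp_ident_right comp_assoc\<close>)
  define \<eta> where "\<eta> d y = q d (d, Ident C d, y)" for d y
  have q_value: "lan_value Q \<eta> c p = q c p" if c: "c \<in> Obj C" and p: "p \<in> lan_points C D \<psi> c" for c p
  proof -
    obtain d g y where *: "p = (d, g, y)" "d \<in> Obj D" "g \<in> Hom C c d" "y \<in> OMap \<psi> d"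
      using p by (auto simp: lan_points_def)
    then show ?thesis
      using nat[of c d g "(d, Ident C d, y)"] lan_point_unit[OF C D *(2), of y] c subobj
      by (simp add: lan_value_def \<eta>_def lan_act_def comp_ident_left)
  qed
  have \<eta>: "natural D \<psi> Q \<eta>"
    unfolding natural_def
  proof (intro conjI ballI)
    fix d y assume "d \<in> Obj D" "y \<in> OMap \<psi> d"
    then show "\<eta> d y \<in> OMap Q d"
      using subobj by (auto simp: \<eta>_def Qobj intro!: imageI lan_point_unit[OF C D])
  next
    fix d d' h y assume *: "d \<in> Obj D" "d' \<in> Obj D" "h \<in> Hom D d d'" "y \<in> OMap \<psi> d'"
    have h: "h \<in> Hom C d d'"
      using subcategory_hom[OF D] * by blast
    have y: "AMap \<psi> d' d h y \<in> OMap \<psi> d"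
      using presheaf_mem[OF \<psi>] * by blast
    let ?p = "(d, Ident C d, AMap \<psi> d' d h y)" and ?q = "(d', h, y)"
    have "(?p, ?q) \<in> lan_step C D \<psi> d"
      using * h subobj by (auto simp: lan_step_def ident_in_hom comp_ident_right intro!: bexI[of _ h])
    then have "q d ?p = q d ?q"
      using * h y subobj lan_point_unit[OF C D *(1) y]
      by (subst eq) (auto simp: E_def lan_points_def intro: lan_rel_step)
    also have "\<dots> = AMap Q d' d h (q d' (d', Ident C d', y))"
      using nat[of d d' h "(d', Ident C d', y)"] lan_point_unit[OF C D *(2,4)] * h subobj
      by (simp add: lan_act_def comp_ident_left)
    finally show "\<eta> d (AMap \<psi> d' d h y) = AMap Q d' d h (\<eta> d' y)"
      by (simp add: \<eta>_def)
  qed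
  have "pointwise_lan D C \<psi> Q \<eta>"
    unfolding pointwise_lan_def using \<eta> q_value eq by (auto simp: E_def Qobj)
  then show ?thesis
    using that Q by blast
qed

text \<open>The converse: the elements of an arbitrary Kan extension can be read off from the constructed one,
to which it is isomorphic compatibly with the units.\<close>

lemma natural_lan_imp_pointwise_lan:
  fixes \<psi> :: "('o, 'm, 'u) presheaf"
  assumes D: "subcategory D C" and C: "category C" and \<psi>: "is_presheaf D \<psi>"
    and "regular_cardinal (infty :: 'u rel)"
    and "|Obj D| <o (infty :: 'u rel)" and "locally_small_cat (infty :: 'u rel) C"
    and \<phi>: "is_presheaf C \<phi>" and lan: "natural_lan D C \<psi> \<phi> \<eta>"
  shows "pointwise_lan D C \<psi> \<phi> \<eta>"
proof -
  obtain Q \<zeta> where Q: "is_presheaf C Q" "pointwise_lan D C \<psi> Q \<zeta>"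
    using pointwise_lan_exists assms(1-6) by blast
  then have lanQ: "natural_lan D C \<psi> Q \<zeta>"
    using pointwise_lan_imp_natural_lan[OF D C] by blast
  obtain \<alpha> \<beta> where ab: "natural C \<phi> Q \<alpha>" "natural C Q \<phi> \<beta>"
    "agree D \<psi> (\<lambda>d y. \<alpha> d (\<eta> d y)) \<zeta>" "agree D \<psi> (\<lambda>d y. \<beta> d (\<zeta> d y)) \<eta>"
    "agree C \<phi> (\<lambda>a x. \<beta> a (\<alpha> a x)) (\<lambda>a x. x)"
    using natural_lan_iso[OF lan lanQ \<phi> Q(1)] .
  note \<eta> = natural_lan_unit[OF lan] and \<zeta> = natural_lan_unit[OF lanQ]
  note \<alpha> = lan_value_natural[OF D \<eta> ab(1,3)] and \<beta> = lan_value_natural[OF D \<zeta> ab(2,4)]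
  have "OMap \<phi> c = lan_value \<phi> \<eta> c ` lan_points C D \<psi> c" if "c \<in> Obj C" for c
  proof (intro equalityI subsetI)
    fix x assume x: "x \<in> OMap \<phi> c"
    then have "\<alpha> c x \<in> OMap Q c" "x = \<beta> c (\<alpha> c x)"
      using natural_mem[OF ab(1)] ab(5) that by (auto simp: agree_def)
    then show "x \<in> lan_value \<phi> \<eta> c ` lan_points C D \<psi> c"
      using pointwise_lan_obj[OF Q(2) that] \<beta>[OF that] by auto
  qed (use lan_value_mem[OF D \<phi> \<eta> that] in auto)
  moreover have "(p, p') \<in> lan_rel C D \<psi> c"
    if "c \<in> Obj C" "p \<in> lan_points C D \<psi> c" "p' \<in> lan_points C D \<psi> c"
      "lan_value \<phi> \<eta> c p = lan_value \<phi> \<eta> c p'" for c p p'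
    using that \<alpha>[of c p] \<alpha>[of c p'] by (intro pointwise_lan_rel[OF Q(2)]) auto
  ultimately show ?thesis
    using \<eta> unfolding pointwise_lan_def by blast
qed

text \<open>The Yoneda lemma in coend form: the Kan extension of \<open>D(-, c)\<close> is \<open>C(-, c)\<close>. The bijections \<open>\<theta>\<close> and \<open>\<tau>\<close> exhibit
\<open>\<psi>\<close> and \<open>\<phi>\<close> as represented by \<open>c\<close>.\<close>

lemma pointwise_lan_representable:
  assumes D: "subcategory D C" and C: "category C" and \<phi>: "is_presheaf C \<phi>"
    and c: "c \<in> Obj D"
    and \<theta>: "\<And>a. a \<in> Obj D \<Longrightarrow> bij_betw (\<theta> a) (Hom D a c) (OMap \<psi> a)"
    and \<theta>n: "\<And>a b f h. a \<in> Obj D \<Longrightarrow> b \<in> Obj D \<Longrightarrow> f \<in> Hom D a b \<Longrightarrow> h \<in> Hom D b c \<Longrightarrow>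
          \<theta> a (Comp D a b c h f) = AMap \<psi> b a f (\<theta> b h)"
    and \<tau>: "\<And>a. a \<in> Obj C \<Longrightarrow> bij_betw (\<tau> a) (Hom C a c) (OMap \<phi> a)"
    and \<tau>n: "\<And>a b f h. a \<in> Obj C \<Longrightarrow> b \<in> Obj C \<Longrightarrow> f \<in> Hom C a b \<Longrightarrow> h \<in> Hom C b c \<Longrightarrow>
          \<tau> a (Comp C a b c h f) = AMap \<phi> b a f (\<tau> b h)"
  shows "\<exists>\<eta>. pointwise_lan D C \<psi> \<phi> \<eta>"
proof -
  interpret C: category C by fact
  interpret D: category D using D by (rule subcategory_category)
  note subobj = subcategory_obj[OF D] and subhom = subcategory_hom[OF D]
  define \<eta> where "\<eta> d y = \<tau> d (inv_into (Hom D d c) (\<theta> d) y)" for d y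
  have \<eta>\<theta>: "\<eta> d (\<theta> d k) = \<tau> d k" if "d \<in> Obj D" "k \<in> Hom D d c" for d k
    using that \<theta>[OF that(1)] by (simp add: \<eta>_def bij_betw_def)
  have \<theta>surj: "\<exists>k\<in>Hom D d c. y = \<theta> d k" if "d \<in> Obj D" "y \<in> OMap \<psi> d" for d y
    using \<theta>[OF that(1)] that by (auto simp: bij_betw_def)
  have \<tau>mem: "\<tau> d k \<in> OMap \<phi> d" if "d \<in> Obj C" "k \<in> Hom C d c" for d k
    using \<tau>[OF that(1)] that by (auto simp: bij_betw_def)
  let ?i = "Ident D c"
  have i: "?i \<in> Hom D c c" "?i = Ident C c"
    using D.ident_in_hom c subcategory_ident[OF D] by auto
  have \<eta>: "natural D \<psi> \<phi> \<eta>"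
    unfolding natural_def
  proof (intro conjI ballI)
    fix d y assume "d \<in> Obj D" "y \<in> OMap \<psi> d"
    then show "\<eta> d y \<in> OMap \<phi> d"
      using \<theta>surj[of d y] \<eta>\<theta> \<tau>mem subobj subhom c by auto
  next
    fix d d' h y assume *: "d \<in> Obj D" "d' \<in> Obj D" "h \<in> Hom D d d'" "y \<in> OMap \<psi> d'"
    then obtain k where k: "k \<in> Hom D d' c" "y = \<theta> d' k"
      using \<theta>surj by blast
    have "\<eta> d (AMap \<psi> d' d h y) = \<eta> d (\<theta> d (Comp D d d' c k h))"
      using \<theta>n * k by simp
    also have "\<dots> = \<tau> d (Comp C d d' c k h)"
      using \<eta>\<theta> D.comp_in_hom[of d d' c h k] * k c subcategory_comp[OF D, of d d' c h k] by simp
    also have "\<dots> = AMap \<phi> d' d h (\<eta> d' y)"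
      using \<tau>n[of d d' h k] \<eta>\<theta> * k c subobj subhom by simp
    finally show "\<eta> d (AMap \<psi> d' d h y) = AMap \<phi> d' d h (\<eta> d' y)" .
  qed
  \<comment> \<open>The identity of \<open>c\<close> generates \<open>\<psi>\<close>, so a single step leads from any point to one over it;
    for these, the value determines the arrow because \<open>\<tau>\<close> is injective.\<close>
  have canon: "\<exists>k\<in>Hom C a c. (p, (c, k, \<theta> c ?i)) \<in> lan_rel C D \<psi> a \<and> lan_value \<phi> \<eta> a p = \<tau> a k"
    if a: "a \<in> Obj C" and p: "p \<in> lan_points C D \<psi> a" for a p
  proof -
    obtain d g y where *: "p = (d, g, y)" "d \<in> Obj D" "g \<in> Hom C a d" "y \<in> OMap \<psi> d"
      using p by (auto simp: lan_points_def)
    obtain k where k: "k \<in> Hom D d c" "y = \<theta> d k"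
      using \<theta>surj * by blast
    have kg: "Comp C a d c k g \<in> Hom C a c"
      using C.comp_in_hom[of a d c g k] * k c a subobj subhom by simp
    have "\<theta> c ?i \<in> OMap \<psi> c"
      using \<theta>[OF c] i by (auto simp: bij_betw_def)
    moreover have "y = AMap \<psi> c d k (\<theta> c ?i)"
      using \<theta>n[of d c k ?i] D.comp_ident_left[of d c k] * k c i by simp
    ultimately have "(p, (c, Comp C a d c k g, \<theta> c ?i)) \<in> lan_step C D \<psi> a"
      using * k c kg by (auto simp: lan_step_def)
    moreover have "lan_value \<phi> \<eta> a p = \<tau> a (Comp C a d c k g)"
      using \<tau>n[of a d g k] \<eta>\<theta>[of d k] * k c a subobj subhom by (simp add: lan_value_def)
    ultimately show ?thesis
      using kg by (blast intro: lan_rel_step)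
  qed
  have "OMap \<phi> a = lan_value \<phi> \<eta> a ` lan_points C D \<psi> a" if a: "a \<in> Obj C" for a
  proof (intro equalityI subsetI)
    fix x assume "x \<in> OMap \<phi> a"
    then obtain k where k: "k \<in> Hom C a c" "x = \<tau> a k"
      using \<tau>[OF a] by (auto simp: bij_betw_def)
    have "lan_value \<phi> \<eta> a (c, k, \<theta> c ?i) = x"
      using \<tau>n[of a c k ?i] \<eta>\<theta>[OF c i(1)] k a c subobj C.ident_in_hom[of c] C.comp_ident_left[of a c k] i
      by (simp add: lan_value_def)
    moreover have "(c, k, \<theta> c ?i) \<in> lan_points C D \<psi> a"
      using \<theta>[OF c] i k c by (auto simp: bij_betw_def lan_points_def)
    ultimately show "x \<in> lan_value \<phi> \<eta> a ` lan_points C D \<psi> a"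
      by blast
  qed (use lan_value_mem[OF D \<phi> \<eta> a] in auto)
  moreover have "(p, p') \<in> lan_rel C D \<psi> a"
    if a: "a \<in> Obj C" and p: "p \<in> lan_points C D \<psi> a" and p': "p' \<in> lan_points C D \<psi> a"
      and eq: "lan_value \<phi> \<eta> a p = lan_value \<phi> \<eta> a p'" for a p p'
  proof -
    obtain k k' where k: "k \<in> Hom C a c" "(p, (c, k, \<theta> c ?i)) \<in> lan_rel C D \<psi> a" "lan_value \<phi> \<eta> a p = \<tau> a k"
      and k': "k' \<in> Hom C a c" "(p', (c, k', \<theta> c ?i)) \<in> lan_rel C D \<psi> a" "lan_value \<phi> \<eta> a p' = \<tau> a k'"
      using canon[OF a p] canon[OF a p'] by blast
    have "k = k'"
      using inj_onD[OF bij_betw_imp_inj_on[OF \<tau>[OF a]]] k k' eq by simp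
    then show ?thesis
      using k(2) k'(2) by (auto intro: lan_rel_trans lan_rel_sym)
  qed
  ultimately show ?thesis
    using \<eta> unfolding pointwise_lan_def by blast
qed

lemma representable_exists:
  assumes C: "category C" and loc: "locally_small_cat (infty :: 'u rel) C" and c: "c \<in> Obj C"
  obtains \<phi> :: "('o, 'm, 'u) presheaf" and \<theta> where "is_presheaf C \<phi>"
    "\<And>a. a \<in> Obj C \<Longrightarrow> bij_betw (\<theta> a) (Hom C a c) (OMap \<phi> a)"
    "\<And>a b f h. a \<in> Obj C \<Longrightarrow> b \<in> Obj C \<Longrightarrow> f \<in> Hom C a b \<Longrightarrow> h \<in> Hom C b c \<Longrightarrow>
          \<theta> a (Comp C a b c h f) = AMap \<phi> b a f (\<theta> b h)"
proof (rule quotient_presheaf[where 'u='u, of C "\<lambda>a. Hom C a c" "\<lambda>b a f h. Comp C a b c h f"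
      "\<lambda>a. Id_on (Hom C a c)", OF C])
  interpret category C by fact
  show "a \<in> Obj C \<Longrightarrow> |Hom C a c| <o (infty :: 'u rel)" for a
    using loc c by (simp add: locally_small_cat_def)
  show "equiv (Hom C a c) (Id_on (Hom C a c))" for a
    by (auto intro!: equivI simp: refl_on_def sym_def trans_def)
  show "Comp C a b c h f \<in> Hom C a c"
    if "a \<in> Obj C" "b \<in> Obj C" "f \<in> Hom C a b" "h \<in> Hom C b c" for a b f h
    using comp_in_hom that c by blast
  then show "(Comp C a b c h f, Comp C a b c h' f) \<in> Id_on (Hom C a c)"
    if "a \<in> Obj C" "b \<in> Obj C" "f \<in> Hom C a b" "(h, h') \<in> Id_on (Hom C b c)" for a b f h h'
    using that by auto
next
  interpret category C by fact
  fix Q :: "('o, 'm, 'u) presheaf" and q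
  assume *: "is_presheaf C Q" "\<And>a. a \<in> Obj C \<Longrightarrow> OMap Q a = q a ` Hom C a c"
    "\<And>a h h'. a \<in> Obj C \<Longrightarrow> h \<in> Hom C a c \<Longrightarrow> h' \<in> Hom C a c \<Longrightarrow>
      q a h = q a h' \<longleftrightarrow> (h, h') \<in> Id_on (Hom C a c)"
    "\<And>a b f h. a \<in> Obj C \<Longrightarrow> b \<in> Obj C \<Longrightarrow> f \<in> Hom C a b \<Longrightarrow> h \<in> Hom C b c \<Longrightarrow>
      q a (Comp C a b c h f) = AMap Q b a f (q b h)"
  have "bij_betw (q a) (Hom C a c) (OMap Q a)" if "a \<in> Obj C" for a
    using *(2,3)[OF that] by (auto simp: bij_betw_def inj_on_def)
  then show thesis
    using that *(1,4) by blast
qed (use c in \<open>auto intro: category.comp_ident_right[OF C] category.comp_assoc[OF C]\<close>)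

section \<open>Closures under weighted colimits\<close>

lemma phi_star_induct:
  assumes "\<phi> \<in> phi_star \<Phi> C" "replete (psh C) S" "\<And>\<phi>. representable C \<phi> \<Longrightarrow> \<phi> \<in> S"
    "closed_under_colimits \<Phi> (psh C) S"
  shows "\<phi> \<in> S"
  using assms unfolding phi_star_def by blast

lemma phi_star_presheaf: "\<phi> \<in> phi_star \<Phi> C \<Longrightarrow> is_presheaf C \<phi>"
proof -
  assume "\<phi> \<in> phi_star \<Phi> C"
  then have "\<phi> \<in> Obj (psh C)"
    by (rule phi_star_induct)
      (auto simp: replete_def closed_under_colimits_def representable_def isomorphic_psh
        is_weighted_colimit_def is_colimit_def cocone_def)
  then show ?thesis
    by simp
qed

lemma phi_star_isomorphic:
  "\<phi> \<in> phi_star \<Phi> C \<Longrightarrow> isomorphic (psh C) \<phi> \<phi>' \<Longrightarrow> \<phi>' \<in> phi_star \<Phi> C"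
  unfolding phi_star_def replete_def by blast

lemma phi_star_representable: "representable C \<phi> \<Longrightarrow> \<phi> \<in> phi_star \<Phi> C"
  unfolding phi_star_def by blast

lemma phi_star_colimit:
  fixes L :: "('o, 'm, 'u) presheaf"
  assumes "(J, W) \<in> \<Phi>" "is_functor J (psh C) F" "\<And>j. j \<in> Obj J \<Longrightarrow> OMap F j \<in> phi_star \<Phi> C"
    "is_weighted_colimit J W (psh C) F L"
  shows "L \<in> phi_star \<Phi> C"
  unfolding phi_star_def
proof (intro InterI CollectI)
  fix S :: "('o, 'm, 'u) presheaf set"
  assume "S \<in> {S. replete (psh C) S \<and> {\<phi>. representable C \<phi>} \<subseteq> S
                        \<and> closed_under_colimits \<Phi> (psh C) S}"
  then have S: "replete (psh C) S" "\<And>\<phi>. representable C \<phi> \<Longrightarrow> \<phi> \<in> S" "closed_under_colimits \<Phi> (psh C) S"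
    by auto
  have "OMap F j \<in> S" if "j \<in> Obj J" for j
    using phi_star_induct[OF assms(3)[OF that] S] by simp
  then show "L \<in> S"
    using S(3) assms unfolding closed_under_colimits_def by blast
qed

lemma
  assumes "is_functor J (psh C) F"
  shows functor_psh_category: "category J"
    and functor_psh_presheaf: "i \<in> Obj J \<Longrightarrow> is_presheaf C (OMap F i)"
    and functor_psh_natural: "i \<in> Obj J \<Longrightarrow> j \<in> Obj J \<Longrightarrow> f \<in> Hom J i j \<Longrightarrow>
      natural C (OMap F i) (OMap F j) (AMap F i j f)"
    and functor_psh_ident: "i \<in> Obj J \<Longrightarrow> a \<in> Obj C \<Longrightarrow> x \<in> OMap (OMap F i) a \<Longrightarrow>
      AMap F i i (Ident J i) a x = x"
    and functor_psh_comp: "i \<in> Obj J \<Longrightarrow> j \<in> Obj J \<Longrightarrow> k \<in> Obj J \<Longrightarrow> f \<in> Hom J i j \<Longrightarrow>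
      g \<in> Hom J j k \<Longrightarrow> a \<in> Obj C \<Longrightarrow> x \<in> OMap (OMap F i) a \<Longrightarrow>
      AMap F i k (Comp J i j k g f) a x = AMap F j k g a (AMap F i j f a x)"
proof -
  interpret is_functor J "psh C" F by fact
  show "category J"
    by (rule dom.category_axioms)
  show pre: "is_presheaf C (OMap F i)" if "i \<in> Obj J" for i
    using omap_in_obj[OF that] by simp
  show "natural C (OMap F i) (OMap F j) (AMap F i j f)"
    if "i \<in> Obj J" "j \<in> Obj J" "f \<in> Hom J i j"
    using amap_in_hom[OF that] pre that by (simp add: Hom_psh)
  show "i \<in> Obj J \<Longrightarrow> a \<in> Obj C \<Longrightarrow> x \<in> OMap (OMap F i) a \<Longrightarrow> AMap F i i (Ident J i) a x = x"
    using amap_ident[of i] by (simp add: Ident_psh)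
  show "AMap F i k (Comp J i j k g f) a x = AMap F j k g a (AMap F i j f a x)"
    if *: "i \<in> Obj J" "j \<in> Obj J" "k \<in> Obj J" "f \<in> Hom J i j" "g \<in> Hom J j k"
      and x: "a \<in> Obj C" "x \<in> OMap (OMap F i) a"
    unfolding amap_comp[OF *] Comp_psh using x by (rule normalise_apply)
qed

lemma functor_psh_diagram: "is_functor J (psh C) F \<Longrightarrow> diagram C J F"
  by (simp add: diagram_def functor_psh_presheaf functor_psh_natural)

lemma functor_pshI:
  assumes "category J" "\<And>i. i \<in> Obj J \<Longrightarrow> is_presheaf C (P i)"
    and nat: "\<And>i j f. i \<in> Obj J \<Longrightarrow> j \<in> Obj J \<Longrightarrow> f \<in> Hom J i j \<Longrightarrow> natural C (P i) (P j) (\<alpha> i j f)"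
    and "\<And>i. i \<in> Obj J \<Longrightarrow> agree C (P i) (\<alpha> i i (Ident J i)) (\<lambda>a x. x)"
    and comp: "\<And>i j k f g. i \<in> Obj J \<Longrightarrow> j \<in> Obj J \<Longrightarrow> k \<in> Obj J \<Longrightarrow> f \<in> Hom J i j \<Longrightarrow> g \<in> Hom J j k \<Longrightarrow>
      agree C (P i) (\<alpha> i k (Comp J i j k g f)) (\<lambda>a x. \<alpha> j k g a (\<alpha> i j f a x))"
  shows "is_functor J (psh C) \<lparr>OMap = P, AMap = (\<lambda>i j f. normalise C (P i) (\<alpha> i j f))\<rparr>"
proof (intro is_functor.intro is_functor_axioms.intro category_psh assms(1))
  fix i j k f g assume *: "i \<in> Obj J" "j \<in> Obj J" "k \<in> Obj J" "f \<in> Hom J i j" "g \<in> Hom J j k"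
  have "\<alpha> i j f a x \<in> OMap (P j) a" if "a \<in> Obj C" "x \<in> OMap (P i) a" for a x
    using nat * that by (blast intro: natural_mem)
  then show "AMap \<lparr>OMap = P, AMap = (\<lambda>i j f. normalise C (P i) (\<alpha> i j f))\<rparr> i k (Comp J i j k g f) =
    Comp (psh C) (OMap \<lparr>OMap = P, AMap = (\<lambda>i j f. normalise C (P i) (\<alpha> i j f))\<rparr> i)
      (OMap \<lparr>OMap = P, AMap = (\<lambda>i j f. normalise C (P i) (\<alpha> i j f))\<rparr> j)
      (OMap \<lparr>OMap = P, AMap = (\<lambda>i j f. normalise C (P i) (\<alpha> i j f))\<rparr> k)
      (AMap \<lparr>OMap = P, AMap = (\<lambda>i j f. normalise C (P i) (\<alpha> i j f))\<rparr> j k g)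
      (AMap \<lparr>OMap = P, AMap = (\<lambda>i j f. normalise C (P i) (\<alpha> i j f))\<rparr> i j f)"
    using comp[OF *] by (simp add: Comp_psh normalise_eq_iff agree_def)
qed (use assms in \<open>auto simp: Ident_psh normalise_eq_iff intro: normalise_Hom_psh\<close>)

lemma diagram_elements:
  assumes "diagram C J F"
  shows "diagram C (elements J W) (F \<circ>F elements_proj)"
  using assms unfolding diagram_def by (auto simp: elements_def elements_proj_def fcomp_def)

lemma elements_proj_simps [simp]:
  "OMap (F \<circ>F elements_proj) = (\<lambda>i. OMap F (fst i))"
  "AMap (F \<circ>F elements_proj) = (\<lambda>i j f. AMap F (fst i) (fst j) f)"
  by (simp_all add: elements_proj_def fcomp_def)

lemma elements_obj [simp]: "p \<in> Obj (elements J W) \<longleftrightarrow> fst p \<in> Obj J \<and> snd p \<in> OMap W (fst p)"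
  by (auto simp: elements_def)

lemma elements_hom: "f \<in> Hom (elements J W) p q \<Longrightarrow> f \<in> Hom J (fst p) (fst q)"
  by (auto simp: elements_def split: prod.splits)

lemma (in category) small_obj:
  assumes "small_cat \<kappa> C"
  shows "|Obj C| <o \<kappa>"
  using assms ident_in_hom unfolding small_cat_def
  by (elim small_inj[where f="\<lambda>a. (a, a, Ident C a)"]) (auto simp: inj_on_def arrows_def)

lemma small_hom:
  assumes "small_cat \<kappa> C" "a \<in> Obj C" "b \<in> Obj C"
  shows "|Hom C a b| <o \<kappa>"
  using assms unfolding small_cat_def
  by (elim small_inj[where f="\<lambda>f. (a, b, f)"]) (auto simp: inj_on_def arrows_def)

lemma locally_small_subcategory:
  assumes "locally_small_cat \<kappa> C" and D: "subcategory D C"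
  shows "locally_small_cat \<kappa> D"
  unfolding locally_small_cat_def
proof (intro ballI)
  fix a b assume "a \<in> Obj D" "b \<in> Obj D"
  then have "|Hom C a b| <o \<kappa>" "Hom D a b \<subseteq> Hom C a b"
    using assms(1) subcategory_obj[OF D] subcategory_hom[OF D] by (auto simp: locally_small_cat_def)
  then show "|Hom D a b| <o \<kappa>"
    by (rule small_subset)
qed

locale small_weights = regular_cardinal \<kappa> for \<kappa> :: "'k rel" +
  fixes \<Phi> :: "(('i, 'j) cat \<times> ('i, 'j, 'u) presheaf) set"
  assumes uncountable: "natLeq <o \<kappa>"
    and universe: "\<kappa> \<le>o (infty :: 'u rel)" "regular_cardinal (infty :: 'u rel)"
    and weights: "(J, W) \<in> \<Phi> \<Longrightarrow> category J \<and> small_presheaf \<kappa> J W"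
begin

lemma small_infty: "|A| <o \<kappa> \<Longrightarrow> |A| <o (infty :: 'u rel)"
  using universe(1) ordLess_ordLeq_trans by blast

lemma small_elements:
  assumes "(J, W) \<in> \<Phi>"
  shows "|Obj (elements J W)| <o \<kappa>"
proof -
  have "Obj (elements J W) = Sigma (Obj J) (OMap W)"
    by (auto simp: elements_def)
  moreover have "|Obj J| <o \<kappa>"
    using weights[OF assms] category.small_obj by (auto simp: small_presheaf_def)
  ultimately show ?thesis
    using weights[OF assms] by (auto simp: small_presheaf_def intro!: small_Sigma)
qed

lemma weighted_colimit_exists:
  fixes F :: "('i, 'j, ('o, 'm, 'u) presheaf, 'o \<Rightarrow> 'u \<Rightarrow> 'u) fctr"
  assumes "category C" "(J, W) \<in> \<Phi>" "is_functor J (psh C) F"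
  obtains L l where "is_weighted_colimit J W (psh C) F L"
    "natural_colimit C (elements J W) (F \<circ>F elements_proj) L l"
proof -
  note d = diagram_elements[OF functor_psh_diagram[OF assms(3)], of W]
  obtain L l where "natural_colimit C (elements J W) (F \<circ>F elements_proj) L l"
    by (rule colimit_exists[OF assms(1) d universe(2) small_infty[OF small_elements[OF assms(2)]]])
  then show ?thesis
    using that is_colimit_psh[OF d] unfolding is_weighted_colimit_def by blast
qed

lemma weighted_colimitE:
  assumes "is_functor J (psh C) F" "is_weighted_colimit J W (psh C) F L"
  obtains l where "natural_colimit C (elements J W) (F \<circ>F elements_proj) L l"
  using assms is_colimit_psh[OF diagram_elements[OF functor_psh_diagram[OF assms(1)]]]
  unfolding is_weighted_colimit_def by blast

text \<open>A colimit of presheaves is pointwise covered by the union of the diagram, which has size below \<open>\<kappa>\<close>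
by regularity.\<close>

lemma phi_star_small:
  assumes D: "category D" "small_cat \<kappa> D" and "\<psi> \<in> phi_star \<Phi> D"
  shows "small_presheaf \<kappa> D \<psi>"
proof -
  let ?S = "{\<psi> :: ('a, 'b, 'u) presheaf. is_presheaf D \<psi> \<and> (\<forall>a\<in>Obj D. |OMap \<psi> a| <o \<kappa>)}"
  have "\<psi> \<in> ?S"
    using assms(3)
  proof (rule phi_star_induct)
    show "replete (psh D) ?S"
      unfolding replete_def
    proof (intro conjI ballI allI impI)
      fix \<psi> \<psi>' :: "('a, 'b, 'u) presheaf" assume \<psi>: "\<psi> \<in> ?S" and "isomorphic (psh D) \<psi> \<psi>'"
      then obtain \<alpha> \<beta> where *: "is_presheaf D \<psi>'" "natural D \<psi>' \<psi> \<beta>"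
          "agree D \<psi>' (\<lambda>a x. \<alpha> a (\<beta> a x)) (\<lambda>a x. x)"
        unfolding isomorphic_psh by blast
      have "|OMap \<psi>' a| <o \<kappa>" if "a \<in> Obj D" for a
      proof (rule small_inj)
        show "|OMap \<psi> a| <o \<kappa>"
          using \<psi> that by simp
        show "inj_on (\<beta> a) (OMap \<psi>' a)"
          using *(3) that by (intro inj_on_inverseI[of _ "\<alpha> a"]) (simp add: agree_def)
        show "\<beta> a ` OMap \<psi>' a \<subseteq> OMap \<psi> a"
          using *(2) that by (auto intro: natural_mem)
      qed
      with * show "\<psi>' \<in> ?S"
        by simp
    qed auto
  next
    fix \<psi> :: "('a, 'b, 'u) presheaf" assume "representable D \<psi>"
    then obtain c \<theta> where *: "is_presheaf D \<psi>" "c \<in> Obj D"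
        "\<And>a. a \<in> Obj D \<Longrightarrow> bij_betw (\<theta> a) (Hom D a c) (OMap \<psi> a)"
      unfolding representable_def by blast
    then have "|OMap \<psi> a| <o \<kappa>" if "a \<in> Obj D" for a
      using small_image[OF small_hom[OF D(2) that *(2)], of "\<theta> a"] *(3)[OF that]
      by (simp add: bij_betw_def)
    with * show "\<psi> \<in> ?S"
      by simp
  next
    show "closed_under_colimits \<Phi> (psh D) ?S"
      unfolding closed_under_colimits_def
    proof (clarify, intro conjI ballI)
      fix J W F and L :: "('a, 'b, 'u) presheaf"
      assume JW: "(J, W) \<in> \<Phi>" and F: "is_functor J (psh D) F" and small: "\<forall>j\<in>Obj J. OMap F j \<in> ?S"
        and L: "is_weighted_colimit J W (psh D) F L"
      obtain l where l: "natural_colimit D (elements J W) (F \<circ>F elements_proj) L l"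
        using weighted_colimitE[OF F L] .
      then show "is_presheaf D L"
        by (simp add: natural_colimit_def natural_cocone_def)
      fix a assume a: "a \<in> Obj D"
      let ?X = "Sigma (Obj (elements J W)) (\<lambda>i. OMap (OMap F (fst i)) a)"
      have "OMap L a \<subseteq> (\<lambda>(i, x). l i a x) ` ?X"
        using colimit_surj[OF D(1) diagram_elements[OF functor_psh_diagram[OF F]] universe(2)
          small_infty[OF small_elements[OF JW]] l a] by force
      moreover have "|?X| <o \<kappa>"
        using small a by (intro small_Sigma small_elements[OF JW]) simp
      ultimately show "|OMap L a| <o \<kappa>"
        using small_subset small_image by blast
    qed
  qed
  then show ?thesis
    using D by (simp add: small_presheaf_def)
qed

text \<open>Induction over \<open>\<Phi>\<^sup>*[D]\<close>. Asking for some Kan extension in \<open>\<Phi>\<^sup>*[C]\<close> instead of all of them makes existence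
part of the induction: the Kan extension of a colimit is obtained as a colimit in presheaves on
\<open>C\<close>, which exists because the weight is small.\<close>

lemma phi_star_lan_exists:
  fixes \<psi> :: "('o, 'm, 'u) presheaf"
  assumes D: "subcategory D C" and C: "category C" and loc: "locally_small_cat (infty :: 'u rel) C"
    and "\<psi> \<in> phi_star \<Phi> D"
  shows "\<exists>\<phi>\<in>phi_star \<Phi> C. \<exists>\<eta>. natural_lan D C \<psi> \<phi> \<eta>"
proof -
  let ?S = "{\<psi>. is_presheaf D \<psi> \<and> (\<exists>\<phi>\<in>phi_star \<Phi> C. \<exists>\<eta>. natural_lan D C \<psi> \<phi> \<eta>)}"
  have "\<psi> \<in> ?S"
    using assms(4)
  proof (rule phi_star_induct)
    show "replete (psh D) ?S"
      unfolding replete_def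
    proof (intro conjI ballI allI impI)
      fix \<psi> \<psi>' assume "\<psi> \<in> ?S" "isomorphic (psh D) \<psi> \<psi>'"
      then show "\<psi>' \<in> ?S"
        using natural_lan_transport_source[OF _ D] by (auto simp: isomorphic_psh) blast
    qed auto
  next
    fix \<psi> :: "('o, 'm, 'u) presheaf" assume "representable D \<psi>"
    then obtain c \<theta> where \<psi>: "is_presheaf D \<psi>" and c: "c \<in> Obj D"
        and \<theta>: "\<And>a. a \<in> Obj D \<Longrightarrow> bij_betw (\<theta> a) (Hom D a c) (OMap \<psi> a)"
        "\<And>a b f h. a \<in> Obj D \<Longrightarrow> b \<in> Obj D \<Longrightarrow> f \<in> Hom D a b \<Longrightarrow> h \<in> Hom D b c \<Longrightarrow>
          \<theta> a (Comp D a b c h f) = AMap \<psi> b a f (\<theta> b h)"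
      unfolding representable_def by blast
    obtain \<phi> :: "('o, 'm, 'u) presheaf" and \<tau> where \<phi>: "is_presheaf C \<phi>"
      and \<tau>: "\<And>a. a \<in> Obj C \<Longrightarrow> bij_betw (\<tau> a) (Hom C a c) (OMap \<phi> a)"
        "\<And>a b f h. a \<in> Obj C \<Longrightarrow> b \<in> Obj C \<Longrightarrow> f \<in> Hom C a b \<Longrightarrow> h \<in> Hom C b c \<Longrightarrow>
          \<tau> a (Comp C a b c h f) = AMap \<phi> b a f (\<tau> b h)"
      using representable_exists[OF C loc subcategory_obj[OF D c]] by blast
    have "\<phi> \<in> phi_star \<Phi> C"
      using \<phi> \<tau> subcategory_obj[OF D c]
      by (intro phi_star_representable iffD2[OF representable_def] conjI bexI[of _ c] exI[of _ \<tau>]) auto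
    moreover have "\<exists>\<eta>. pointwise_lan D C \<psi> \<phi> \<eta>"
      by (rule pointwise_lan_representable[OF D C \<phi> c \<theta> \<tau>])
    ultimately show "\<psi> \<in> ?S"
      using \<psi> pointwise_lan_imp_natural_lan[OF D C \<phi>] by blast
  next
    show "closed_under_colimits \<Phi> (psh D) ?S"
      unfolding closed_under_colimits_def
    proof clarify
      fix J W F and L :: "('o, 'm, 'u) presheaf"
      assume JW: "(J, W) \<in> \<Phi>" and F: "is_functor J (psh D) F" and FS: "\<forall>j\<in>Obj J. OMap F j \<in> ?S"
        and L: "is_weighted_colimit J W (psh D) F L"
      interpret J: category J
        using F by (rule functor_psh_category)
      obtain l where l: "natural_colimit D (elements J W) (F \<circ>F elements_proj) L l"
        using weighted_colimitE[OF F L] .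
      have "\<exists>P. \<forall>j\<in>Obj J. P j \<in> phi_star \<Phi> C \<and> (\<exists>\<eta>. natural_lan D C (OMap F j) (P j) \<eta>)"
        using FS by (intro bchoice) blast
      then obtain P where P: "\<And>j. j \<in> Obj J \<Longrightarrow> P j \<in> phi_star \<Phi> C"
        and "\<forall>j\<in>Obj J. \<exists>\<eta>. natural_lan D C (OMap F j) (P j) \<eta>"
        by blast
      from bchoice[OF this(2)] obtain \<eta> where
        \<eta>: "\<And>j. j \<in> Obj J \<Longrightarrow> natural_lan D C (OMap F j) (P j) (\<eta> j)"
        by blast
      note Ppre = phi_star_presheaf[OF P]
      note unit = natural_lan_unit[OF \<eta>]
      \<comment> \<open>The chosen Kan extensions form a diagram on \<open>J\<close>, functorial because maps out of them are
        determined by their composites with the units.\<close>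
      define \<alpha> where "\<alpha> i j f = (SOME \<gamma>. natural C (P i) (P j) \<gamma> \<and>
          agree D (OMap F i) (\<lambda>d y. \<gamma> d (\<eta> i d y)) (\<lambda>d y. \<eta> j d (AMap F i j f d y)))" for i j f
      have "natural C (P i) (P j) (\<alpha> i j f) \<and>
          agree D (OMap F i) (\<lambda>d y. \<alpha> i j f d (\<eta> i d y)) (\<lambda>d y. \<eta> j d (AMap F i j f d y))"
        if "i \<in> Obj J" "j \<in> Obj J" "f \<in> Hom J i j" for i j f
        unfolding \<alpha>_def
        using natural_lan_extend[OF \<eta>[OF that(1)] Ppre[OF that(2)]
            natural_comp[OF functor_psh_natural[OF F that] unit[OF that(2)]]]
        by (rule someI_ex)
      then have \<alpha>: "\<And>i j f. i \<in> Obj J \<Longrightarrow> j \<in> Obj J \<Longrightarrow> f \<in> Hom J i j \<Longrightarrow> natural C (P i) (P j) (\<alpha> i j f)"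
        and \<alpha>\<eta>: "\<And>i j f d y. i \<in> Obj J \<Longrightarrow> j \<in> Obj J \<Longrightarrow> f \<in> Hom J i j \<Longrightarrow> d \<in> Obj D \<Longrightarrow>
          y \<in> OMap (OMap F i) d \<Longrightarrow> \<alpha> i j f d (\<eta> i d y) = \<eta> j d (AMap F i j f d y)"
        by (auto simp: agree_def)
      let ?F = "\<lparr>OMap = P, AMap = (\<lambda>i j f. normalise C (P i) (\<alpha> i j f))\<rparr>"
      have F': "is_functor J (psh C) ?F"
      proof (rule functor_pshI[OF J.category_axioms Ppre \<alpha>])
        fix i assume i: "i \<in> Obj J"
        then show "agree C (P i) (\<alpha> i i (Ident J i)) (\<lambda>a x. x)"
          using J.ident_in_hom[OF i] functor_psh_ident[OF F]
          by (intro natural_lan_unique[OF \<eta>[OF i] Ppre[OF i] \<alpha> natural_id])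
            (auto simp: agree_def \<alpha>\<eta>)
      next
        fix i j k f g assume *: "i \<in> Obj J" "j \<in> Obj J" "k \<in> Obj J" "f \<in> Hom J i j" "g \<in> Hom J j k"
        then show "agree C (P i) (\<alpha> i k (Comp J i j k g f)) (\<lambda>a x. \<alpha> j k g a (\<alpha> i j f a x))"
          using J.comp_in_hom[OF *] functor_psh_comp[OF F] natural_mem[OF functor_psh_natural[OF F]]
          by (intro natural_lan_unique[OF \<eta>[OF *(1)] Ppre[OF *(3)] \<alpha> natural_comp[OF \<alpha> \<alpha>]])
            (auto simp: agree_def \<alpha>\<eta>)
      qed
      obtain L' l' where L': "is_weighted_colimit J W (psh C) ?F L'"
        and l': "natural_colimit C (elements J W) (?F \<circ>F elements_proj) L' l'"
        using weighted_colimit_exists[OF C JW F'] .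
      have "L' \<in> phi_star \<Phi> C"
        using P by (intro phi_star_colimit[OF JW F' _ L']) simp
      moreover have "\<exists>\<zeta>. natural_lan D C L L' \<zeta>"
      proof (rule lan_colimit[OF D _ _ _ _ l l'])
        fix p q f assume *: "p \<in> Obj (elements J W)" "q \<in> Obj (elements J W)" "f \<in> Hom (elements J W) p q"
        have "f \<in> Hom J (fst p) (fst q)"
          using *(3) by (rule elements_hom)
        then show "agree D (OMap (F \<circ>F elements_proj) p)
            (\<lambda>d y. AMap (?F \<circ>F elements_proj) p q f d (\<eta> (fst p) d y))
            (\<lambda>d y. \<eta> (fst q) d (AMap (F \<circ>F elements_proj) p q f d y))"
          using * natural_mem[OF unit] subcategory_obj[OF D] by (simp add: agree_def \<alpha>\<eta>)
      qed (use \<eta> in \<open>simp_all add: diagram_elements functor_psh_diagram F F'\<close>)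
      ultimately show "is_presheaf D L \<and> (\<exists>\<phi>\<in>phi_star \<Phi> C. \<exists>\<eta>. natural_lan D C L \<phi> \<eta>)"
        using l by (auto simp: natural_colimit_def natural_cocone_def)
    qed
  qed
  then show ?thesis
    by simp
qed

lemma phi_star_lan:
  fixes \<psi> :: "('o, 'm, 'u) presheaf"
  assumes "subcategory D C" "category C" "locally_small_cat (infty :: 'u rel) C"
    and "\<psi> \<in> phi_star \<Phi> D" "is_presheaf C \<phi>" "natural_lan D C \<psi> \<phi> \<eta>"
  shows "\<phi> \<in> phi_star \<Phi> C"
  using phi_star_lan_exists[OF assms(1-4)] natural_lan_isomorphic[OF _ assms(6) _ assms(5)]
    phi_star_isomorphic phi_star_presheaf by blast

end

section \<open>Small subcategories closed under prescribed arrows\<close>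

lemma arrows_ident: "category C \<Longrightarrow> a \<in> Obj C \<Longrightarrow> (a, a, Ident C a) \<in> arrows C"
  by (simp add: arrows_def category.ident_in_hom)

lemma subcategory_arrows: "subcategory D C \<Longrightarrow> arrows D \<subseteq> arrows C"
  unfolding arrows_def subcategory_def by blast

lemma subcategory_if_arrows_subset:
  assumes D': "subcategory D' C" and D: "subcategory D C" and sub: "arrows D' \<subseteq> arrows D"
  shows "subcategory D' D"
proof -
  have obj: "a \<in> Obj D" if "a \<in> Obj D'" for a
    using sub arrows_ident[OF subcategory_category[OF D'] that] by (auto simp: arrows_def)
  have hom: "f \<in> Hom D a b" if "a \<in> Obj D'" "b \<in> Obj D'" "f \<in> Hom D' a b" for a b f
    using sub that by (auto simp: arrows_def)
  show ?thesis
    unfolding subcategory_def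
    using subcategory_category[OF D'] obj hom
    by (auto simp: subcategory_ident[OF D] subcategory_ident[OF D']
        subcategory_comp[OF D] subcategory_comp[OF D'])
qed

text \<open>A zigzag consists of finitely many arrows, so it survives in every subcategory that contains these.\<close>

lemma lan_rel_finite_support:
  assumes D': "subcategory D' C" and c: "c \<in> Obj C"
    and "(p, q) \<in> lan_rel C D' \<psi> c"
  shows "\<exists>H. finite H \<and> H \<subseteq> arrows C \<and> (\<forall>D. subcategory D C \<and> arrows D' \<subseteq> arrows D \<and> H \<subseteq> arrows D \<longrightarrow>
    (p, q) \<in> lan_rel D D' \<psi> c)"
proof -
  define S where "S p q H \<longleftrightarrow> finite H \<and> H \<subseteq> arrows C \<and>
    (\<forall>D. subcategory D C \<and> arrows D' \<subseteq> arrows D \<and> H \<subseteq> arrows D \<longrightarrow> (p, q) \<in> lan_rel D D' \<psi> c)" for p q H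
  have "\<exists>H. S p q H"
    using assms(3)
  proof (rule lan_rel_induct)
    fix p q assume "(p, q) \<in> lan_step C D' \<psi> c"
    then obtain d g y d' y' h where *: "p = (d, g, y)" "q = (d', Comp C c d d' h g, y')"
        "d \<in> Obj D'" "d' \<in> Obj D'" "g \<in> Hom C c d" "Comp C c d d' h g \<in> Hom C c d'"
        "y' \<in> OMap \<psi> d'" "h \<in> Hom D' d d'" "y = AMap \<psi> d' d h y'"
      by (auto simp: lan_step_def)
    let ?H = "{(c, d, g), (c, d', Comp C c d d' h g)}"
    have "(p, q) \<in> lan_rel D D' \<psi> c"
      if D: "subcategory D C" and sub: "arrows D' \<subseteq> arrows D" and H: "?H \<subseteq> arrows D" for D
    proof -
      have "(d, d', h) \<in> arrows D"
        using sub * by (auto simp: arrows_def)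
      then have "Comp D c d d' h g = Comp C c d d' h g"
        using H by (intro subcategory_comp[OF D]) (auto simp: arrows_def)
      then have "(p, q) \<in> lan_step D D' \<psi> c"
        using * H by (auto simp: lan_step_def arrows_def intro!: bexI[of _ h])
      then show ?thesis
        by (rule lan_rel_step)
    qed
    moreover have "?H \<subseteq> arrows C"
      using * c subcategory_obj[OF D'] by (simp add: arrows_def)
    ultimately have "S p q ?H"
      by (simp add: S_def)
    then show "\<exists>H. S p q H" ..
  next
    fix p
    have "S p p {}"
      by (simp add: S_def)
    then show "\<exists>H. S p p H" ..
  next
    fix p q assume "\<exists>H. S p q H"
    then obtain H where "S p q H" ..
    then have "S q p H"
      by (simp add: S_def lan_rel_sym)
    then show "\<exists>H. S q p H" ..
  next
    fix p q r assume "\<exists>H. S p q H" "\<exists>H. S q r H"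
    then obtain H H' where H: "S p q H" "S q r H'"
      by blast
    have "(p, r) \<in> lan_rel D D' \<psi> c"
      if "subcategory D C" "arrows D' \<subseteq> arrows D" "H \<union> H' \<subseteq> arrows D" for D
      using H that by (intro lan_rel_trans[of p q _ _ _ _ r]) (simp_all add: S_def)
    then have "S p r (H \<union> H')"
      using H by (simp add: S_def)
    then show "\<exists>H. S p r H" ..
  qed
  then show ?thesis
    by (simp add: S_def)
qed

text \<open>Countably many rounds of adding \<open>\<Gamma> s t\<close> for all \<open>s\<close> and \<open>t\<close> present suffice, since \<open>\<Gamma> s t\<close> depends on two elements only;
regularity bounds every round, and uncountability bounds their union.\<close>

lemma (in regular_cardinal) small_closure:
  fixes \<Gamma> :: "'x \<Rightarrow> 'x \<Rightarrow> 'x set"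
  assumes "natLeq <o \<kappa>" and X0: "|X0| <o \<kappa>" "X0 \<subseteq> A"
    and \<Gamma>: "\<And>s t. s \<in> A \<Longrightarrow> t \<in> A \<Longrightarrow> |\<Gamma> s t| <o \<kappa>" "\<And>s t. s \<in> A \<Longrightarrow> t \<in> A \<Longrightarrow> \<Gamma> s t \<subseteq> A"
  obtains X where "X0 \<subseteq> X" "X \<subseteq> A" "|X| <o \<kappa>" "\<And>s t. s \<in> X \<Longrightarrow> t \<in> X \<Longrightarrow> \<Gamma> s t \<subseteq> X"
proof -
  define F where "F X = X \<union> (\<Union>s\<in>X. \<Union>t\<in>X. \<Gamma> s t)" for X
  define Y where "Y n = (F ^^ n) X0" for n
  have Y_Suc: "Y (Suc n) = F (Y n)" for n
    by (simp add: Y_def)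
  have Y: "Y n \<subseteq> A \<and> |Y n| <o \<kappa>" for n
  proof (induction n)
    case 0
    then show ?case
      using X0 by (simp add: Y_def)
  next
    case (Suc n)
    then have "F (Y n) \<subseteq> A"
      using \<Gamma>(2) by (auto simp: F_def)
    moreover have "|F (Y n)| <o \<kappa>"
      unfolding F_def using Suc \<Gamma>(1) by (intro small_Un small_UN) auto
    ultimately show ?case
      by (simp add: Y_Suc)
  qed
  have mono: "Y m \<subseteq> Y n" if "m \<le> n" for m n
    using that by (rule lift_Suc_mono_le[of Y, rotated]) (auto simp: Y_Suc F_def)
  have "|UNIV :: nat set| <o \<kappa>"
    using card_of_nat assms(1) by (rule ordIso_ordLess_trans)
  then have "|\<Union>n. Y n| <o \<kappa>"
    using Y by (intro small_UN) auto
  moreover have "\<Gamma> s t \<subseteq> (\<Union>n. Y n)" if st: "s \<in> (\<Union>n. Y n)" "t \<in> (\<Union>n. Y n)" for s t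
  proof -
    obtain m n where "s \<in> Y m" "t \<in> Y n"
      using st by blast
    then have "s \<in> Y (max m n)" "t \<in> Y (max m n)"
      using mono[of m "max m n"] mono[of n "max m n"] by auto
    then have "\<Gamma> s t \<subseteq> Y (Suc (max m n))"
      by (auto simp: Y_Suc F_def)
    then show ?thesis
      by blast
  qed
  moreover have "X0 \<subseteq> (\<Union>n. Y n)"
    using UN_upper[of 0 UNIV Y] by (simp add: Y_def)
  moreover have "(\<Union>n. Y n) \<subseteq> A"
    using Y by blast
  ultimately show ?thesis
    using that by blast
qed

lemma (in regular_cardinal) small_closed_subcategory:
  fixes C :: "('o, 'm) cat"
  assumes "natLeq <o \<kappa>" and C: "category C" and X0: "|X0| <o \<kappa>" "X0 \<subseteq> arrows C"
    and \<Gamma>: "\<And>s t. s \<in> arrows C \<Longrightarrow> t \<in> arrows C \<Longrightarrow> |\<Gamma> s t| <o \<kappa>"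
      "\<And>s t. s \<in> arrows C \<Longrightarrow> t \<in> arrows C \<Longrightarrow> \<Gamma> s t \<subseteq> arrows C"
  obtains D where "subcategory D C" "small_cat \<kappa> D" "X0 \<subseteq> arrows D"
    "\<And>s t. s \<in> arrows D \<Longrightarrow> t \<in> arrows D \<Longrightarrow> \<Gamma> s t \<subseteq> arrows D"
proof -
  interpret category C by fact
  define ids :: "'o \<times> 'o \<times> 'm \<Rightarrow> ('o \<times> 'o \<times> 'm) set" where "ids = (\<lambda>(a, b, f). {(a, a, Ident C a), (b, b, Ident C b)})"
  define cmp where "cmp = (\<lambda>(a, b, f) (b', c, g). if b = b' then {(a, c, Comp C a b c g f)} else {})"
  define \<Delta> where "\<Delta> s t = \<Gamma> s t \<union> (ids s \<union> cmp s t)" for s t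
  have \<Delta>_small: "|\<Delta> s t| <o \<kappa>" if "s \<in> arrows C" "t \<in> arrows C" for s t
    unfolding \<Delta>_def
    by (rule small_Un[OF \<Gamma>(1)[OF that] small_Un[OF small_finite small_finite]])
      (auto simp: ids_def cmp_def split: prod.splits)
  have \<Delta>_arrows: "\<Delta> s t \<subseteq> arrows C" if "s \<in> arrows C" "t \<in> arrows C" for s t
    using \<Gamma>(2)[OF that] that
    by (auto simp: \<Delta>_def ids_def cmp_def arrows_def ident_in_hom comp_in_hom split: if_splits)
  obtain X where X: "X0 \<subseteq> X" "X \<subseteq> arrows C" "|X| <o \<kappa>"
    and closed: "\<And>s t. s \<in> X \<Longrightarrow> t \<in> X \<Longrightarrow> \<Delta> s t \<subseteq> X"
  proof (rule small_closure[where \<Gamma>=\<Delta>, OF assms(1) X0])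
    show "|\<Delta> s t| <o \<kappa>" if "s \<in> arrows C" "t \<in> arrows C" for s t
      using that by (rule \<Delta>_small)
    show "\<Delta> s t \<subseteq> arrows C" if "s \<in> arrows C" "t \<in> arrows C" for s t
      using that by (rule \<Delta>_arrows)
  qed (rule that)
  have id: "(a, a, Ident C a) \<in> X" "(b, b, Ident C b) \<in> X" if "(a, b, f) \<in> X" for a b f
    using closed[OF that that] by (auto simp: \<Delta>_def ids_def)
  have cmp: "(a, c, Comp C a b c g f) \<in> X" if "(a, b, f) \<in> X" "(b, c, g) \<in> X" for a b c f g
    using closed[OF that] by (auto simp: \<Delta>_def cmp_def)
  define D where "D = \<lparr>Obj = {a. (a, a, Ident C a) \<in> X}, Hom = (\<lambda>a b. {f. (a, b, f) \<in> X}),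
    Ident = Ident C, Comp = Comp C\<rparr>"
  have XC: "a \<in> Obj C \<and> b \<in> Obj C \<and> f \<in> Hom C a b" if "(a, b, f) \<in> X" for a b f
    using X(2) that by (auto simp: arrows_def)
  have "category D"
  proof
    fix a b c d f g h assume "a \<in> Obj D" "b \<in> Obj D" "c \<in> Obj D" "d \<in> Obj D"
      "f \<in> Hom D a b" "g \<in> Hom D b c" "h \<in> Hom D c d"
    then show "Comp D a c d h (Comp D a b c g f) = Comp D a b d (Comp D b c d h g) f"
      using XC by (auto simp: D_def intro!: comp_assoc)
  qed (use id cmp XC in \<open>auto simp: D_def comp_ident_left comp_ident_right\<close>)
  then have "subcategory D C"
    using XC by (auto simp: subcategory_def D_def)
  moreover have "arrows D = X"
    using id by (auto simp: arrows_def D_def)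
  moreover have "\<Gamma> s t \<subseteq> X" if "s \<in> X" "t \<in> X" for s t
    using closed[OF that] by (auto simp: \<Delta>_def)
  ultimately show ?thesis
    using X by (intro that[of D]) (simp_all add: small_cat_def)
qed

section \<open>The part of a left Kan extension seen by an intermediate subcategory\<close>

text \<open>Here \<open>\<phi>\<close> is thought of as the Kan extension of \<open>\<psi>\<close> from \<open>D'\<close> to \<open>C\<close>, and \<open>D\<close> is a category between \<open>D'\<close> and \<open>C\<close>.
The canonical map to \<open>\<phi>\<close> from the Kan extension of \<open>\<psi>\<close> to \<open>D\<close> need not be injective; \<open>lan_image\<close> is its image.\<close>

definition lan_image ::
  "('o, 'm) cat \<Rightarrow> ('o, 'm) cat \<Rightarrow> ('o, 'm, 'u) presheaf \<Rightarrow> ('o, 'm, 'u) presheaf \<Rightarrow>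
   ('o \<Rightarrow> 'u \<Rightarrow> 'u) \<Rightarrow> ('o, 'm, 'u) presheaf" where
  "lan_image D D' \<psi> \<phi> \<eta> = \<lparr>OMap = (\<lambda>d. lan_value \<phi> \<eta> d ` lan_points D D' \<psi> d),
     AMap = (\<lambda>b a f. \<lambda>x\<in>lan_value \<phi> \<eta> b ` lan_points D D' \<psi> b. AMap \<phi> b a f x)\<rparr>"

lemma lan_image_obj: "OMap (lan_image D D' \<psi> \<phi> \<eta>) d = lan_value \<phi> \<eta> d ` lan_points D D' \<psi> d"
  by (simp add: lan_image_def)

context
  fixes C D D' :: "('o, 'm) cat" and \<psi> \<phi> :: "('o, 'm, 'u) presheaf" and \<eta>
  assumes D': "subcategory D' D" and D: "subcategory D C"
    and \<phi>: "is_presheaf C \<phi>" and \<eta>: "natural D' \<psi> \<phi> \<eta>"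
begin

private abbreviation "G \<equiv> lan_image D D' \<psi> \<phi> \<eta>"

lemma lan_image_subset:
  assumes d: "d \<in> Obj D" and x: "x \<in> OMap G d"
  shows "x \<in> OMap \<phi> d"
proof -
  note * = lan_value_mem[OF D' presheaf_subcategory[OF D \<phi>], of \<psi> \<eta> d]
  show ?thesis
    using x * d \<eta> by (auto simp: lan_image_obj lan_value_def)
qed

lemma lan_image_value_act:
  assumes "a \<in> Obj D" "b \<in> Obj D" "f \<in> Hom D a b" "p \<in> lan_points D D' \<psi> b"
  shows "AMap \<phi> b a f (lan_value \<phi> \<eta> b p) = lan_value \<phi> \<eta> a (lan_act D b a f p)"
  using lan_value_act[OF D' presheaf_subcategory[OF D \<phi>], of \<psi> \<eta> a b f p] assms \<eta>
  by (simp add: lan_value_def)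

lemma lan_image_act:
  assumes "a \<in> Obj D" "b \<in> Obj D" "f \<in> Hom D a b" "x \<in> OMap G b"
  shows "AMap \<phi> b a f x \<in> OMap G a" "AMap G b a f x = AMap \<phi> b a f x"
proof -
  obtain p where p: "p \<in> lan_points D D' \<psi> b" "x = lan_value \<phi> \<eta> b p"
    using assms(4) by (auto simp: lan_image_obj)
  then show "AMap \<phi> b a f x \<in> OMap G a"
    using lan_image_value_act[OF assms(1-3)]
    by (simp add: lan_image_obj lan_act_mem[OF subcategory_category[OF D] D' assms(1-3)])
  show "AMap G b a f x = AMap \<phi> b a f x"
    using assms(4) by (simp add: lan_image_def)
qed

lemma lan_image_presheaf: "is_presheaf D G"
  unfolding is_presheaf_iff[OF subcategory_category[OF D]]
proof (intro conjI ballI)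
  interpret category D using D by (rule subcategory_category)
  note P = presheaf_subcategory[OF D \<phi>]
  show "|OMap G a| <o (infty :: 'u rel)" if "a \<in> Obj D" for a
    using presheaf_size[OF \<phi> subcategory_obj[OF D that]] by (rule small_subset) (use lan_image_subset that in blast)
  show "AMap G b a f \<in> OMap G b \<rightarrow>\<^sub>E OMap G a" if "a \<in> Obj D" "b \<in> Obj D" "f \<in> Hom D a b" for a b f
    using lan_image_act(1)[OF that] by (auto simp: lan_image_def)
  show "AMap G a a (Ident D a) x = x" if "a \<in> Obj D" "x \<in> OMap G a" for a x
    using lan_image_act(2)[of a a "Ident D a" x] presheaf_ident[OF P, of a x] that
      lan_image_subset ident_in_hom by simp
  show "AMap G c a (Comp D a b c g f) x = AMap G b a f (AMap G c b g x)"
    if "a \<in> Obj D" "b \<in> Obj D" "c \<in> Obj D" "f \<in> Hom D a b" "g \<in> Hom D b c" "x \<in> OMap G c" for a b c f g x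
    using lan_image_act(2)[of a c "Comp D a b c g f" x] presheaf_comp[OF P that(1-5), of x] that
      lan_image_subset comp_in_hom[of a b c f g] lan_image_act[of b c g x]
      lan_image_act(2)[of a b f "AMap \<phi> c b g x"] by simp
qed

lemma lan_image_unit: "natural D' \<psi> G \<eta>"
proof -
  have mem: "\<eta> d y \<in> OMap G d" if "d \<in> Obj D'" "y \<in> OMap \<psi> d" for d y
    using lan_point_unit[OF subcategory_category[OF D] D' that]
      lan_value_unit[OF D' presheaf_subcategory[OF D \<phi>], of \<psi> \<eta> d y] \<eta> that
    by (auto simp: lan_image_obj lan_value_def intro!: image_eqI)
  then show ?thesis
    using natural_act[OF \<eta>] lan_image_act(2) subcategory_obj[OF D'] subcategory_hom[OF D']
    unfolding natural_def by simp
qed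

lemma lan_image_value:
  assumes "d \<in> Obj D" "p \<in> lan_points D D' \<psi> d"
  shows "lan_value G \<eta> d p = lan_value \<phi> \<eta> d p"
  using assms lan_image_act(2) natural_mem[OF lan_image_unit] subcategory_obj[OF D']
  by (auto simp: lan_value_def lan_points_def)

text \<open>If the canonical map is injective, its image is the Kan extension itself. Injectivity says that
zigzags in \<open>C\<close> between points over \<open>D\<close> can be replaced by zigzags in \<open>D\<close>.\<close>

lemma lan_image_pointwise_lan:
  assumes "\<And>d p p'. d \<in> Obj D \<Longrightarrow> p \<in> lan_points D D' \<psi> d \<Longrightarrow> p' \<in> lan_points D D' \<psi> d \<Longrightarrow>
    lan_value \<phi> \<eta> d p = lan_value \<phi> \<eta> d p' \<Longrightarrow> (p, p') \<in> lan_rel D D' \<psi> d"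
  shows "pointwise_lan D' D \<psi> G \<eta>"
  unfolding pointwise_lan_def
  using lan_image_unit lan_image_value assms by (auto simp: lan_image_obj)

text \<open>Kan extending in two stages. A family out of the image is determined by its values on the
unit, so the universal property of \<open>\<phi>\<close> with respect to \<open>\<psi>\<close> transfers to the image.\<close>

lemma lan_image_natural_lan:
  assumes "natural_lan D' C \<psi> \<phi> \<eta>"
  shows "natural_lan D C G \<phi> (\<lambda>d x. x)"
  unfolding natural_lan_def
proof (intro conjI allI impI)
  show incl: "natural D G \<phi> (\<lambda>d x. x)"
    using lan_image_subset lan_image_act(2) by (simp add: natural_def)
  {
    fix K \<beta> assume K: "is_presheaf C K \<and> natural D G K \<beta>"
    then have "natural D' \<psi> K (\<lambda>d y. \<beta> d (\<eta> d y))"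
      using natural_comp[OF lan_image_unit natural_subcategory[OF D']] by blast
    then obtain \<gamma> where \<gamma>: "natural C \<phi> K \<gamma>" "agree D' \<psi> (\<lambda>d y. \<gamma> d (\<eta> d y)) (\<lambda>d y. \<beta> d (\<eta> d y))"
      using natural_lan_extend[OF assms] K by blast
    have "\<gamma> d x = \<beta> d x" if d: "d \<in> Obj D" and x: "x \<in> OMap G d" for d x
    proof -
      obtain p where p: "p \<in> lan_points D D' \<psi> d" "x = lan_value \<phi> \<eta> d p"
        using x by (auto simp: lan_image_obj)
      have "\<beta> d (lan_value G \<eta> d p) = lan_value K (\<lambda>d y. \<beta> d (\<eta> d y)) d p"
        using K by (intro lan_value_natural[OF D' lan_image_unit _ _ d p(1)]) auto
      moreover have "\<gamma> d (lan_value G \<eta> d p) = lan_value K (\<lambda>d y. \<beta> d (\<eta> d y)) d p"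
        using \<gamma>(2) natural_comp[OF incl natural_subcategory[OF D \<gamma>(1)]]
        by (intro lan_value_natural[OF D' lan_image_unit _ _ d p(1)])
      ultimately show ?thesis
        using lan_image_value[OF d p(1)] p by simp
    qed
    then show "\<exists>\<gamma>. natural C \<phi> K \<gamma> \<and> agree D G (\<lambda>d y. \<gamma> d y) \<beta>"
      using \<gamma> by (auto simp: agree_def)
  next
    fix K \<gamma> \<gamma>' assume "is_presheaf C K \<and> natural C \<phi> K \<gamma> \<and> natural C \<phi> K \<gamma>' \<and>
        agree D G (\<lambda>d y. \<gamma> d y) (\<lambda>d y. \<gamma>' d y)"
    then show "agree C \<phi> \<gamma> \<gamma>'"
      using natural_mem[OF lan_image_unit] subcategory_obj[OF D']
      by (intro natural_lan_unique[OF assms]) (auto simp: agree_def)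
  }
qed

end

section \<open>Descent to a small subcategory\<close>

context small_weights
begin

definition descends :: "('o, 'm) cat \<Rightarrow> ('o, 'm, 'u) presheaf \<Rightarrow> bool" where
  "descends C \<phi> \<longleftrightarrow> is_presheaf C \<phi> \<and> (\<exists>D. subcategory D C \<and> small_cat \<kappa> D \<and>
     (\<exists>\<psi>\<in>phi_star \<Phi> D. \<exists>\<eta>. natural_lan D C \<psi> \<phi> \<eta>))"

lemma descends_isomorphic:
  assumes "descends C \<phi>" and iso: "isomorphic (psh C) \<phi> \<phi>'"
  shows "descends C \<phi>'"
proof -
  obtain D \<psi> \<eta> where "subcategory D C" "small_cat \<kappa> D" "\<psi> \<in> phi_star \<Phi> D" "natural_lan D C \<psi> \<phi> \<eta>"
    using assms(1) unfolding descends_def by blast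
  moreover obtain \<eta>' where "natural_lan D C \<psi> \<phi>' \<eta>'"
    using natural_lan_transport_target iso calculation by blast
  moreover have "is_presheaf C \<phi>'"
    using iso by (simp add: isomorphic_psh)
  ultimately show ?thesis
    unfolding descends_def by blast
qed

lemma descends_representable:
  fixes \<phi> :: "('o, 'm, 'u) presheaf"
  assumes C: "category C" and loc: "locally_small_cat (infty :: 'u rel) C" and "representable C \<phi>"
  shows "descends C \<phi>"
proof -
  interpret category C by fact
  obtain c \<tau> where \<phi>: "is_presheaf C \<phi>" and c: "c \<in> Obj C"
      and \<tau>: "\<And>a. a \<in> Obj C \<Longrightarrow> bij_betw (\<tau> a) (Hom C a c) (OMap \<phi> a)"
      "\<And>a b f h. a \<in> Obj C \<Longrightarrow> b \<in> Obj C \<Longrightarrow> f \<in> Hom C a b \<Longrightarrow> h \<in> Hom C b c \<Longrightarrow>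
        \<tau> a (Comp C a b c h f) = AMap \<phi> b a f (\<tau> b h)"
    using assms(3) unfolding representable_def by blast
  define D where "D = \<lparr>Obj = {c}, Hom = (\<lambda>_ _. {Ident C c}), Ident = Ident C, Comp = Comp C\<rparr>"
  have "category D"
    by standard (use c in \<open>auto simp: D_def comp_ident_left ident_in_hom\<close>)
  then have D: "subcategory D C"
    using c by (auto simp: subcategory_def D_def ident_in_hom)
  have "arrows D = {(c, c, Ident C c)}"
    by (auto simp: arrows_def D_def)
  then have small: "small_cat \<kappa> D"
    using small_finite[of "arrows D"] by (simp add: small_cat_def)
  have cD: "c \<in> Obj D"
    by (simp add: D_def)
  obtain \<psi> :: "('o, 'm, 'u) presheaf" and \<theta> where \<psi>: "is_presheaf D \<psi>"
    and \<theta>: "\<And>a. a \<in> Obj D \<Longrightarrow> bij_betw (\<theta> a) (Hom D a c) (OMap \<psi> a)"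
      "\<And>a b f h. a \<in> Obj D \<Longrightarrow> b \<in> Obj D \<Longrightarrow> f \<in> Hom D a b \<Longrightarrow> h \<in> Hom D b c \<Longrightarrow>
        \<theta> a (Comp D a b c h f) = AMap \<psi> b a f (\<theta> b h)"
    using representable_exists[OF \<open>category D\<close> locally_small_subcategory[OF loc D] cD] by blast
  have "\<psi> \<in> phi_star \<Phi> D"
    using \<psi> \<theta> cD
    by (intro phi_star_representable iffD2[OF representable_def] conjI bexI[of _ c] exI[of _ \<theta>]) auto
  moreover have "\<exists>\<eta>. pointwise_lan D C \<psi> \<phi> \<eta>"
    by (rule pointwise_lan_representable[OF D C \<phi> cD \<theta> \<tau>])
  ultimately show ?thesis
    using \<phi> D small pointwise_lan_imp_natural_lan[OF D C \<phi>] unfolding descends_def by blast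
qed

text \<open>The first of the last two conclusions makes the maps of the diagram \<open>F\<close> restrict to the images over \<open>E\<close>, the
second one makes these images Kan extensions of the \<open>\<psi> j\<close>. The arrows for the former are put into \<open>E\<close>
from the beginning; those for the latter are supplied by the closure operator \<open>\<Gamma>\<close>, because they depend
on the arrows already present.\<close>

lemma descent_subcategory:
  fixes F :: "('i, 'j, ('o, 'm, 'u) presheaf, 'o \<Rightarrow> 'u \<Rightarrow> 'u) fctr"
  assumes C: "category C" and JW: "(J, W) \<in> \<Phi>" and F: "is_functor J (psh C) F"
    and D: "\<And>j. j \<in> Obj J \<Longrightarrow> subcategory (D j) C" "\<And>j. j \<in> Obj J \<Longrightarrow> small_cat \<kappa> (D j)"
    and \<psi>: "\<And>j a. j \<in> Obj J \<Longrightarrow> a \<in> Obj (D j) \<Longrightarrow> |OMap (\<psi> j) a| <o \<kappa>"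
    and lan: "\<And>j. j \<in> Obj J \<Longrightarrow> pointwise_lan (D j) C (\<psi> j) (OMap F j) (\<eta> j)"
  obtains E where "subcategory E C" "small_cat \<kappa> E" "\<And>j. j \<in> Obj J \<Longrightarrow> subcategory (D j) E"
    "\<And>i j f d y. i \<in> Obj J \<Longrightarrow> j \<in> Obj J \<Longrightarrow> f \<in> Hom J i j \<Longrightarrow> d \<in> Obj (D i) \<Longrightarrow> y \<in> OMap (\<psi> i) d \<Longrightarrow>
      \<exists>p\<in>lan_points E (D j) (\<psi> j) d. AMap F i j f d (\<eta> i d y) = lan_value (OMap F j) (\<eta> j) d p"
    "\<And>j d p p'. j \<in> Obj J \<Longrightarrow> d \<in> Obj E \<Longrightarrow> p \<in> lan_points E (D j) (\<psi> j) d \<Longrightarrow>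
      p' \<in> lan_points E (D j) (\<psi> j) d \<Longrightarrow>
      lan_value (OMap F j) (\<eta> j) d p = lan_value (OMap F j) (\<eta> j) d p' \<Longrightarrow> (p, p') \<in> lan_rel E (D j) (\<psi> j) d"
proof -
  interpret J: category J
    using F by (rule functor_psh_category)
  have J_small: "small_cat \<kappa> J"
    using weights[OF JW] by (auto simp: small_presheaf_def)
  note J_obj = J.small_obj[OF J_small]
  have D_obj: "|Obj (D j)| <o \<kappa>" if "j \<in> Obj J" for j
    using category.small_obj[OF subcategory_category[OF D(1)] D(2)] that by blast
  have "\<exists>p\<in>lan_points C (D j) (\<psi> j) d. AMap F i j f d (\<eta> i d y) = lan_value (OMap F j) (\<eta> j) d p"
    if ij: "i \<in> Obj J" "j \<in> Obj J" "f \<in> Hom J i j" and d: "d \<in> Obj (D i)" "y \<in> OMap (\<psi> i) d" for i j f d y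
  proof -
    have dC: "d \<in> Obj C"
      using subcategory_obj[OF D(1)[OF ij(1)] d(1)] .
    have "AMap F i j f d (\<eta> i d y) \<in> OMap (OMap F j) d"
      using natural_mem[OF functor_psh_natural[OF F ij] dC]
        natural_mem[OF pointwise_lan_unit[OF lan[OF ij(1)]] d] by blast
    then show ?thesis
      using pointwise_lan_obj[OF lan[OF ij(2)] dC] by auto
  qed
  then obtain pt where pt: "\<And>i j f d y. i \<in> Obj J \<Longrightarrow> j \<in> Obj J \<Longrightarrow> f \<in> Hom J i j \<Longrightarrow>
      d \<in> Obj (D i) \<Longrightarrow> y \<in> OMap (\<psi> i) d \<Longrightarrow> pt i j f d y \<in> lan_points C (D j) (\<psi> j) d \<and>
      AMap F i j f d (\<eta> i d y) = lan_value (OMap F j) (\<eta> j) d (pt i j f d y)"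
    by metis
  define arr :: "'o \<Rightarrow> 'o \<times> 'm \<times> 'u \<Rightarrow> 'o \<times> 'o \<times> 'm" where "arr d = (\<lambda>(d', g, y). (d, d', g))" for d
  define X1 where "X1 = (\<Union>(i, j, f)\<in>arrows J. \<Union>d\<in>Obj (D i). \<Union>y\<in>OMap (\<psi> i) d. {arr d (pt i j f d y)})"
  define X0 where "X0 = (\<Union>j\<in>Obj J. arrows (D j)) \<union> X1"
  have "|\<Union>d\<in>Obj (D i). \<Union>y\<in>OMap (\<psi> i) d. {arr d (pt i j f d y)}| <o \<kappa>" if "i \<in> Obj J" for i j f
    by (intro small_UN D_obj[OF that] \<psi>[OF that] small_finite) auto
  then have "|X1| <o \<kappa>"
    unfolding X1_def using J_small unfolding small_cat_def
    by (intro small_UN) (auto simp: arrows_def)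
  moreover have "|\<Union>j\<in>Obj J. arrows (D j)| <o \<kappa>"
    using J_obj D(2) unfolding small_cat_def by (rule small_UN)
  ultimately have X0: "|X0| <o \<kappa>"
    unfolding X0_def by (intro small_Un)
  have "arr d (pt i j f d y) \<in> arrows C"
    if "i \<in> Obj J" "j \<in> Obj J" "f \<in> Hom J i j" "d \<in> Obj (D i)" "y \<in> OMap (\<psi> i) d" for i j f d y
    using pt[OF that] subcategory_obj[OF D(1)[OF that(1)] that(4)] subcategory_obj[OF D(1)[OF that(2)]]
    by (auto simp: arr_def arrows_def lan_points_def)
  then have X0C: "X0 \<subseteq> arrows C"
    unfolding X0_def X1_def using subcategory_arrows[OF D(1)] by (fastforce simp: arrows_def[of J])
  have "\<exists>H. finite H \<and> H \<subseteq> arrows C \<and> ((p, q) \<in> lan_rel C (D j) (\<psi> j) c \<longrightarrow>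
      (\<forall>E. subcategory E C \<and> arrows (D j) \<subseteq> arrows E \<and> H \<subseteq> arrows E \<longrightarrow> (p, q) \<in> lan_rel E (D j) (\<psi> j) c))"
    if "j \<in> Obj J" "c \<in> Obj C" for j c p q
  proof (cases "(p, q) \<in> lan_rel C (D j) (\<psi> j) c")
    case True
    then show ?thesis
      using lan_rel_finite_support[OF D(1)[OF that(1)] that(2)] by simp
  next
    case False
    then show ?thesis
      by (intro exI[of _ "{}"]) simp
  qed
  then obtain H where H: "\<And>j c p q. j \<in> Obj J \<Longrightarrow> c \<in> Obj C \<Longrightarrow> finite (H j c p q) \<and> H j c p q \<subseteq> arrows C \<and>
      ((p, q) \<in> lan_rel C (D j) (\<psi> j) c \<longrightarrow> (\<forall>E. subcategory E C \<and> arrows (D j) \<subseteq> arrows E \<and>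
        H j c p q \<subseteq> arrows E \<longrightarrow> (p, q) \<in> lan_rel E (D j) (\<psi> j) c))"
    by metis
  define Y where "Y j b = (if b \<in> Obj (D j) then OMap (\<psi> j) b else {})" for j b
  have Y: "|Y j b| <o \<kappa>" if "j \<in> Obj J" for j b
    using \<psi>[OF that] small_finite[of "{}"] by (auto simp: Y_def)
  \<comment> \<open>For arrows \<open>g\<close> and \<open>g'\<close> with the same source \<open>a\<close>, the zigzags between all related points that
    they carry. Closedness will be used for such pairs.\<close>
  define \<Gamma> where "\<Gamma> = (\<lambda>(a, b, g) (a' :: 'o, b', g').
    \<Union>j\<in>Obj J. \<Union>y\<in>Y j b. \<Union>y'\<in>Y j b'. H j a (b, g, y) (b', g', y'))"
  obtain E where E: "subcategory E C" "small_cat \<kappa> E" "X0 \<subseteq> arrows E"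
    and closed: "\<And>s t. s \<in> arrows E \<Longrightarrow> t \<in> arrows E \<Longrightarrow> \<Gamma> s t \<subseteq> arrows E"
  proof (rule small_closed_subcategory[where \<Gamma>=\<Gamma>, OF uncountable C X0 X0C])
    fix s t assume "s \<in> arrows C" "t \<in> arrows C"
    then obtain a b g a' b' g' where st: "s = (a, b, g)" "t = (a', b', g')" and a: "a \<in> Obj C"
      by (auto simp: arrows_def)
    show "|\<Gamma> s t| <o \<kappa>"
      unfolding st \<Gamma>_def prod.case
      by (intro small_UN J_obj Y small_finite) (use H a in auto)
    show "\<Gamma> s t \<subseteq> arrows C"
      unfolding st \<Gamma>_def prod.case using H[OF _ a] by (intro UN_least) blast
  qed (rule that)
  have D_sub: "arrows (D j) \<subseteq> arrows E" if "j \<in> Obj J" for j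
    using E(3) that by (auto simp: X0_def)
  have DE: "subcategory (D j) E" if "j \<in> Obj J" for j
    using subcategory_if_arrows_subset[OF D(1)[OF that] E(1) D_sub[OF that]] .
  show ?thesis
  proof (rule that[OF E(1,2) DE])
    fix i j f d y assume *: "i \<in> Obj J" "j \<in> Obj J" "f \<in> Hom J i j" "d \<in> Obj (D i)" "y \<in> OMap (\<psi> i) d"
    then have "(i, j, f) \<in> arrows J"
      by (simp add: arrows_def)
    then have "arr d (pt i j f d y) \<in> X1"
      unfolding X1_def using *(4,5) by (intro UN_I[of "(i, j, f)"]) (simp_all, blast)
    then have "arr d (pt i j f d y) \<in> arrows E"
      using E(3) by (auto simp: X0_def)
    then have "pt i j f d y \<in> lan_points E (D j) (\<psi> j) d"
      using pt[OF *] by (auto simp: lan_points_def arr_def arrows_def)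
    then show "\<exists>p\<in>lan_points E (D j) (\<psi> j) d. AMap F i j f d (\<eta> i d y) = lan_value (OMap F j) (\<eta> j) d p"
      using pt[OF *] by blast
  next
    fix j d p p' assume *: "j \<in> Obj J" "d \<in> Obj E" "p \<in> lan_points E (D j) (\<psi> j) d"
      "p' \<in> lan_points E (D j) (\<psi> j) d" "lan_value (OMap F j) (\<eta> j) d p = lan_value (OMap F j) (\<eta> j) d p'"
    have dC: "d \<in> Obj C"
      using subcategory_obj[OF E(1) *(2)] .
    obtain b g y b' g' y' where p: "p = (b, g, y)" "b \<in> Obj (D j)" "g \<in> Hom E d b" "y \<in> OMap (\<psi> j) b"
      and p': "p' = (b', g', y')" "b' \<in> Obj (D j)" "g' \<in> Hom E d b'" "y' \<in> OMap (\<psi> j) b'"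
      using *(3,4) by (auto simp: lan_points_def)
    have b: "b \<in> Obj E" "b' \<in> Obj E"
      using subcategory_obj[OF DE[OF *(1)]] p p' by auto
    have "p \<in> lan_points C (D j) (\<psi> j) d" "p' \<in> lan_points C (D j) (\<psi> j) d"
      using p p' b subcategory_hom[OF E(1) *(2)] by (auto simp: lan_points_def)
    then have "(p, p') \<in> lan_rel C (D j) (\<psi> j) d"
      using pointwise_lan_rel[OF lan[OF *(1)] dC] *(5) by blast
    moreover have "\<Gamma> (d, b, g) (d, b', g') \<subseteq> arrows E"
      using p p' b *(2) by (intro closed) (auto simp: arrows_def)
    moreover have "y \<in> Y j b" "y' \<in> Y j b'"
      using p p' by (simp_all add: Y_def)
    then have "H j d p p' \<subseteq> \<Gamma> (d, b, g) (d, b', g')"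
      unfolding \<Gamma>_def prod.case p(1) p'(1) using *(1) by blast
    ultimately show "(p, p') \<in> lan_rel E (D j) (\<psi> j) d"
      using H[OF *(1) dC, of p p'] E(1) D_sub[OF *(1)] by blast
  qed
qed

text \<open>With \<open>E\<close> as in \<open>descent_subcategory\<close>, the whole diagram \<open>F\<close> is the Kan extension of a diagram \<open>G\<close> in \<open>\<Phi>\<^sup>*[E]\<close>. It
remains to take the weighted colimit of \<open>G\<close> and to use that Kan extension preserves colimits.\<close>

lemma descends_colimit:
  fixes L :: "('o, 'm, 'u) presheaf"
  assumes C: "category C" and loc: "locally_small_cat (infty :: 'u rel) C"
    and JW: "(J, W) \<in> \<Phi>" and F: "is_functor J (psh C) F"
    and FS: "\<And>j. j \<in> Obj J \<Longrightarrow> descends C (OMap F j)"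
    and L: "is_weighted_colimit J W (psh C) F L"
  shows "descends C L"
proof -
  interpret J: category J
    using F by (rule functor_psh_category)
  obtain l where l: "natural_colimit C (elements J W) (F \<circ>F elements_proj) L l"
    using weighted_colimitE[OF F L] .
  note Fpre = functor_psh_presheaf[OF F] and Fnat = functor_psh_natural[OF F]
  have "\<exists>D \<psi> \<eta>. subcategory D C \<and> small_cat \<kappa> D \<and> \<psi> \<in> phi_star \<Phi> D \<and> natural_lan D C \<psi> (OMap F j) \<eta>"
    if "j \<in> Obj J" for j
    using FS[OF that] unfolding descends_def by blast
  then obtain D \<psi> \<eta> where D: "\<And>j. j \<in> Obj J \<Longrightarrow> subcategory (D j) C" "\<And>j. j \<in> Obj J \<Longrightarrow> small_cat \<kappa> (D j)"
    and \<psi>: "\<And>j. j \<in> Obj J \<Longrightarrow> \<psi> j \<in> phi_star \<Phi> (D j)"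
    and \<eta>: "\<And>j. j \<in> Obj J \<Longrightarrow> natural_lan (D j) C (\<psi> j) (OMap F j) (\<eta> j)"
    by metis
  note Dcat = subcategory_category[OF D(1)] and \<psi>pre = phi_star_presheaf[OF \<psi>]
    and unit = natural_lan_unit[OF \<eta>]
  have lan: "pointwise_lan (D j) C (\<psi> j) (OMap F j) (\<eta> j)" if "j \<in> Obj J" for j
    using natural_lan_imp_pointwise_lan[OF D(1) C \<psi>pre universe(2) _ loc Fpre \<eta>]
      small_infty[OF category.small_obj[OF Dcat D(2)]] that by blast
  have \<psi>_small: "|OMap (\<psi> j) a| <o \<kappa>" if "j \<in> Obj J" "a \<in> Obj (D j)" for j a
    using phi_star_small[OF Dcat D(2) \<psi>] that unfolding small_presheaf_def by blast
  obtain E where E: "subcategory E C" "small_cat \<kappa> E" and DE: "\<And>j. j \<in> Obj J \<Longrightarrow> subcategory (D j) E"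
    and image: "\<And>i j f d y. i \<in> Obj J \<Longrightarrow> j \<in> Obj J \<Longrightarrow> f \<in> Hom J i j \<Longrightarrow> d \<in> Obj (D i) \<Longrightarrow> y \<in> OMap (\<psi> i) d \<Longrightarrow>
      \<exists>p\<in>lan_points E (D j) (\<psi> j) d. AMap F i j f d (\<eta> i d y) = lan_value (OMap F j) (\<eta> j) d p"
    and inj: "\<And>j d p p'. j \<in> Obj J \<Longrightarrow> d \<in> Obj E \<Longrightarrow> p \<in> lan_points E (D j) (\<psi> j) d \<Longrightarrow>
      p' \<in> lan_points E (D j) (\<psi> j) d \<Longrightarrow>
      lan_value (OMap F j) (\<eta> j) d p = lan_value (OMap F j) (\<eta> j) d p' \<Longrightarrow> (p, p') \<in> lan_rel E (D j) (\<psi> j) d"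
    using descent_subcategory[OF C JW F D \<psi>_small lan] by blast
  note Ecat = subcategory_category[OF E(1)] and Eobj = subcategory_obj[OF E(1)] and Ehom = subcategory_hom[OF E(1)]
  define G where "G j = lan_image E (D j) (\<psi> j) (OMap F j) (\<eta> j)" for j
  have G_obj: "OMap (G j) d = lan_value (OMap F j) (\<eta> j) d ` lan_points E (D j) (\<psi> j) d" for j d
    unfolding G_def by (rule lan_image_obj)
  have G_sub: "x \<in> OMap (OMap F j) d" if "j \<in> Obj J" "d \<in> Obj E" "x \<in> OMap (G j) d" for j d x
    using lan_image_subset[OF DE E(1) Fpre unit, OF that(1,1,1)] that unfolding G_def by blast
  have G_act: "AMap (G j) b a f x = AMap (OMap F j) b a f x"
    if "j \<in> Obj J" "a \<in> Obj E" "b \<in> Obj E" "f \<in> Hom E a b" "x \<in> OMap (G j) b" for j a b f x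
    using lan_image_act(2)[OF DE E(1) Fpre unit, OF that(1,1,1)] that unfolding G_def by blast
  have Gpre: "is_presheaf E (G j)" if "j \<in> Obj J" for j
    unfolding G_def using lan_image_presheaf[OF DE E(1) Fpre unit] that by blast
  have G_lan: "natural_lan (D j) E (\<psi> j) (G j) (\<eta> j)" if "j \<in> Obj J" for j
    unfolding G_def using lan_image_pointwise_lan[OF DE E(1) Fpre unit inj] that
      pointwise_lan_imp_natural_lan[OF DE Ecat Gpre] unfolding G_def by blast
  have F_lan: "natural_lan E C (G j) (OMap F j) (\<lambda>d x. x)" if "j \<in> Obj J" for j
    unfolding G_def using lan_image_natural_lan[OF DE E(1) Fpre unit \<eta>] that by blast
  have G_phi: "G j \<in> phi_star \<Phi> E" if "j \<in> Obj J" for j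
    using phi_star_lan[OF DE Ecat locally_small_subcategory[OF loc E(1)] \<psi> Gpre G_lan] that by blast
  \<comment> \<open>An element \<open>g \<cdot> \<eta> y\<close> of \<open>G i\<close> is sent to \<open>g \<cdot> F f (\<eta> y)\<close>. By the choice of \<open>E\<close> the second factor is
    represented by an arrow of \<open>E\<close>, and composing that arrow with \<open>g\<close> stays in \<open>E\<close>.\<close>
  have G_map: "AMap F i j f d x \<in> OMap (G j) d"
    if ij: "i \<in> Obj J" "j \<in> Obj J" "f \<in> Hom J i j" and d: "d \<in> Obj E" "x \<in> OMap (G i) d" for i j f d x
  proof -
    obtain b g y where *: "x = AMap (OMap F i) b d g (\<eta> i b y)" "b \<in> Obj (D i)" "g \<in> Hom E d b" "y \<in> OMap (\<psi> i) b"
      using d(2) by (auto simp: G_obj lan_points_def lan_value_def)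
    have b: "b \<in> Obj E"
      using subcategory_obj[OF DE[OF ij(1)] *(2)] .
    obtain p where p: "p \<in> lan_points E (D j) (\<psi> j) b" "AMap F i j f b (\<eta> i b y) = lan_value (OMap F j) (\<eta> j) b p"
      using image[OF ij *(2,4)] by blast
    have "AMap F i j f d x = AMap (OMap F j) b d g (lan_value (OMap F j) (\<eta> j) b p)"
      unfolding *(1) p(2)[symmetric]
      using natural_act[OF Fnat[OF ij] Eobj[OF d(1)] Eobj[OF b] Ehom[OF d(1) b *(3)]]
        natural_mem[OF unit[OF ij(1)] *(2,4)] by blast
    also have "\<dots> = lan_value (OMap F j) (\<eta> j) d (lan_act E b d g p)"
      using lan_image_value_act[OF DE E(1) Fpre unit, OF ij(2,2,2) d(1) b *(3) p(1)] .
    finally show ?thesis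
      using lan_act_mem[OF Ecat DE[OF ij(2)] d(1) b *(3) p(1)] by (simp add: G_obj)
  qed
  let ?G = "\<lparr>OMap = G, AMap = (\<lambda>i j f. normalise E (G i) (AMap F i j f))\<rparr>"
  have G: "is_functor J (psh E) ?G"
  proof (rule functor_pshI[OF J.category_axioms Gpre])
    fix i j f assume ij: "i \<in> Obj J" "j \<in> Obj J" "f \<in> Hom J i j"
    show "natural E (G i) (G j) (AMap F i j f)"
      unfolding natural_def
    proof (intro conjI ballI G_map[OF ij])
      fix a b g x assume *: "a \<in> Obj E" "b \<in> Obj E" "g \<in> Hom E a b" "x \<in> OMap (G i) b"
      then show "AMap F i j f a (AMap (G i) b a g x) = AMap (G j) b a g (AMap F i j f b x)"
        using G_act[OF ij(1) *] G_act[OF ij(2) *(1-3) G_map[OF ij *(2,4)]] G_sub[OF ij(1) *(2,4)]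
          natural_act[OF Fnat[OF ij] Eobj[OF *(1)] Eobj[OF *(2)] Ehom[OF *(1-3)]] by simp
    qed
  next
    fix i assume "i \<in> Obj J"
    then show "agree E (G i) (AMap F i i (Ident J i)) (\<lambda>a x. x)"
      using functor_psh_ident[OF F] Eobj G_sub by (simp add: agree_def)
  next
    fix i j k f g assume *: "i \<in> Obj J" "j \<in> Obj J" "k \<in> Obj J" "f \<in> Hom J i j" "g \<in> Hom J j k"
    then show "agree E (G i) (AMap F i k (Comp J i j k g f)) (\<lambda>a x. AMap F j k g a (AMap F i j f a x))"
      using functor_psh_comp[OF F *] Eobj G_sub by (simp add: agree_def)
  qed
  obtain K k where K: "is_weighted_colimit J W (psh E) ?G K"
    and k: "natural_colimit E (elements J W) (?G \<circ>F elements_proj) K k"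
    using weighted_colimit_exists[OF Ecat JW G] .
  have "K \<in> phi_star \<Phi> E"
    using G_phi by (intro phi_star_colimit[OF JW G _ K]) simp
  moreover have "\<exists>\<zeta>. natural_lan E C K L \<zeta>"
  proof (rule lan_colimit[OF E(1) _ _ _ _ k l])
    fix p q f assume *: "p \<in> Obj (elements J W)" "q \<in> Obj (elements J W)" "f \<in> Hom (elements J W) p q"
    show "agree E (OMap (?G \<circ>F elements_proj) p) (\<lambda>d y. AMap (F \<circ>F elements_proj) p q f d y)
        (\<lambda>d y. AMap (?G \<circ>F elements_proj) p q f d y)"
      by (simp add: agree_def)
  next
    fix p assume "p \<in> Obj (elements J W)"
    then show "natural_lan E C (OMap (?G \<circ>F elements_proj) p) (OMap (F \<circ>F elements_proj) p) (\<lambda>d x. x)"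
      using F_lan by simp
  qed (simp_all add: diagram_elements functor_psh_diagram F G)
  moreover have "is_presheaf C L"
    using l by (simp add: natural_colimit_def natural_cocone_def)
  ultimately show ?thesis
    using E unfolding descends_def by blast
qed

lemma phi_star_iff_descends:
  fixes \<phi> :: "('o, 'm, 'u) presheaf"
  assumes C: "category C" and loc: "locally_small_cat (infty :: 'u rel) C"
  shows "\<phi> \<in> phi_star \<Phi> C \<longleftrightarrow> descends C \<phi>"
proof
  assume "\<phi> \<in> phi_star \<Phi> C"
  then have "\<phi> \<in> {\<phi>. descends C \<phi>}"
  proof (rule phi_star_induct)
    show "replete (psh C) {\<phi>. descends C \<phi>}"
      using descends_isomorphic[of C] by (auto simp: replete_def descends_def[of C, THEN iffD1])
    show "closed_under_colimits \<Phi> (psh C) {\<phi>. descends C \<phi>}"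
      unfolding closed_under_colimits_def using descends_colimit[OF C loc] by auto
  qed (use descends_representable[OF C loc] in simp)
  then show "descends C \<phi>"
    by simp
next
  assume "descends C \<phi>"
  then show "\<phi> \<in> phi_star \<Phi> C"
    unfolding descends_def using phi_star_lan[OF _ C loc] by blast
qed

end

theorem proposition4p7:
  fixes \<kappa> :: "'k rel"
    and \<Phi> :: "(('i, 'j) cat \<times> ('i, 'j, 'u) presheaf) set"
    and C :: "('o, 'm) cat"
    and \<phi> :: "('o, 'm, 'u) presheaf"
  assumes "regularCard (infty :: 'u rel)"
    and "Card_order \<kappa>" and "regularCard \<kappa>" and "natLeq <o \<kappa>" and "\<kappa> \<le>o (infty :: 'u rel)"
    and "\<forall>(J, W)\<in>\<Phi>. category J \<and> small_presheaf \<kappa> J W"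
    and "category C" and "locally_small_cat (infty :: 'u rel) C"
    and "is_presheaf C \<phi>"
  shows "(\<phi> \<in> phi_star \<Phi> C \<longleftrightarrow>
      (\<exists>D. subcategory D C \<and> small_cat \<kappa> D \<and>
        (\<exists>\<psi>\<in>phi_star \<Phi> D. is_left_kan_extension (opcat D) (opcat C) setcat inclusion \<psi> \<phi>)))
    \<and> (\<forall>D \<psi>. subcategory D C \<and> small_cat \<kappa> D \<and> \<psi> \<in> phi_star \<Phi> D \<and>
        is_left_kan_extension (opcat D) (opcat C) setcat inclusion \<psi> \<phi>
        \<longrightarrow> small_presheaf \<kappa> D \<psi>)"
proof -
  interpret regular_cardinal \<kappa>
    using assms(2-4) by (rule regular_cardinalI)
  interpret small_weights \<kappa> \<Phi>
  proof (intro small_weights.intro small_weights_axioms.intro regular_cardinal_axioms)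
    show "regular_cardinal (infty :: 'u rel)"
      using assms(1,4,5) by (rule regular_cardinal_infty)
  qed (use assms(4-6) in auto)
  have "is_left_kan_extension (opcat D) (opcat C) setcat inclusion \<psi> \<phi> \<longleftrightarrow> (\<exists>\<eta>. natural_lan D C \<psi> \<phi> \<eta>)"
    if "subcategory D C" "\<psi> \<in> phi_star \<Phi> D" for D and \<psi> :: "('o, 'm, 'u) presheaf"
    using is_left_kan_extension_iff[OF assms(7) that(1) phi_star_presheaf[OF that(2)] assms(9)] .
  then have "descends C \<phi> \<longleftrightarrow> (\<exists>D. subcategory D C \<and> small_cat \<kappa> D \<and>
      (\<exists>\<psi>\<in>phi_star \<Phi> D. is_left_kan_extension (opcat D) (opcat C) setcat inclusion \<psi> \<phi>))"
    unfolding descends_def using assms(9) by blast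
  then have "\<phi> \<in> phi_star \<Phi> C \<longleftrightarrow> (\<exists>D. subcategory D C \<and> small_cat \<kappa> D \<and>
      (\<exists>\<psi>\<in>phi_star \<Phi> D. is_left_kan_extension (opcat D) (opcat C) setcat inclusion \<psi> \<phi>))"
    using phi_star_iff_descends[OF assms(7,8)] by simp
  moreover have "small_presheaf \<kappa> D \<psi>" if "subcategory D C" "small_cat \<kappa> D" "\<psi> \<in> phi_star \<Phi> D"
    for D and \<psi> :: "('o, 'm, 'u) presheaf"
    using subcategory_category[OF that(1)] that(2,3) by (rule phi_star_small)
  ultimately show ?thesis
    by blast
qed

end
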